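(* For every integer $n\ge 3$, the number of binary rotation words of length $n+1$ is \[ f(n+1)=n^2+3n+4+\frac{1}{2}\sum_{p=3}^n \varphi(p)\,(n^2-p^2+n+p)-f_1(n)-2\sum_{l=2}^{n-1} f_2(n,l), \] where $\varphi$ is Euler's totient function, \[ f_1(n)=\begin{cases} 2 \sum_{i=k}^{2k}\sum_{p=1}^{i+1}\varphi(p), & \text{if } n=2k+1, \\ 2 \sum_{i=k}^{2k-1}\sum_{p=1}^{i+1}\varphi(p) + \sum_{p=1}^{k}\varphi(p), & \text{if } n=2k, \end{cases} \] \[ g(n,l)= n-l+1+(n \bmod (l+1)),\qquad h(n,l)=\min(l+1,n-l), \] and \[ f_2(n,l)=\left( \frac{1}{2}\left\lfloor \frac{n}{l+1} \right\rfloor g(n,l)-h(n,l)\right)(\varphi(l+1)-1)+h(n,l)\left( \frac{\varphi(l+1)}{2}-1 \right). \]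
   Context: For $\alpha,\beta,\gamma\in[0,1)$, the infinite binary rotation word $r=r_0r_1r_2\cdots$ is defined by $r_i=1$ if $\{i\alpha\}\in[\beta,\gamma)$ and $r_i=0$ otherwise, where $\{x\}$ is the fractional part and the interval $[\beta,\gamma)$ denotes the usual interval if $\beta<\gamma$ and denotes $[\beta,1)\cup[0,\gamma)$ otherwise. Write $r(\alpha,\beta,\gamma,n)=r_0\cdots r_{n-1}$ for its prefix of length $n$. A binary rotation word of length $n$ is any word of the form $r(\alpha,\beta,\gamma,n)$; $f(n)$ denotes the number of distinct binary rotation words of length $n$. *)

theory Defs
  imports Complex_Main "HOL-Number_Theory.Totient"
begin

(* If \<beta> = \<gamma>, the second branch yields the whole circle [0,1). *)
definition circle_interval :: "real \<Rightarrow> real \<Rightarrow> real set" where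
  "circle_interval \<beta> \<gamma> = (if \<beta> < \<gamma> then {\<beta>..<\<gamma>} else {\<beta>..<1} \<union> {0..<\<gamma>})"

definition rotation_letter :: "real \<Rightarrow> real \<Rightarrow> real \<Rightarrow> nat \<Rightarrow> nat" where
  "rotation_letter \<alpha> \<beta> \<gamma> i = (if frac (real i * \<alpha>) \<in> circle_interval \<beta> \<gamma> then 1 else 0)"

definition rotation_prefix :: "real \<Rightarrow> real \<Rightarrow> real \<Rightarrow> nat \<Rightarrow> nat list" where
  "rotation_prefix \<alpha> \<beta> \<gamma> n = map (rotation_letter \<alpha> \<beta> \<gamma>) [0..<n]"

definition rotation_words :: "nat \<Rightarrow> nat list set" where
  "rotation_words n =
     {rotation_prefix \<alpha> \<beta> \<gamma> n | \<alpha> \<beta> \<gamma>. \<alpha> \<in> {0..<1} \<and> \<beta> \<in> {0..<1} \<and> \<gamma> \<in> {0..<1}}"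

definition num_rotation_words :: "nat \<Rightarrow> nat" where
  "num_rotation_words n = card (rotation_words n)"

definition f1 :: "nat \<Rightarrow> nat" where
  "f1 n = (let k = n div 2 in
     if odd n then 2 * (\<Sum>i=k..2*k. \<Sum>p=1..i+1. totient p)
     else 2 * (\<Sum>i=k..2*k-1. \<Sum>p=1..i+1. totient p) + (\<Sum>p=1..k. totient p))"

definition g :: "nat \<Rightarrow> nat \<Rightarrow> real" where
  "g n l = real n - real l + 1 + real (n mod (l + 1))"

definition h :: "nat \<Rightarrow> nat \<Rightarrow> real" where
  "h n l = min (real l + 1) (real n - real l)"

definition f2 :: "nat \<Rightarrow> nat \<Rightarrow> real" where
  "f2 n l =
     (1 / 2 * real (n div (l + 1)) * g n l - h n l) * (real (totient (l + 1)) - 1)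
     + h n l * (real (totient (l + 1)) / 2 - 1)"

end

theory Submission
  imports Defs
begin

text \<open>
  Encode a word by the set \<open>S\<close> of positions of its ones in \<open>{0..n}\<close>. For a slope \<open>\<alpha>\<close>, a proper nonempty
  \<open>S\<close> is a rotation set iff there is an integer staircase \<open>U\<close> such that the offsets
  \<open>i \<alpha> - U i\<close> lie in a half-open unit interval and are smaller on \<open>S\<close> than on its complement. For fixed \<open>U\<close> this
  is a convex open condition on \<open>\<alpha>\<close>, so each pair \<open>(S, U)\<close> (with \<open>U\<close> up to constants) defines an
  interval of slopes, a cell, whose left end is a Farey fraction. By the reflection
  \<open>\<alpha> \<mapsto> 1 - \<alpha>\<close> only slopes below \<open>1/2\<close> matter. The cells with left end \<open>p/q\<close> are the
  \<open>n (n + 1)\<close> rotation sets just to the right of \<open>p/q\<close> minus the \<open>q (q - 1)\<close> ones at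
  \<open>p/q\<close>, which gives the total number of cells.

  It remains to subtract the multiplicities. If \<open>S\<close> belongs to two cells, then \<open>S\<close> or its complement
  is a singleton or an arithmetic progression of difference \<open>q \<ge> 3\<close>: otherwise consecutive elements
  of \<open>S\<close> with unequal gaps span unimodular lattice triangles, which determine \<open>U\<close> on \<open>S\<close>, and
  \<open>U\<close> on \<open>S\<close> determines \<open>U\<close>. A singleton \<open>{i}\<close> has one cell for each
  Farey fraction in \<open>[0, 1/2)\<close> with denominator at most \<open>max i (n - i)\<close>; a progression of difference
  \<open>q\<close> has, at each fraction \<open>p/q\<close>, one cell if it is a full residue class and two otherwise.
\<close>

text \<open>Each inequality in \<open>stair\<close> compares an integer with some (j - i) \<alpha>,
  where j - i is at most \<open>n\<close> in absolute value; this is why a cell can only end at a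
  fraction with denominator at most \<open>n\<close>. The difficulty is that words are to be counted
  and one word may have several cells. The bound 1/2 helps twice. Reflection keeps \<open>S\<close>,
  so each set would otherwise be met on both sides of 1/2; and below 1/2 the equation a B - b A = 1,
  up to sign, has at most one solution, which is why a unimodular triangle determines
  \<open>U\<close>. A slope with v distinct fractional parts has v (v - 1) rotation sets, one for
  each ordered pair of distinct orbit points; v is n + 1 next to p/q and q at p/q. In the final
  formula \<open>f1\<close> comes from the cells of singletons, \<open>f2 n l\<close> is the number
  of cells minus one summed over the progressions of difference l + 1, and the factor 2 before its
  sum accounts for complements.\<close>

definition offset :: "real \<Rightarrow> (nat \<Rightarrow> int) \<Rightarrow> nat \<Rightarrow> real" where
  "offset \<alpha> U i = real i * \<alpha> - of_int (U i)"

text \<open>Only pairs across the boundary of \<open>S\<close> are compared. For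
  \<open>proper\<close> \<open>S\<close> this already puts all offsets into the half-open unit
  interval that starts at the smallest offset on \<open>S\<close>. The inequalities are strict and
  affine in \<alpha>, hence cells are open and convex.\<close>

definition stair :: "nat \<Rightarrow> real \<Rightarrow> (nat \<Rightarrow> int) \<Rightarrow> nat set \<Rightarrow> bool" where
  "stair n \<alpha> U S \<longleftrightarrow>
     (\<forall>i\<in>S. \<forall>j\<in>{..n} - S. offset \<alpha> U i < offset \<alpha> U j \<and> offset \<alpha> U j < offset \<alpha> U i + 1)"

definition proper :: "nat \<Rightarrow> nat set \<Rightarrow> bool" where
  "proper n S \<longleftrightarrow> S \<subseteq> {..n} \<and> S \<noteq> {} \<and> S \<noteq> {..n}"

lemma stairD:
  assumes "stair n \<alpha> U S" "i \<in> S" "j \<le> n" "j \<notin> S"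
  shows "offset \<alpha> U i < offset \<alpha> U j" "offset \<alpha> U j < offset \<alpha> U i + 1"
  using assms by (auto simp: stair_def)

section \<open>Symmetries of staircases\<close>

lemma stair_shift:
  assumes "stair n \<alpha> U S" "S \<subseteq> {..n}" "\<And>i. i \<le> n \<Longrightarrow> U' i = U i + c"
  shows "stair n \<alpha> U' S"
  unfolding stair_def
proof (intro ballI)
  fix i j assume ij: "i \<in> S" "j \<in> {..n} - S"
  hence "U' i = U i + c" "U' j = U j + c" using assms by auto
  thus "offset \<alpha> U' i < offset \<alpha> U' j \<and> offset \<alpha> U' j < offset \<alpha> U' i + 1"
    using stairD[OF assms(1) ij(1), of j] ij by (simp add: offset_def)
qed

lemma proper_obtain:
  assumes "proper n S"
  obtains i j where "i \<in> S" "i \<le> n" "j \<le> n" "j \<notin> S"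
  using assms by (auto simp: proper_def)

lemma proper_compl: "proper n S \<Longrightarrow> proper n ({..n} - S)"
  by (auto simp: proper_def)

lemma compl_compl: "S \<subseteq> {..n} \<Longrightarrow> {..n} - ({..n} - S) = (S :: nat set)"
  by auto

text \<open>Lowering \<open>U\<close> by 1 on \<open>S\<close> lifts these offsets by 1, past those
  of the complement but by less than a full turn.\<close>

lemma stair_compl:
  assumes "stair n \<alpha> U S"
  shows "stair n \<alpha> (\<lambda>i. U i - of_bool (i \<in> S)) ({..n} - S)"
  using assms by (auto simp: stair_def offset_def algebra_simps)

text \<open>Negation reverses the order of the offsets; the extra 1 on \<open>S\<close> moves
  \<open>S\<close> back below its complement, so that the two inequalities of \<open>stair\<close>
  trade places. Together with \<open>stair_add_int\<close> this is the reflection at 1/2, and it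
  keeps \<open>S\<close>.\<close>

lemma stair_neg:
  assumes "stair n \<alpha> U S"
  shows "stair n (- \<alpha>) (\<lambda>i. of_bool (i \<in> S) - U i) S"
  using assms by (fastforce simp: stair_def offset_def algebra_simps)

lemma stair_add_int:
  assumes "stair n \<alpha> U S"
  shows "stair n (\<alpha> + of_int m) (\<lambda>i. U i + int i * m) S"
  using assms by (simp add: stair_def offset_def algebra_simps)

definition flip :: "nat \<Rightarrow> nat set \<Rightarrow> nat set" where
  "flip n S = {i. i \<le> n \<and> n - i \<in> S}"

lemma mem_flip: "i \<in> flip n S \<longleftrightarrow> i \<le> n \<and> n - i \<in> S"
  by (simp add: flip_def)

text \<open>Reversing a word negates the slope, up to a common shift of all offsets by n \<alpha>,
  and \<open>stair_neg\<close> undoes the negation. Results about the right end of \<open>S\<close>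
  thus transfer to its left end at the same slope.\<close>

lemma stair_flip:
  assumes "stair n \<alpha> U S"
  shows "stair n \<alpha> (\<lambda>i. of_bool (i \<in> flip n S) - U (n - i)) (flip n S)"
proof -
  have "stair n (-\<alpha>) (\<lambda>i. U (n - i)) (flip n S)"
    unfolding stair_def
  proof (intro ballI)
    fix i j assume "i \<in> flip n S" "j \<in> {..n} - flip n S"
    hence *: "i \<le> n" "n - i \<in> S" "j \<le> n" "n - j \<notin> S" by (simp_all add: mem_flip)
    have o: "offset (-\<alpha>) (\<lambda>i. U (n - i)) k = offset \<alpha> U (n - k) - real n * \<alpha>" if "k \<le> n" for k
    proof -
      have "real (n - k) * \<alpha> = (real n - real k) * \<alpha>" using that by (simp add: of_nat_diff)
      also have "\<dots> = real n * \<alpha> - real k * \<alpha>" by (rule left_diff_distrib)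
      finally show ?thesis by (simp add: offset_def)
    qed
    show "offset (-\<alpha>) (\<lambda>i. U (n - i)) i < offset (-\<alpha>) (\<lambda>i. U (n - i)) j \<and>
       offset (-\<alpha>) (\<lambda>i. U (n - i)) j < offset (-\<alpha>) (\<lambda>i. U (n - i)) i + 1"
      using stairD[OF assms *(2) _ *(4)] *(1,3) by (simp add: o)
  qed
  from stair_neg[OF this] show ?thesis by simp
qed

lemma proper_flip: 
  assumes "proper n S" shows "proper n (flip n S)"
proof -
  obtain i j where "i \<in> S" "i \<le> n" "j \<le> n" "j \<notin> S" using proper_obtain[OF assms] by blast
  hence "n - i \<in> flip n S" "n - j \<notin> flip n S" "n - j \<in> {..n}" by (simp_all add: mem_flip)
  moreover have "flip n S \<subseteq> {..n}" by (simp add: flip_def subset_eq)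
  ultimately show ?thesis unfolding proper_def by blast
qed

section \<open>Dependence of a staircase on the slope\<close>

lemma stair_convex:
  assumes "stair n \<alpha> U S" "stair n \<beta> U S" "\<alpha> \<le> x" "x \<le> \<beta>"
  shows "stair n x U S"
proof (cases "\<alpha> = \<beta>")
  case True thus ?thesis using assms by simp
next
  case False
  define t where "t = (x - \<alpha>) / (\<beta> - \<alpha>)"
  have pos: "\<beta> - \<alpha> > 0" using assms(3,4) False by linarith
  have t: "0 \<le> t" "t \<le> 1" using assms(3,4) pos by (simp_all add: t_def)
  have "t * (\<beta> - \<alpha>) = x - \<alpha>" using pos by (simp add: t_def)
  hence x: "x = (1 - t) * \<alpha> + t * \<beta>" by (simp add: algebra_simps)
  have o: "offset x U i = (1 - t) * offset \<alpha> U i + t * offset \<beta> U i" for i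
    by (simp add: offset_def x algebra_simps)
  have cv: "(1 - t) * a + t * b < (1 - t) * c + t * d" if "a < c" "b < d" for a b c d :: real
  proof (cases "t = 0")
    case False
    have "(1 - t) * a \<le> (1 - t) * c" using that t by (intro mult_left_mono) auto
    moreover have "t * b < t * d" using that t False by auto
    ultimately show ?thesis by linarith
  qed (use that in auto)
  show ?thesis unfolding stair_def
  proof (intro ballI)
    fix i j assume "i \<in> S" "j \<in> {..n} - S"
    hence 1: "offset \<alpha> U i < offset \<alpha> U j" "offset \<alpha> U j < offset \<alpha> U i + 1"
      and 2: "offset \<beta> U i < offset \<beta> U j" "offset \<beta> U j < offset \<beta> U i + 1"
      using assms by (auto simp: stair_def)
    show "offset x U i < offset x U j \<and> offset x U j < offset x U i + 1"
      using cv[OF 1(1) 2(1)] cv[OF 1(2) 2(2)] by (simp add: o algebra_simps)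
  qed
qed

lemma stair_open:
  assumes "stair n \<alpha> U S" "S \<subseteq> {..n}"
  shows "\<exists>\<delta>>0. \<forall>x. \<bar>x - \<alpha>\<bar> < \<delta> \<longrightarrow> stair n x U S"
proof -
  have fin: "finite S" using assms(2) finite_subset by blast
  have lim: "((\<lambda>x. offset x U i) \<longlongrightarrow> offset \<alpha> U i) (nhds \<alpha>)" for i
    unfolding offset_def by (intro tendsto_intros filterlim_ident)
  have "eventually (\<lambda>x. offset x U i < offset x U j \<and> offset x U j < offset x U i + 1) (nhds \<alpha>)"
    if "i \<in> S" "j \<in> {..n} - S" for i j
  proof -
    have 1: "((\<lambda>x. offset x U j - offset x U i) \<longlongrightarrow> offset \<alpha> U j - offset \<alpha> U i) (nhds \<alpha>)"
      by (intro tendsto_diff lim)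
    have "offset \<alpha> U j - offset \<alpha> U i > 0" "offset \<alpha> U j - offset \<alpha> U i < 1"
      using stairD[OF assms(1), of i j] that by auto
    from order_tendstoD(1)[OF 1 this(1)] order_tendstoD(2)[OF 1 this(2)]
    show ?thesis by eventually_elim auto
  qed
  hence "eventually (\<lambda>x. stair n x U S) (nhds \<alpha>)"
    unfolding stair_def by (intro eventually_ball_finite ballI fin) auto
  thus ?thesis by (auto simp: eventually_nhds_metric dist_real_def)
qed

text \<open>For \<open>i\<close> in \<open>S\<close> and \<open>j\<close> outside, U j - U i is the
  floor of (j - i) \<alpha>; all other pairs are compared through a point on the other side.\<close>

lemma stair_unique:
  assumes "stair n \<alpha> U S" "stair n \<alpha> U' S" "proper n S" "k \<le> n" "l \<le> n"
  shows "U k - U' k = U l - U' l"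
proof -
  have *: "U i - U' i = U j - U' j" if "i \<in> S" "j \<le> n" "j \<notin> S" for i j
  proof -
    have "real_of_int (U j - U i) < (real j - real i) * \<alpha>"
      "(real j - real i) * \<alpha> < real_of_int (U j - U i) + 1"
      "real_of_int (U' j - U' i) < (real j - real i) * \<alpha>"
      "(real j - real i) * \<alpha> < real_of_int (U' j - U' i) + 1"
      using stairD[OF assms(1) that] stairD[OF assms(2) that]
      by (auto simp: offset_def algebra_simps)
    hence "U j - U i = U' j - U' i" by linarith
    thus ?thesis by linarith
  qed
  obtain i j where ij: "i \<in> S" "i \<le> n" "j \<le> n" "j \<notin> S" using proper_obtain[OF assms(3)] by blast
  have "U m - U' m = U i - U' i" if "m \<le> n" for m
    using *[of i j] *[of m j] *[of i m] ij that by (cases "m \<in> S") auto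
  thus ?thesis using assms by simp
qed

text \<open>No fraction with denominator at most \<open>n\<close> separates \<open>\<beta>\<close> from \<open>\<alpha>\<close>; one may lie at
  \<open>\<alpha>\<close>, but none at \<open>\<beta>\<close> unless \<open>\<alpha> = \<beta>\<close>.\<close>
definition sees :: "nat \<Rightarrow> real \<Rightarrow> real \<Rightarrow> bool" where
  "sees n \<alpha> \<beta> \<longleftrightarrow> (\<forall>b\<in>{1..n}. \<forall>a::int.
     (of_int a < real b * \<alpha> \<longrightarrow> of_int a < real b * \<beta>) \<and>
     (real b * \<alpha> < of_int a \<longrightarrow> real b * \<beta> < of_int a))"

lemma sees_int:
  assumes "sees n \<alpha> \<beta>" "\<bar>e\<bar> \<le> int n" "of_int a < of_int e * \<alpha>"
  shows "of_int a < of_int e * \<beta>"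
proof -
  consider "e = 0" | "e > 0" | "e < 0" by linarith
  thus ?thesis
  proof cases
    case 2
    hence "nat e \<in> {1..n}" "real (nat e) = of_int e" using assms(2) by auto
    thus ?thesis using assms(1,3) unfolding sees_def by metis
  next
    case 3
    hence e: "nat (-e) \<in> {1..n}" "real (nat (-e)) = - of_int e" using assms(2) by auto
    have "real (nat (-e)) * \<alpha> < of_int (-a)" using e assms(3) by simp
    hence "real (nat (-e)) * \<beta> < of_int (-a)" using assms(1) e(1) unfolding sees_def by blast
    thus ?thesis using e by simp
  qed (use assms in auto)
qed

text \<open>Each inequality of \<open>stair\<close> says that an integer is less than e \<alpha> for
  some integer e between -n and n; \<open>sees\<close> preserves these.\<close>

lemma stair_sees:
  assumes "sees n \<alpha> \<beta>" "stair n \<alpha> U S" "S \<subseteq> {..n}"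
  shows "stair n \<beta> U S"
  unfolding stair_def
proof (intro ballI)
  fix i j assume ij: "i \<in> S" "j \<in> {..n} - S"
  hence le: "\<bar>int j - int i\<bar> \<le> int n" "\<bar>int i - int j\<bar> \<le> int n" using assms(3) by auto
  have "offset \<alpha> U i < offset \<alpha> U j" "offset \<alpha> U j < offset \<alpha> U i + 1"
    using assms ij by (auto simp: stair_def)
  hence "of_int (U j - U i) < of_int (int j - int i) * \<alpha>"
     "of_int (U i - U j - 1) < of_int (int i - int j) * \<alpha>"
    by (auto simp: offset_def algebra_simps)
  from sees_int[OF assms(1) le(1) this(1)] sees_int[OF assms(1) le(2) this(2)]
  show "offset \<beta> U i < offset \<beta> U j \<and> offset \<beta> U j < offset \<beta> U i + 1"
    by (auto simp: offset_def algebra_simps)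
qed

text \<open>The source of the contradictions with \<open>consec\<close>: a lattice point whose
  offset fits the window of \<open>S\<close> belongs to \<open>S\<close>. If the column
  \<open>i\<close> were outside \<open>S\<close>, taking j = i would put the integer
  \<open>k\<close> strictly between U i and U i + 1.\<close>

lemma stair_lattice_point:
  assumes st: "stair n \<alpha> U S" and pr: "proper n S" and i: "i \<le> n"
    and y: "\<And>j. j \<le> n \<Longrightarrow> j \<notin> S \<Longrightarrow>
      real i * \<alpha> - of_int k < offset \<alpha> U j \<and> offset \<alpha> U j < real i * \<alpha> - of_int k + 1"
  shows "i \<in> S \<and> U i = k"
proof -
  have S: "i \<in> S"
  proof (rule ccontr)
    assume "i \<notin> S"
    from y[OF i this] have "U i < k" "k < U i + 1"
      unfolding offset_def by linarith+
    thus False by linarith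
  qed
  obtain j where "j \<le> n" "j \<notin> S" using proper_obtain[OF pr] by blast
  from y[OF this] stairD[OF st S this] have "U i = k" by (simp add: offset_def)
  with S show ?thesis by blast
qed

section \<open>Consecutive elements of a rotation set\<close>

definition consec :: "nat set \<Rightarrow> nat \<Rightarrow> nat \<Rightarrow> bool" where
  "consec S s t \<longleftrightarrow> s \<in> S \<and> t \<in> S \<and> s < t \<and> (\<forall>x\<in>S. \<not> (s < x \<and> x < t))"

text \<open>If (t - s, U t - U s) were a proper multiple of a lattice vector, adding that vector
  once at \<open>s\<close> would give a lattice point in a column strictly between, with offset
  between those of \<open>s\<close> and \<open>t\<close>.\<close>

lemma consec_gcd:
  assumes st: "stair n \<alpha> U S" and pr: "proper n S" and c: "consec S s t"
  shows "coprime (int t - int s) (U t - U s)"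
proof (rule ccontr)
  assume nc: "\<not> coprime (int t - int s) (U t - U s)"
  define g where "g = gcd (int t - int s) (U t - U s)"
  have lt: "s < t" and S: "s \<in> S" "t \<in> S" using c by (auto simp: consec_def)
  have "g > 0" using lt by (simp add: g_def)
  moreover have "g \<noteq> 1" using nc by (simp add: g_def coprime_iff_gcd_eq_1)
  ultimately have g: "g \<ge> 2" by linarith
  obtain a A where a: "int t - int s = g * a" and A: "U t - U s = g * A"
    by (metis g_def gcd_dvd1 gcd_dvd2 dvdE)
  have apos: "a > 0" using lt g a by (metis diff_gt_0_iff_gt of_nat_less_iff zero_less_mult_pos \<open>g > 0\<close>)
  have alt: "a < g * a" using apos g by simp
  define i where "i = s + nat a"
  have ii: "int i = int s + a" using apos by (simp add: i_def)
  have i: "real i = real s + of_int a" using apos by (simp add: i_def)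
  have i2: "s < i" "i < t" using apos alt a ii by linarith+
  have tn: "t \<le> n" using S pr by (auto simp: proper_def)
  have r1: "real t = real s + of_int g * of_int a"
  proof -
    have "of_int (int t - int s) = (of_int (g * a) :: real)" using a by simp
    thus ?thesis by simp
  qed
  have r2: "of_int (U t) = of_int (U s) + of_int g * (of_int A :: real)"
  proof -
    have "of_int (U t - U s) = (of_int (g * A) :: real)" using A by simp
    thus ?thesis by simp
  qed
  define \<epsilon> where "\<epsilon> = of_int a * \<alpha> - of_int A"
  have ot: "offset \<alpha> U t = offset \<alpha> U s + of_int g * \<epsilon>"
    by (simp add: offset_def r1 r2 \<epsilon>_def algebra_simps)
  have oi: "real i * \<alpha> - of_int (U s + A) = offset \<alpha> U s + \<epsilon>"
    by (simp add: offset_def i \<epsilon>_def algebra_simps)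
  have "i \<in> S \<and> U i = U s + A"
  proof (rule stair_lattice_point[OF st pr])
    show "i \<le> n" using i2 tn by simp
    fix j assume j: "j \<le> n" "j \<notin> S"
    have s1: "offset \<alpha> U s < offset \<alpha> U j" "offset \<alpha> U j < offset \<alpha> U s + 1"
      and t1: "offset \<alpha> U t < offset \<alpha> U j" "offset \<alpha> U j < offset \<alpha> U t + 1"
      using stairD[OF st S(1) j] stairD[OF st S(2) j] by auto
    have "\<epsilon> \<le> of_int g * \<epsilon> \<and> 0 \<le> \<epsilon> \<or> of_int g * \<epsilon> \<le> \<epsilon> \<and> \<epsilon> \<le> 0"
    proof (cases "\<epsilon> \<ge> 0")
      case True
      thus ?thesis using mult_right_mono[of 1 "of_int g" \<epsilon>] g by simp
    next
      case False
      thus ?thesis using mult_right_mono_neg[of 1 "of_int g" \<epsilon>] g by simp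
    qed
    thus "real i * \<alpha> - of_int (U s + A) < offset \<alpha> U j \<and> offset \<alpha> U j < real i * \<alpha> - of_int (U s + A) + 1"
      unfolding oi using s1 t1 ot by linarith
  qed
  thus False using c i2 by (auto simp: consec_def)
qed

text \<open>If the triangle spanned by three consecutive points had determinant at least 2, it would
  contain a further lattice point, in a column strictly between the outer ones.\<close>
lemma consec_det_less_2:
  assumes st: "stair n \<alpha> U S" and pr: "proper n S"
    and c1: "consec S s t" and c2: "consec S t u"
  shows "(int t - int s) * (U u - U t) - (int u - int t) * (U t - U s) < 2"
proof (rule ccontr)
  define a where "a = int t - int s"
  define A where "A = U t - U s"
  define c where "c = int u - int s"
  define C where "C = U u - U s"
  define \<Delta> where "\<Delta> = a * C - c * A"
  assume "\<not> ?thesis"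
  hence \<Delta>: "\<Delta> \<ge> 2" by (simp add: \<Delta>_def a_def A_def c_def C_def algebra_simps)
  have lt: "s < t" "t < u" and S: "s \<in> S" "t \<in> S" "u \<in> S" using c1 c2 by (auto simp: consec_def)
  have un: "u \<le> n" using S pr by (auto simp: proper_def)
  have ac: "0 < a" "a < c" using lt by (auto simp: a_def c_def)
  have "coprime a A" using consec_gcd[OF st pr c1] by (simp add: a_def A_def)
  then obtain x y where xy: "a * x + A * y = 1"
    using bezout_int[of a A] by (auto simp: mult.commute)
  define E0 where "E0 = x"
  define e0 where "e0 = - y"
  \<comment> \<open>Subtracting multiples of (a, A) keeps the determinant with (a, A) equal to 1 and
    changes e C - c E by multiples of \<Delta>; this choice reduces it modulo \<Delta>.\<close>
  define k where "k = (e0 * C - c * E0) div \<Delta>"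
  define e where "e = e0 - k * a"
  define E where "E = E0 - k * A"
  define l where "l = e * C - c * E"
  have 1: "a * E - e * A = 1" using xy by (simp add: e_def E_def e0_def E0_def algebra_simps)
  have "l = (e0 * C - c * E0) - k * \<Delta>" by (simp add: l_def e_def E_def \<Delta>_def algebra_simps)
  hence "l = (e0 * C - c * E0) mod \<Delta>" by (simp add: k_def minus_div_mult_eq_mod)
  hence l: "0 \<le> l" "l < \<Delta>" using \<Delta> by auto
  \<comment> \<open>In both coordinates, (e, E) is l / \<Delta> times (a, A) plus 1 / \<Delta> times
    (c, C). Since l + 1 is at most \<Delta>, the new point lies in the triangle.\<close>
  have le: "\<Delta> * e = l * a + c"
  proof -
    have "l * a + c * (a * E - e * A) = \<Delta> * e" by (simp add: l_def \<Delta>_def algebra_simps)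
    thus ?thesis using 1 by simp
  qed
  have lE: "\<Delta> * E = l * A + C"
  proof -
    have "l * A + C * (a * E - e * A) = \<Delta> * E" by (simp add: l_def \<Delta>_def algebra_simps)
    thus ?thesis using 1 by simp
  qed
  have "\<Delta> * e > 0" using l ac le by (smt (verit) mult_nonneg_nonneg)
  hence epos: "e > 0" using \<Delta> by (simp add: zero_less_mult_iff)
  have "\<Delta> * e < \<Delta> * c"
  proof -
    have "l * a \<le> (\<Delta> - 1) * a" using l ac by (intro mult_right_mono) auto
    also have "\<dots> < (\<Delta> - 1) * c" using \<Delta> ac by simp
    finally show ?thesis using le by (simp add: algebra_simps)
  qed
  hence ec: "e < c" using \<Delta> by simp
  define i where "i = s + nat e"
  have i: "real i = real s + of_int e" "s < i" "i < u" "int i = int s + e"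
    using epos ec by (auto simp: i_def c_def)
  define \<epsilon>a where "\<epsilon>a = of_int a * \<alpha> - of_int A"
  define \<epsilon>c where "\<epsilon>c = of_int c * \<alpha> - of_int C"
  define \<epsilon> where "\<epsilon> = of_int e * \<alpha> - of_int E"
  have ot: "offset \<alpha> U t = offset \<alpha> U s + \<epsilon>a"
    by (simp add: offset_def \<epsilon>a_def a_def A_def algebra_simps)
  have ou: "offset \<alpha> U u = offset \<alpha> U s + \<epsilon>c"
    by (simp add: offset_def \<epsilon>c_def c_def C_def algebra_simps)
  have oi: "real i * \<alpha> - of_int (U s + E) = offset \<alpha> U s + \<epsilon>"
    by (simp add: offset_def i \<epsilon>_def algebra_simps)
  have comb: "of_int \<Delta> * \<epsilon> = of_int l * \<epsilon>a + \<epsilon>c"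
  proof -
    have "of_int \<Delta> * \<epsilon> = of_int (\<Delta> * e) * \<alpha> - of_int (\<Delta> * E)"
      by (simp add: \<epsilon>_def algebra_simps)
    also have "\<dots> = of_int l * \<epsilon>a + \<epsilon>c"
      unfolding le lE by (simp add: \<epsilon>a_def \<epsilon>c_def algebra_simps)
    finally show ?thesis .
  qed
  have "i \<in> S \<and> U i = U s + E"
  proof (rule stair_lattice_point[OF st pr])
    show "i \<le> n" using i un by simp
    fix j assume j: "j \<le> n" "j \<notin> S"
    define z where "z = offset \<alpha> U j - offset \<alpha> U s"
    have z: "0 < z" "z < 1" "\<epsilon>a < z" "z < \<epsilon>a + 1" "\<epsilon>c < z" "z < \<epsilon>c + 1"
      using stairD[OF st S(1) j] stairD[OF st S(2) j] stairD[OF st S(3) j] ot ou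
      by (auto simp: z_def)
    have D: "real_of_int \<Delta> > 0" "real_of_int l \<ge> 0" "real_of_int l + 1 \<le> of_int \<Delta>"
      using l \<Delta> by linarith+
    have "of_int l * \<epsilon>a + \<epsilon>c < of_int l * z + z"
      using mult_left_mono[of \<epsilon>a z "of_int l"] z D by linarith
    also have "\<dots> = (of_int l + 1) * z" by (simp add: algebra_simps)
    also have "\<dots> \<le> of_int \<Delta> * z" using D z by (intro mult_right_mono) auto
    finally have up: "\<epsilon> < z" using D comb by (metis mult_less_cancel_left_pos)
    have "of_int \<Delta> * (z - 1) \<le> (of_int l + 1) * (z - 1)" using D z by (intro mult_right_mono_neg) auto
    also have "\<dots> = of_int l * (z - 1) + (z - 1)" by (simp add: algebra_simps)
    also have "\<dots> < of_int l * \<epsilon>a + \<epsilon>c"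
      using mult_left_mono[of "z - 1" \<epsilon>a "of_int l"] z D by linarith
    finally have "z - 1 < \<epsilon>" using D comb by (metis mult_less_cancel_left_pos)
    with up show "real i * \<alpha> - of_int (U s + E) < offset \<alpha> U j
        \<and> offset \<alpha> U j < real i * \<alpha> - of_int (U s + E) + 1"
      unfolding oi by (simp add: z_def)
  qed
  hence iS: "i \<in> S" and Ui: "U i = U s + E" by auto
  \<comment> \<open>Only \<open>t\<close> is available strictly between \<open>s\<close> and
    \<open>u\<close>, but then (e, E) = (a, A) would have determinant 0 with (a, A) instead of
    1.\<close>
  have "i = t" using iS i c1 c2 by (metis consec_def linorder_neqE_nat)
  hence "e = a" "E = A" using i Ui by (auto simp: a_def A_def)
  thus False using 1 by simp
qed

lemma consec_det:
  assumes st: "stair n \<alpha> U S" and pr: "proper n S"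
    and c1: "consec S s t" and c2: "consec S t u"
  shows "\<bar>(int t - int s) * (U u - U t) - (int u - int t) * (U t - U s)\<bar> \<le> 1"
proof -
  have S: "s \<in> S" "t \<in> S" "u \<in> S" using c1 c2 by (auto simp: consec_def)
  have "(int t - int s) * (U t - U u) - (int u - int t) * (U s - U t) < 2"
    using consec_det_less_2[OF stair_neg[OF st] pr c1 c2] S by simp
  hence "- ((int t - int s) * (U u - U t) - (int u - int t) * (U t - U s)) < 2"
    by (simp add: algebra_simps)
  with consec_det_less_2[OF st pr c1 c2] show ?thesis by linarith
qed

text \<open>Otherwise the longer gap would contain the translate of an end point by the shorter step.\<close>
lemma consec_opposite:
  assumes st: "stair n \<alpha> U S" and pr: "proper n S"
    and c1: "consec S s t" and c2: "consec S t u" and ne: "t - s \<noteq> u - t"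
  shows "offset \<alpha> U s < offset \<alpha> U t \<and> offset \<alpha> U u < offset \<alpha> U t \<or>
         offset \<alpha> U t < offset \<alpha> U s \<and> offset \<alpha> U t < offset \<alpha> U u"
proof -
  have lt: "s < t" "t < u" and S: "s \<in> S" "t \<in> S" "u \<in> S" using c1 c2 by (auto simp: consec_def)
  have un: "u \<le> n" using S pr by (auto simp: proper_def)
  consider "t - s > u - t" | "t - s < u - t" using ne by linarith
  thus ?thesis
  proof cases
    case 1
    define i where "i = s + (u - t)"
    \<comment> \<open>The fourth vertex of a parallelogram on the three points: its offset is that
      of \<open>s\<close> plus that of \<open>u\<close> minus that of \<open>t\<close>. If the
      offset of \<open>t\<close> lay between the other two, so would this one, and \<open>i\<close>
      would belong to \<open>S\<close>.\<close>
    define k where "k = U s + (U u - U t)"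
    have i: "i \<le> n" "s < i" "i < t" "real i = real s + real u - real t"
      using 1 lt un by (auto simp: i_def)
    hence "i \<notin> S" using c1 by (auto simp: consec_def)
    with stair_lattice_point[OF st pr i(1), of k] obtain j where j: "j \<le> n" "j \<notin> S" and
      nf: "\<not> (real i * \<alpha> - of_int k < offset \<alpha> U j \<and> offset \<alpha> U j < real i * \<alpha> - of_int k + 1)" by blast
    have "real i * \<alpha> - of_int k = offset \<alpha> U s + offset \<alpha> U u - offset \<alpha> U t"
      by (simp add: offset_def i k_def algebra_simps)
    thus ?thesis using nf stairD[OF st S(1) j] stairD[OF st S(2) j] stairD[OF st S(3) j] by linarith
  next
    case 2
    define i where "i = u - (t - s)"
    define k where "k = U u - (U t - U s)"
    have i: "i \<le> n" "t < i" "i < u" "real i = real u - real t + real s"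
      using 2 lt un by (auto simp: i_def)
    hence "i \<notin> S" using c2 by (auto simp: consec_def)
    with stair_lattice_point[OF st pr i(1), of k] obtain j where j: "j \<le> n" "j \<notin> S" and
      nf: "\<not> (real i * \<alpha> - of_int k < offset \<alpha> U j \<and> offset \<alpha> U j < real i * \<alpha> - of_int k + 1)" by blast
    have "real i * \<alpha> - of_int k = offset \<alpha> U u - offset \<alpha> U t + offset \<alpha> U s"
      by (simp add: offset_def i k_def algebra_simps)
    thus ?thesis using nf stairD[OF st S(1) j] stairD[OF st S(2) j] stairD[OF st S(3) j] by linarith
  qed
qed

text \<open>For two equal gaps the determinant is a multiple of the gap. Being at most 1 in absolute
  value, it vanishes as soon as the gap is at least 2.\<close>

lemma consec_equal_gap:
  assumes st: "stair n \<alpha> U S" and pr: "proper n S"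
    and c1: "consec S s t" and c2: "consec S t u" and eq: "t - s = u - t" "t - s \<ge> 2"
  shows "U u - U t = U t - U s"
proof -
  have lt: "s < t" "t < u" using c1 c2 by (auto simp: consec_def)
  define a where "a = int t - int s"
  have a: "int u - int t = a" "a \<ge> 2" using eq lt by (auto simp: a_def)
  have "\<bar>a * (U u - U t - (U t - U s))\<bar> \<le> 1"
    using consec_det[OF st pr c1 c2] a by (simp add: a_def[symmetric] algebra_simps)
  hence "a * \<bar>U u - U t - (U t - U s)\<bar> \<le> 1" using a by (simp add: abs_mult)
  hence "\<bar>U u - U t - (U t - U s)\<bar> < 1"
    using a mult_left_mono[of 1 "\<bar>U u - U t - (U t - U s)\<bar>" a] by linarith
  thus ?thesis by linarith
qed

text \<open>A fraction strictly between the Farey neighbours A / a and B / b has denominator at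
  least a + b. As \<open>a\<close> and \<open>b\<close> differ, this is at least 3, so neither 0 nor
  1/2 separates the two, and both lie in [0, 1/2] along with \<alpha>.\<close>

lemma farey_pair_half:
  fixes a b A B :: int and \<alpha> :: real
  assumes ab: "a \<ge> 1" "b \<ge> 1" "a \<noteq> b" and det: "a * B - b * A = 1"
    and \<alpha>: "0 < \<alpha>" "\<alpha> < 1 / 2" and A: "of_int A < of_int a * \<alpha>" and B: "of_int b * \<alpha> < of_int B"
  shows "0 \<le> A \<and> 2 * A \<le> a \<and> 0 \<le> B \<and> 2 * B \<le> b"
proof -
  have "0 < of_int b * \<alpha>" using ab \<alpha> by simp
  hence "0 < real_of_int B" using B by linarith
  hence Bpos: "B \<ge> 1" by simp
  have "of_int a * \<alpha> < of_int a * (1 / 2)" using ab \<alpha> by simp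
  hence "real_of_int (2 * A) < of_int a" using A by simp
  hence A2: "2 * A < a" by linarith
  have A0: "A \<ge> 0"
  proof (rule ccontr)
    assume "\<not> A \<ge> 0"
    hence "b * A \<le> b * (-1)" using ab by (intro mult_left_mono) auto
    moreover have "a * 1 \<le> a * B" using ab Bpos by (intro mult_left_mono) auto
    ultimately show False using det ab by linarith
  qed
  have "2 * B \<le> b"
  proof (rule ccontr)
    assume "\<not> 2 * B \<le> b"
    hence "a * (b + 1) \<le> a * (2 * B)" using ab by (intro mult_left_mono) auto
    moreover have "b * (2 * A) \<le> b * (a - 1)" using ab A2 by (intro mult_left_mono) auto
    ultimately have "a * (b + 1) - b * (a - 1) \<le> 2" using det by linarith
    hence "a + b \<le> 2" by (simp add: algebra_simps)
    thus False using ab by linarith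
  qed
  thus ?thesis using A0 A2 Bpos by linarith
qed

text \<open>A peak or valley at \<open>t\<close> puts A / a and B / b on opposite sides of \<alpha>.
  The determinant is then nonzero, hence 1 or -1 by \<open>consec_det\<close>, and the fractions are
  Farey neighbours around a slope below 1/2.\<close>

lemma consec_triple_bounds:
  assumes st: "stair n \<alpha> U S" and pr: "proper n S" and \<alpha>: "0 < \<alpha>" "\<alpha> < 1 / 2"
    and c1: "consec S s t" and c2: "consec S t u" and ne: "t - s \<noteq> u - t"
  defines "a \<equiv> int t - int s" and "b \<equiv> int u - int t" and "A \<equiv> U t - U s" and "B \<equiv> U u - U t"
  shows "\<bar>a * B - b * A\<bar> = 1 \<and> 0 \<le> A \<and> 2 * A \<le> a \<and> 0 \<le> B \<and> 2 * B \<le> b"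
proof -
  have lt: "s < t" "t < u" using c1 c2 by (auto simp: consec_def)
  have ab: "a \<ge> 1" "b \<ge> 1" "a \<noteq> b" using lt ne by (auto simp: a_def b_def)
  have det: "\<bar>a * B - b * A\<bar> \<le> 1" using consec_det[OF st pr c1 c2] by (simp add: a_def b_def A_def B_def)
  have oa: "offset \<alpha> U t - offset \<alpha> U s = of_int a * \<alpha> - of_int A"
    and ob: "offset \<alpha> U u - offset \<alpha> U t = of_int b * \<alpha> - of_int B"
    by (simp_all add: offset_def a_def b_def A_def B_def algebra_simps)
  have id: "real_of_int (a * B - b * A) = 
      of_int b * (of_int a * \<alpha> - of_int A) - of_int a * (of_int b * \<alpha> - of_int B)"
    by (simp add: algebra_simps)
  from consec_opposite[OF st pr c1 c2 ne] show ?thesis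
  proof
    assume "offset \<alpha> U s < offset \<alpha> U t \<and> offset \<alpha> U u < offset \<alpha> U t"
    hence e: "of_int a * \<alpha> - of_int A > 0" "of_int b * \<alpha> - of_int B < 0" using oa ob by linarith+
    have "of_int b * (of_int a * \<alpha> - of_int A) > 0" using e ab by simp
    moreover have "of_int a * (of_int b * \<alpha> - of_int B) < 0" using e ab by (simp add: mult_less_0_iff)
    ultimately have "real_of_int (a * B - b * A) > 0" unfolding id by linarith
    hence "a * B - b * A > 0" by linarith
    hence d: "a * B - b * A = 1" using det by linarith
    show ?thesis using farey_pair_half[OF ab d \<alpha>] e d by simp
  next
    assume "offset \<alpha> U t < offset \<alpha> U s \<and> offset \<alpha> U t < offset \<alpha> U u"
    hence e: "of_int a * \<alpha> - of_int A < 0" "of_int b * \<alpha> - of_int B > 0" using oa ob by linarith+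
    have "of_int b * (of_int a * \<alpha> - of_int A) < 0" using e ab by (simp add: mult_less_0_iff)
    moreover have "of_int a * (of_int b * \<alpha> - of_int B) > 0" using e ab by simp
    ultimately have "real_of_int (a * B - b * A) < 0" unfolding id by linarith
    hence "a * B - b * A < 0" by linarith
    hence d: "b * A - a * B = 1" using det by linarith
    show ?thesis using farey_pair_half[OF ab(2,1) ab(3)[symmetric] d \<alpha>] e d by simp
  qed
qed

text \<open>As \<open>a\<close> and \<open>b\<close> are coprime, two solutions of equal sign differ
  by a multiple of (a, b), and two of opposite sign add up to one. The bounds by a / 2 and b / 2
  leave room only for equality.\<close>

lemma half_pairs_unique:
  fixes a b A B A' B' :: int
  assumes "a \<ge> 1" "b \<ge> 1"
    and d: "\<bar>a * B - b * A\<bar> = 1" and bd: "0 \<le> A" "2 * A \<le> a" "0 \<le> B" "2 * B \<le> b"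
    and d': "\<bar>a * B' - b * A'\<bar> = 1" and bd': "0 \<le> A'" "2 * A' \<le> a" "0 \<le> B'" "2 * B' \<le> b"
  shows "A = A' \<and> B = B'"
proof -
  have cop: "coprime a b"
  proof (rule coprimeI)
    fix c assume "c dvd a" "c dvd b"
    hence "c dvd a * B - b * A" by simp
    thus "is_unit c" using d by (metis dvd_abs_iff)
  qed
  have div: "a dvd x \<Longrightarrow> \<bar>x\<bar> < a \<Longrightarrow> x = 0" for x :: int
    using zdvd_imp_le[of a "\<bar>x\<bar>"] by (cases "x = 0") auto
  consider "a * B - b * A = a * B' - b * A'" | "a * B - b * A = - (a * B' - b * A')"
    using d d' by linarith
  thus ?thesis
  proof cases
    case 1
    hence e: "a * (B - B') = b * (A - A')" by (simp add: algebra_simps)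
    hence "a dvd b * (A - A')" by (metis dvd_triv_left)
    hence "a dvd A - A'" using cop coprime_dvd_mult_right_iff by blast
    moreover have "\<bar>A - A'\<bar> < a" using assms by linarith
    ultimately have "A - A' = 0" by (rule div)
    moreover from this have "B - B' = 0" using e assms(1) by simp
    ultimately show ?thesis by simp
  next
    case 2
    hence e: "a * (B + B') = b * (A + A')" by (simp add: algebra_simps)
    hence "a dvd b * (A + A')" by (metis dvd_triv_left)
    hence dv: "a dvd A + A'" using cop coprime_dvd_mult_right_iff by blast
    have "A + A' < a \<or> A + A' = a" using bd bd' by linarith
    thus ?thesis
    proof
      assume "A + A' < a"
      hence "A + A' = 0" using bd bd' by (intro div dv) auto
      hence "A = 0" "A' = 0" using bd bd' by linarith+
      moreover from this have "B + B' = 0" using e assms(1) by simp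
      hence "B = 0" "B' = 0" using bd bd' by linarith+
      ultimately show ?thesis by simp
    next
      assume s: "A + A' = a"
      hence "B + B' = b" using e assms(1) by (simp add: mult.commute)
      hence "2 * A = a" "2 * B = b" "2 * A' = a" "2 * B' = b" using s bd bd' by linarith+
      thus ?thesis by linarith
    qed
  qed
qed

section \<open>Two slopes for the same set\<close>

text \<open>\<open>m\<close> counts steps rather than terms; \<open>m = 0\<close> gives a singleton
  for every \<open>q\<close>.\<close>

definition ap :: "nat \<Rightarrow> nat \<Rightarrow> nat \<Rightarrow> nat set" where
  "ap s q m = (\<lambda>k. s + k * q) ` {..m}"

lemma consec_succ:
  assumes "finite S" "x \<in> S" "u \<in> S" "x < u"
  obtains y where "consec S x y" "y \<le> u"
proof
  define y where "y = Min {z \<in> S. x < z}"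
  have f: "finite {z \<in> S. x < z}" "{z \<in> S. x < z} \<noteq> {}" using assms by auto
  from Min_in[OF f] have y: "y \<in> S" "x < y" by (auto simp: y_def)
  have "y \<le> z" if "z \<in> S" "x < z" for z using f that by (auto simp: y_def)
  thus "consec S x y" "y \<le> u" using y assms unfolding consec_def by (meson not_le)+
qed

lemma consec_pred:
  assumes "finite S" "x \<in> S" "u \<in> S" "x < u"
  obtains y where "consec S y u" "x \<le> y"
proof
  define y where "y = Max {z \<in> S. z < u}"
  have f: "finite {z \<in> S. z < u}" "{z \<in> S. z < u} \<noteq> {}" using assms by auto
  from Max_in[OF f] have y: "y \<in> S" "y < u" by (auto simp: y_def)
  have "z \<le> y" if "z \<in> S" "z < u" for z using f that by (auto simp: y_def)
  thus "consec S y u" "x \<le> y" using y assms unfolding consec_def by (meson not_le)+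
qed

lemma consec_succ_unique: "consec S x y \<Longrightarrow> consec S x z \<Longrightarrow> y = z"
  by (metis consec_def linorder_neqE_nat)

lemma consec_pred_unique: "consec S x z \<Longrightarrow> consec S y z \<Longrightarrow> x = y"
  by (metis consec_def linorder_neqE_nat)

lemma mem_apI: "k \<le> m \<Longrightarrow> s + k * q \<in> ap s q m"
  by (auto simp: ap_def)

lemma mem_ap_lt: "k < m \<Longrightarrow> s + k * q + q \<in> ap s q m"
  using mem_apI[of "Suc k" m s q] by (simp add: algebra_simps)

lemma ap_le: "x \<in> ap s q m \<Longrightarrow> x \<le> s + m * q"
  by (auto simp: ap_def)

lemma consec_ap: "q \<ge> 1 \<Longrightarrow> k < m \<Longrightarrow> consec (ap s q m) (s + k * q) (s + k * q + q)"
  unfolding consec_def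
proof (intro conjI ballI)
  assume q: "q \<ge> 1" and k: "k < m"
  show "s + k * q \<in> ap s q m" using k by (intro mem_apI) simp
  show "s + k * q + q \<in> ap s q m" using k by (rule mem_ap_lt)
  fix x assume "x \<in> ap s q m"
  then obtain l where l: "x = s + l * q" by (auto simp: ap_def)
  show "\<not> (s + k * q < x \<and> x < s + k * q + q)"
  proof
    assume "s + k * q < x \<and> x < s + k * q + q"
    hence "k * q < l * q" "l * q < Suc k * q" using l by simp_all
    hence "k < l" "l < Suc k" using mult_less_cancel2 by blast+
    thus False by simp
  qed
qed simp_all

text \<open>From any element the steps of length \<open>q\<close> can stop only at the maximum
  \<open>u\<close>, so they hit it exactly. All elements are thus congruent to \<open>u\<close>, and
  the steps from the minimum fill the progression.\<close>

lemma closed_ap: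
  assumes q: "q \<ge> 1" and fin: "finite S" and u: "u \<in> S" "\<And>x. x \<in> S \<Longrightarrow> x \<le> u"
    and cl: "\<And>x. x \<in> S \<Longrightarrow> x < u \<Longrightarrow> x + q \<in> S"
  obtains s m where "S = ap s q m"
proof -
  have dv: "\<exists>k. u = x + k * q" if "x \<in> S" for x
    using that
  proof (induction "u - x" arbitrary: x rule: less_induct)
    case less
    show ?case
    proof (cases "x = u")
      case True
      thus ?thesis by (intro exI[of _ 0]) simp
    next
      case False
      hence xu: "x < u" using u less.prems by (meson le_neq_implies_less)
      have "x + q \<in> S" using cl less.prems xu by blast
      moreover have "u - (x + q) < u - x" using q xu by simp
      ultimately obtain k where "u = x + q + k * q" using less.hyps by blast
      thus ?thesis by (intro exI[of _ "Suc k"]) simp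
    qed
  qed
  define s where "s = Min S"
  have "S \<noteq> {}" using u by blast
  hence s: "s \<in> S" "\<And>x. x \<in> S \<Longrightarrow> s \<le> x" using Min_in[of S] fin by (auto simp: s_def)
  obtain m where m: "u = s + m * q" using dv s by blast
  have up: "s + k * q \<in> S" if "k \<le> m" for k
    using that
  proof (induction k)
    case (Suc k)
    have "k * q < m * q" using Suc q by simp
    hence "s + k * q + q \<in> S" using cl Suc m by simp
    thus ?case by (simp add: algebra_simps)
  qed (use s in simp)
  have "x \<in> ap s q m" if x: "x \<in> S" for x
  proof -
    obtain k where k: "u = x + k * q" using dv x by blast
    have "s \<le> x" using s x by blast
    hence "k * q \<le> m * q" using k m by linarith
    hence "k \<le> m" using q by (metis mult_le_cancel2 less_le_trans zero_less_one)
    hence "x = s + (m - k) * q" using k m by (simp add: diff_mult_distrib)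
    thus ?thesis by (auto simp: ap_def)
  qed
  hence "S = ap s q m" using up by (auto simp: ap_def)
  thus ?thesis using that by blast
qed

lemma closed_down_ap:
  assumes q: "q \<ge> 1" and fin: "finite S" and s: "s \<in> S" "\<And>x. x \<in> S \<Longrightarrow> s \<le> x"
    and cl: "\<And>x. x \<in> S \<Longrightarrow> s < x \<Longrightarrow> q \<le> x \<and> x - q \<in> S"
  obtains s m where "S = ap s q m"
proof -
  have dv: "\<exists>k. x = s + k * q \<and> (\<forall>l\<le>k. s + l * q \<in> S)" if "x \<in> S" for x
    using that
  proof (induction x rule: less_induct)
    case (less x)
    show ?case
    proof (cases "x = s")
      case True
      thus ?thesis using s by (intro exI[of _ 0]) simp
    next
      case False
      hence xs: "s < x" using s(2)[OF less.prems] by simp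
      hence x: "x - q \<in> S" "q \<le> x" using cl less.prems by blast+
      moreover have "x - q < x" using q xs by simp
      ultimately obtain k where k: "x - q = s + k * q" "\<forall>l\<le>k. s + l * q \<in> S"
        using less.IH by blast
      hence "x = s + Suc k * q" using x by simp
      thus ?thesis using k less.prems by (intro exI[of _ "Suc k"]) (auto simp: le_Suc_eq)
    qed
  qed
  define u where "u = Max S"
  have "S \<noteq> {}" using s by blast
  hence u: "u \<in> S" "\<And>x. x \<in> S \<Longrightarrow> x \<le> u" using Max_in[of S] fin by (auto simp: u_def)
  obtain m where m: "u = s + m * q" "\<forall>l\<le>m. s + l * q \<in> S" using dv u by blast
  have "x \<in> ap s q m" if x: "x \<in> S" for x
  proof -
    obtain k where k: "x = s + k * q" using dv x by blast
    hence "k * q \<le> m * q" using u(2)[OF x] m by simp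
    thus ?thesis using k q by (auto simp: ap_def)
  qed
  hence "S = ap s q m" using m by (auto simp: ap_def)
  thus ?thesis using that by blast
qed

text \<open>Used in contrapositive form: a set that is no progression has two neighbouring gaps of
  different length, where the comparison of two staircases starts.\<close>

lemma gap_ap:
  assumes fin: "finite S" "S \<noteq> {}"
    and gap: "\<And>s t u. consec S s t \<Longrightarrow> consec S t u \<Longrightarrow> t - s = u - t"
  obtains s q m where "q \<ge> 1" "S = ap s q m"
proof -
  define u where "u = Max S"
  have u: "u \<in> S" "\<And>x. x \<in> S \<Longrightarrow> x \<le> u" using Max_in[of S] fin by (auto simp: u_def)
  show ?thesis
  proof (cases "S = {u}")
    case True
    hence "S = ap u 1 0" by (simp add: ap_def)
    thus ?thesis using that[of 1 u 0] by simp
  next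
    case False
    then obtain y where y: "y \<in> S" "y \<noteq> u" using u by blast
    hence "y < u" using u(2) le_neq_implies_less by blast
    then obtain t where t: "consec S t u" using consec_pred[OF fin(1) y(1) u(1)] by blast
    define q where "q = u - t"
    have q: "q \<ge> 1" using t by (auto simp: q_def consec_def)
    have "consec S x (x + q)" if "x \<in> S" "x < u" for x
      using that
    proof (induction "u - x" arbitrary: x rule: less_induct)
      case less
      obtain y where y: "consec S x y" "y \<le> u" using consec_succ[OF fin(1) less.prems(1) u(1) less.prems(2)] .
      have yx: "y \<in> S" "x < y" using y by (auto simp: consec_def)
      show ?case
      proof (cases "y = u")
        case True
        hence "x = t" using y t consec_pred_unique by metis
        thus ?thesis using t by (simp add: q_def consec_def)
      next
        case False
        hence "consec S y (y + q)" using less.hyps[of y] y yx less.prems by simp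
        hence "y - x = q" using gap[OF y(1)] by fastforce
        hence "x + q = y" using yx by simp
        thus ?thesis using y by simp
      qed
    qed
    hence "\<And>x. x \<in> S \<Longrightarrow> x < u \<Longrightarrow> x + q \<in> S" by (simp add: consec_def)
    then obtain s m where "S = ap s q m" using closed_ap[OF q fin(1) u] by blast
    thus ?thesis using that q by blast
  qed
qed

text \<open>Unequal gaps make the vectors on both sides of \<open>t\<close> a pair of Farey
  neighbours, which \<open>half_pairs_unique\<close> determines independently of the slope. Across
  equal gaps the vector is merely repeated, so agreement passes from one gap to the next.\<close>

lemma triple_step:
  assumes st: "stair n \<alpha> U S" and st': "stair n \<beta> U' S" and pr: "proper n S"
    and \<alpha>: "0 < \<alpha>" "\<alpha> < 1 / 2" and \<beta>: "0 < \<beta>" "\<beta> < 1 / 2"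
    and sparse: "\<forall>x\<in>S. Suc x \<notin> S"
    and c1: "consec S s t" and c2: "consec S t u"
  shows "U t - U s = U' t - U' s \<longleftrightarrow> U u - U t = U' u - U' t"
    and "t - s \<noteq> u - t \<Longrightarrow> U t - U s = U' t - U' s"
proof -
  have lt: "s < t" "t < u" using c1 c2 by (auto simp: consec_def)
  have ne: "U t - U s = U' t - U' s \<and> U u - U t = U' u - U' t" if ne: "t - s \<noteq> u - t"
  proof -
    have "1 \<le> int t - int s" "1 \<le> int u - int t" using lt by simp_all
    thus ?thesis
      using half_pairs_unique[where a = "int t - int s" and b = "int u - int t" and A = "U t - U s"
          and B = "U u - U t" and A' = "U' t - U' s" and B' = "U' u - U' t"]
        consec_triple_bounds[OF st pr \<alpha> c1 c2 ne] consec_triple_bounds[OF st' pr \<beta> c1 c2 ne] by blast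
  qed
  thus "t - s \<noteq> u - t \<Longrightarrow> U t - U s = U' t - U' s" by blast
  show "U t - U s = U' t - U' s \<longleftrightarrow> U u - U t = U' u - U' t"
  proof (cases "t - s = u - t")
    case True
    have "t \<noteq> Suc s" using c1 sparse by (auto simp: consec_def)
    hence "t - s \<ge> 2" using lt by simp
    thus ?thesis using consec_equal_gap[OF st pr c1 c2 True] consec_equal_gap[OF st' pr c1 c2 True] by simp
  qed (use ne in blast)
qed

text \<open>One triple with unequal gaps anchors the two staircases to each other;
  \<open>triple_step\<close> carries the agreement gap by gap to both ends of
  \<open>S\<close>.\<close>

lemma sparse_agree:
  assumes st: "stair n \<alpha> U S" and st': "stair n \<beta> U' S" and pr: "proper n S"
    and \<alpha>: "0 < \<alpha>" "\<alpha> < 1 / 2" and \<beta>: "0 < \<beta>" "\<beta> < 1 / 2"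
    and sparse: "\<forall>x\<in>S. Suc x \<notin> S" and nap: "\<And>s q m. q \<ge> 1 \<Longrightarrow> S \<noteq> ap s q m"
  obtains c where "\<And>x. x \<in> S \<Longrightarrow> U x = U' x + c"
proof -
  have fin: "finite S" "S \<noteq> {}" using pr finite_subset by (auto simp: proper_def)
  obtain s t u where c1: "consec S s t" and c2: "consec S t u" and ne: "t - s \<noteq> u - t"
    using gap_ap[OF fin] nap by metis
  note step = triple_step[OF st st' pr \<alpha> \<beta> sparse]
  have ts: "U t - U s = U' t - U' s" using step(2)[OF c1 c2 ne] .
  hence ut: "U u - U t = U' u - U' t" using step(1)[OF c1 c2] by simp
  have S: "t \<in> S" using c1 by (auto simp: consec_def)
  have up: "U x - U' x = U t - U' t" if "x \<in> S" "t \<le> x" for x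
    using that
  proof (induction x rule: less_induct)
    case (less x)
    show ?case
    proof (cases "x = t")
      case False
      hence "t < x" using less.prems by simp
      then obtain y where y: "consec S y x" "t \<le> y" using consec_pred[OF fin(1) S less.prems(1)] by blast
      have yS: "y \<in> S" "y < x" using y by (auto simp: consec_def)
      show ?thesis
      proof (cases "y = t")
        case True
        hence "x = u" using y c2 consec_succ_unique by metis
        thus ?thesis using ut by simp
      next
        case False
        hence "t < y" using y by simp
        then obtain z where z: "consec S z y" "t \<le> z" using consec_pred[OF fin(1) S yS(1)] by blast
        have zS: "z \<in> S" "z < y" using z by (auto simp: consec_def)
        have "U y - U' y = U t - U' t" "U z - U' z = U t - U' t"
          using less.IH yS zS y z by auto
        thus ?thesis using step(1)[OF z(1) y(1)] by linarith
      qed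
    qed simp
  qed
  have down: "U x - U' x = U t - U' t" if "x \<in> S" "x \<le> t" for x
    using that
  proof (induction "t - x" arbitrary: x rule: less_induct)
    case less
    show ?case
    proof (cases "x = t")
      case False
      hence "x < t" using less.prems by simp
      then obtain y where y: "consec S x y" "y \<le> t" using consec_succ[OF fin(1) less.prems(1) S] by blast
      have yS: "y \<in> S" "x < y" using y by (auto simp: consec_def)
      show ?thesis
      proof (cases "y = t")
        case True
        hence "x = s" using y c1 consec_pred_unique by metis
        thus ?thesis using ts by simp
      next
        case False
        hence "y < t" using y by simp
        then obtain z where z: "consec S y z" "z \<le> t" using consec_succ[OF fin(1) yS(1) S] by blast
        have zS: "z \<in> S" "y < z" using z by (auto simp: consec_def)
        have "U y - U' y = U t - U' t" "U z - U' z = U t - U' t"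
          using less.hyps[of y] less.hyps[of z] yS zS y z by auto
        thus ?thesis using step(1)[OF y(1) z(1)] by linarith
      qed
    qed simp
  qed
  have "U x = U' x + (U t - U' t)" if "x \<in> S" for x
    using up[OF that] down[OF that] by linarith
  thus ?thesis using that by blast
qed

text \<open>Weighting the inequalities for \<open>s\<close> and \<open>t\<close> with t - i and i -
  s cancels \<alpha>. What remains says that \<open>U i\<close> is the floor of the height at column
  \<open>i\<close> of the chord from (s, U s) to (t, U t).\<close>

lemma middle_bounds:
  assumes st: "stair n \<alpha> U S" and S: "s \<in> S" "t \<in> S" and i: "s < i" "i < t" "i \<le> n" "i \<notin> S"
  shows "(int t - int s) * U i < (int t - int i) * U s + (int i - int s) * U t"
    and "(int t - int i) * U s + (int i - int s) * U t < (int t - int s) * (U i + 1)"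
proof -
  define a where "a = real t - real i"
  define b where "b = real i - real s"
  have ab: "a > 0" "b > 0" using i by (auto simp: a_def b_def)
  have o: "offset \<alpha> U s < offset \<alpha> U i" "offset \<alpha> U i < offset \<alpha> U s + 1"
    "offset \<alpha> U t < offset \<alpha> U i" "offset \<alpha> U i < offset \<alpha> U t + 1"
    using stairD[OF st S(1) i(3,4)] stairD[OF st S(2) i(3,4)] by auto
  have lin: "a * (real s * \<alpha>) + b * (real t * \<alpha>) = (a + b) * (real i * \<alpha>)"
    by (simp add: a_def b_def algebra_simps)
  have "a * offset \<alpha> U s + b * offset \<alpha> U t < a * offset \<alpha> U i + b * offset \<alpha> U i"
    using ab o by (intro add_strict_mono mult_strict_left_mono)
  hence "(a + b) * of_int (U i) < a * of_int (U s) + b * of_int (U t)"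
    using lin by (simp add: offset_def algebra_simps)
  hence "of_int ((int t - int s) * U i) < (of_int ((int t - int i) * U s + (int i - int s) * U t) :: real)"
    by (simp add: a_def b_def algebra_simps)
  thus "(int t - int s) * U i < (int t - int i) * U s + (int i - int s) * U t"
    using of_int_less_iff by blast
  have "a * offset \<alpha> U i + b * offset \<alpha> U i < a * (offset \<alpha> U s + 1) + b * (offset \<alpha> U t + 1)"
    using ab o by (intro add_strict_mono mult_strict_left_mono)
  hence "a * of_int (U s) + b * of_int (U t) < (a + b) * (of_int (U i) + 1)"
    using lin by (simp add: offset_def algebra_simps)
  hence "of_int ((int t - int i) * U s + (int i - int s) * U t) < (of_int ((int t - int s) * (U i + 1)) :: real)"
    by (simp add: a_def b_def algebra_simps)
  thus "(int t - int i) * U s + (int i - int s) * U t < (int t - int s) * (U i + 1)"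
    using of_int_less_iff by blast
qed

lemma middle_agree:
  assumes st: "stair n \<alpha> U S" and st': "stair n \<beta> U' S" and eq: "\<And>x. x \<in> S \<Longrightarrow> U x = U' x"
    and S: "s \<in> S" "t \<in> S" and i: "s \<le> i" "i \<le> t" "i \<le> n"
  shows "U i = U' i"
proof (cases "i \<in> S")
  case False
  hence i': "s < i" "i < t" using S i by (metis le_neq_implies_less)+
  define N where "N = (int t - int i) * U s + (int i - int s) * U t"
  define a where "a = int t - int s"
  have a: "a > 0" using i' by (simp add: a_def)
  have "a * U i < N" "N < a * (U i + 1)"
    using middle_bounds[OF st S i' i(3) False] by (simp_all add: N_def a_def)
  moreover have "a * U' i < N" "N < a * (U' i + 1)"
    using middle_bounds[OF st' S i' i(3) False] eq[OF S(1)] eq[OF S(2)] by (simp_all add: N_def a_def)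
  ultimately have "a * U i < a * (U' i + 1)" "a * U' i < a * (U i + 1)" by linarith+
  hence "U i < U' i + 1" "U' i < U i + 1" using a by simp_all
  thus ?thesis by linarith
qed (use eq in blast)

section \<open>Changes of a staircase to the left and right of the set\<close>

definition sep :: "real \<Rightarrow> real \<Rightarrow> nat \<Rightarrow> int \<Rightarrow> bool" where
  "sep \<alpha> \<beta> q p \<longleftrightarrow> (real q * \<alpha> < of_int p \<and> of_int p < real q * \<beta>) \<or>
                    (real q * \<beta> < of_int p \<and> of_int p < real q * \<alpha>)"

lemma sep_commute: "sep \<alpha> \<beta> q p \<longleftrightarrow> sep \<beta> \<alpha> q p"
  by (auto simp: sep_def)

text \<open>At the first change \<open>i\<close>, a fraction \<open>p/q\<close> with \<open>q = i - u\<close> separates the slopes, and every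
  earlier element of \<open>S\<close> is carried along by the vector \<open>(q, p)\<close>.\<close>
lemma tail_change_less:
  assumes st: "stair n \<alpha> U S" and st': "stair n \<beta> U' S" and pr: "proper n S"
    and eq: "\<And>x. x \<in> S \<Longrightarrow> U x = U' x"
    and u: "u \<in> S" "\<And>x. x \<in> S \<Longrightarrow> x \<le> u" and i: "i \<le> n" "u < i" "U i < U' i"
    and below: "\<And>j. u < j \<Longrightarrow> j < i \<Longrightarrow> U j = U' j"
  obtains p where "sep \<alpha> \<beta> (i - u) p"
    "\<And>x. x \<in> S \<Longrightarrow> x < u \<Longrightarrow> x + (i - u) \<in> S \<and> U (x + (i - u)) = U x + p"
proof -
  define q where "q = i - u"
  define p where "p = U' i - U u"
  have q: "real q = real i - real u" using i by (simp add: q_def)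
  have nS: "i \<notin> S" using u(2) i(2) by (meson not_le)
  have "U i + 1 \<le> U' i" using i by simp
  hence "real_of_int (U i) + 1 \<le> of_int (U' i)" by linarith
  hence a: "real q * \<alpha> < of_int p"
    using stairD(2)[OF st u(1) i(1) nS] by (simp add: offset_def p_def q algebra_simps)
  have b: "of_int p < real q * \<beta>"
    using stairD(1)[OF st' u(1) i(1) nS] eq[OF u(1)] by (simp add: offset_def p_def q algebra_simps)
  have "x + q \<in> S \<and> U (x + q) = U x + p" if x: "x \<in> S" "x < u" for x
  proof -
    define j where "j = x + q"
    define e where "e = U j - U x"
    have j: "j \<le> n" "j < i" "x \<le> j" using x i by (auto simp: j_def q_def)
    have Uj: "U j = U' j"
    proof (cases "j \<le> u")
      case True
      thus ?thesis using middle_agree[OF st st' eq x(1) u(1)] j by simp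
    qed (use below j in simp)
    have oj: "offset \<alpha> U j = offset \<alpha> U x + real q * \<alpha> - of_int e"
      by (simp add: offset_def e_def j_def algebra_simps)
    have oj': "offset \<beta> U' j = offset \<beta> U' x + real q * \<beta> - of_int e"
      using eq[OF x(1)] Uj by (simp add: offset_def e_def j_def algebra_simps)
    \<comment> \<open>Outside \<open>S\<close>, the common increment \<open>e\<close> would be the
      floor of both q \<alpha> and q \<beta>, although \<open>p\<close> separates them.\<close>
    have jS: "j \<in> S"
    proof (rule ccontr)
      assume "j \<notin> S"
      hence "of_int e < real q * \<alpha>" "real q * \<beta> < of_int e + 1"
        using stairD[OF st x(1) j(1)] stairD[OF st' x(1) j(1)] oj oj' by simp_all
      hence "e < p" "p < e + 1" using a b by linarith+
      thus False by simp
    qed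
    \<comment> \<open>Any outside point shows that two offsets on \<open>S\<close> differ by less
      than 1; used at both slopes, this pins \<open>e\<close> down to \<open>p\<close>.\<close>
    obtain y where y: "y \<le> n" "y \<notin> S" using proper_obtain[OF pr] by blast
    have "of_int e < real q * \<alpha> + 1"
      using stairD(2)[OF st jS y] stairD(1)[OF st x(1) y] oj by linarith
    hence "e \<le> p" using a by linarith
    moreover have "real q * \<beta> < of_int e + 1"
      using stairD(1)[OF st' jS y] stairD(2)[OF st' x(1) y] oj' by linarith
    hence "p \<le> e" using b by linarith
    ultimately show ?thesis using jS by (simp add: e_def j_def)
  qed
  thus ?thesis using that[of p] a b unfolding q_def sep_def by blast
qed

lemma tail_change:
  assumes st: "stair n \<alpha> U S" and st': "stair n \<beta> U' S" and pr: "proper n S"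
    and eq: "\<And>x. x \<in> S \<Longrightarrow> U x = U' x"
    and u: "u \<in> S" "\<And>x. x \<in> S \<Longrightarrow> x \<le> u" and i: "i \<le> n" "u < i" "U i \<noteq> U' i"
  obtains q p where "q \<ge> 1" "u + q \<le> n" "sep \<alpha> \<beta> q p"
    "\<And>x. x \<in> S \<Longrightarrow> x < u \<Longrightarrow> x + q \<in> S \<and> U (x + q) = U x + p"
proof -
  define j where "j = (LEAST j. u < j \<and> U j \<noteq> U' j)"
  have j: "u < j" "U j \<noteq> U' j" using LeastI[of "\<lambda>j. u < j \<and> U j \<noteq> U' j" i] i by (auto simp: j_def)
  have below: "U k = U' k" if "u < k" "k < j" for k
    using not_less_Least[of k "\<lambda>j. u < j \<and> U j \<noteq> U' j"] that by (auto simp: j_def)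
  have jn: "j \<le> n" using Least_le[of "\<lambda>j. u < j \<and> U j \<noteq> U' j" i] i by (simp add: j_def)
  have q: "j - u \<ge> 1" "u + (j - u) \<le> n" using j jn by auto
  consider "U j < U' j" | "U' j < U j" using j by linarith
  thus ?thesis
  proof cases
    case 1
    show ?thesis
      using tail_change_less[OF st st' pr eq u jn j(1) 1 below] that[OF q] by metis
  next
    case 2
    obtain p where p: "sep \<beta> \<alpha> (j - u) p"
      "\<And>x. x \<in> S \<Longrightarrow> x < u \<Longrightarrow> x + (j - u) \<in> S \<and> U' (x + (j - u)) = U' x + p"
      using tail_change_less[OF st' st pr eq[symmetric] u jn j(1) 2 below[symmetric]] by metis
    have "x + (j - u) \<in> S \<and> U (x + (j - u)) = U x + p" if "x \<in> S" "x < u" for x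
      using p(2)[OF that] eq that by simp
    thus ?thesis using that[OF q] p(1) sep_commute by blast
  qed
qed

text \<open>Mirror image of \<open>tail_change\<close>, obtained by reversing the word with
  \<open>flip\<close>.\<close>

lemma head_change:
  assumes st: "stair n \<alpha> U S" and st': "stair n \<beta> U' S" and pr: "proper n S"
    and eq: "\<And>x. x \<in> S \<Longrightarrow> U x = U' x"
    and s: "s \<in> S" "\<And>x. x \<in> S \<Longrightarrow> s \<le> x" and i: "i < s" "U i \<noteq> U' i"
  obtains q p where "q \<ge> 1" "q \<le> s" "sep \<alpha> \<beta> q p"
    "\<And>x. x \<in> S \<Longrightarrow> s < x \<Longrightarrow> q \<le> x \<and> x - q \<in> S \<and> U x = U (x - q) + p"
proof -
  have sub: "\<And>x. x \<in> S \<Longrightarrow> x \<le> n" using pr by (auto simp: proper_def)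
  have sn: "s \<le> n" using sub s by blast
  define V where "V = (\<lambda>i. of_bool (i \<in> flip n S) - U (n - i))"
  define V' where "V' = (\<lambda>i. of_bool (i \<in> flip n S) - U' (n - i))"
  have eqV: "V x = V' x" if "x \<in> flip n S" for x
    using that eq by (simp add: V_def V'_def mem_flip)
  have u: "n - s \<in> flip n S" using s sn by (simp add: mem_flip)
  have u2: "x \<le> n - s" if "x \<in> flip n S" for x
    using s(2)[of "n - x"] that by (auto simp: mem_flip)
  have i': "n - i \<le> n" "n - s < n - i" "V (n - i) \<noteq> V' (n - i)"
    using i sn by (auto simp: V_def V'_def)
  obtain q p where qp: "q \<ge> 1" "(n - s) + q \<le> n" "sep \<alpha> \<beta> q p"
    and cl: "\<And>x. x \<in> flip n S \<Longrightarrow> x < n - s \<Longrightarrow> x + q \<in> flip n S \<and> V (x + q) = V x + p"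
    using tail_change[OF stair_flip[OF st, folded V_def] stair_flip[OF st', folded V'_def]
        proper_flip[OF pr] eqV u u2 i'] by metis
  have "q \<le> x \<and> x - q \<in> S \<and> U x = U (x - q) + p" if x: "x \<in> S" "s < x" for x
  proof -
    have xn: "x \<le> n" using sub x by blast
    hence 1: "n - x \<in> flip n S" "n - x < n - s" using x by (auto simp: mem_flip)
    from cl[OF this] have 2: "n - x + q \<in> flip n S" "V (n - x + q) = V (n - x) + p" by auto
    have qx: "q \<le> x" and "n - (n - x + q) \<in> S" using 2(1) xn by (auto simp: mem_flip)
    moreover have e: "n - (n - x + q) = x - q" "n - (n - x) = x" using xn by auto
    ultimately show ?thesis using 2 1 by (simp add: V_def e)
  qed
  thus ?thesis using that qp sn by fastforce
qed

definition agree :: "nat \<Rightarrow> (nat \<Rightarrow> int) \<Rightarrow> (nat \<Rightarrow> int) \<Rightarrow> bool" where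
  "agree n U U' \<longleftrightarrow> (\<exists>c. \<forall>i\<le>n. U i = U' i + c)"

text \<open>Between the ends of \<open>S\<close> the staircase is determined by its values on
  \<open>S\<close>. A change beyond an end would make \<open>S\<close> closed under a fixed step,
  hence a progression.\<close>

lemma agree_nonap:
  assumes st: "stair n \<alpha> U S" and st': "stair n \<beta> U' S" and pr: "proper n S"
    and eq: "\<And>x. x \<in> S \<Longrightarrow> U x = U' x + c" and nap: "\<And>s q m. q \<ge> 1 \<Longrightarrow> S \<noteq> ap s q m"
  shows "agree n U U'"
proof -
  define V where "V = (\<lambda>i. U' i + c)"
  have sub: "S \<subseteq> {..n}" using pr by (simp add: proper_def)
  have fin: "finite S" "S \<noteq> {}" using pr finite_subset by (auto simp: proper_def)
  have stV: "stair n \<beta> V S" using stair_shift[OF st' sub, of V c] by (simp add: V_def)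
  have eqV: "\<And>x. x \<in> S \<Longrightarrow> U x = V x" using eq by (simp add: V_def)
  define s where "s = Min S"
  define u where "u = Max S"
  have s: "s \<in> S" "\<And>x. x \<in> S \<Longrightarrow> s \<le> x" using Min_in[of S] fin by (auto simp: s_def)
  have u: "u \<in> S" "\<And>x. x \<in> S \<Longrightarrow> x \<le> u" using Max_in[of S] fin by (auto simp: u_def)
  have "U i = V i" if i: "i \<le> n" for i
  proof (rule ccontr)
    assume ne: "U i \<noteq> V i"
    consider "i < s" | "s \<le> i \<and> i \<le> u" | "u < i" by linarith
    thus False
    proof cases
      case 1
      obtain q p where "q \<ge> 1" "\<And>x. x \<in> S \<Longrightarrow> s < x \<Longrightarrow> q \<le> x \<and> x - q \<in> S \<and> U x = U (x - q) + p"
        using head_change[OF st stV pr eqV s 1 ne] by metis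
      thus False using closed_down_ap[OF _ fin(1) s, of q] nap by metis
    next
      case 2
      thus False using middle_agree[OF st stV eqV s(1) u(1)] i ne by blast
    next
      case 3
      obtain q p where "q \<ge> 1" "\<And>x. x \<in> S \<Longrightarrow> x < u \<Longrightarrow> x + q \<in> S \<and> U (x + q) = U x + p"
        using tail_change[OF st stV pr eqV u i 3 ne] by metis
      thus False using closed_ap[OF _ fin(1) u, of q] nap by metis
    qed
  qed
  thus ?thesis by (auto simp: agree_def V_def)
qed

text \<open>The step along which a change carries \<open>S\<close> must be the difference of the
  progression, so the separating fraction is p / q. A change also needs room for one more term, that
  is q <= s or s + m q + q <= n. The hypothesis \<open>side\<close> excludes either the fraction or
  the room.\<close>

lemma agree_ap:
  assumes st: "stair n \<alpha> U S" and st': "stair n \<beta> U' S" and pr: "proper n S"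
    and S: "S = ap s q m" and qm: "q \<ge> 1" "m \<ge> 1"
    and inc: "\<And>k. k < m \<Longrightarrow> U (s + k * q + q) = U (s + k * q) + p"
    and inc': "\<And>k. k < m \<Longrightarrow> U' (s + k * q + q) = U' (s + k * q) + p"
    and side: "\<not> sep \<alpha> \<beta> q p \<or> (n < s + m * q + q \<and> s < q)"
  shows "agree n U U'"
proof -
  define c where "c = U s - U' s"
  define V where "V = (\<lambda>i. U' i + c)"
  have sub: "S \<subseteq> {..n}" using pr by (simp add: proper_def)
  have fin: "finite S" "S \<noteq> {}" using pr finite_subset by (auto simp: proper_def)
  have stV: "stair n \<beta> V S" using stair_shift[OF st' sub, of V c] by (simp add: V_def)
  have "U (s + k * q) = V (s + k * q)" if "k \<le> m" for k
    using that
  proof (induction k)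
    case (Suc k)
    thus ?case using inc[of k] inc'[of k] by (simp add: V_def algebra_simps)
  qed (simp add: V_def c_def)
  hence eqV: "\<And>x. x \<in> S \<Longrightarrow> U x = V x" by (auto simp: S ap_def)
  define u where "u = s + m * q"
  have s: "s \<in> S" "\<And>x. x \<in> S \<Longrightarrow> s \<le> x" using mem_apI[of 0 m s q] by (auto simp: S ap_def)
  have u: "u \<in> S" "\<And>x. x \<in> S \<Longrightarrow> x \<le> u" using mem_apI[of m m s q] ap_le by (auto simp: S u_def)
  have "U i = V i" if i: "i \<le> n" for i
  proof (rule ccontr)
    assume ne: "U i \<noteq> V i"
    consider "i < s" | "s \<le> i \<and> i \<le> u" | "u < i" by linarith
    thus False
    proof cases
      case 1
      obtain q' p' where *: "q' \<ge> 1" "q' \<le> s" "sep \<alpha> \<beta> q' p'" 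
        "\<And>x. x \<in> S \<Longrightarrow> s < x \<Longrightarrow> q' \<le> x \<and> x - q' \<in> S \<and> U x = U (x - q') + p'"
        using head_change[OF st stV pr eqV s 1 ne] by metis
      have c: "consec S s (s + q)" using consec_ap[of q 0 m s] qm by (simp add: S)
      hence x: "s + q \<in> S" "s < s + q" by (auto simp: consec_def)
      from *(4)[OF x] have y: "s + q - q' \<in> S" "U (s + q) = U (s + q - q') + p'" by auto
      have "s + q - q' < s + q" using * by linarith
      hence "s + q - q' = s" using y(1) c s(2)[OF y(1)] unfolding consec_def by (metis le_neq_implies_less)
      hence "q' = q" using * by linarith
      hence "p' = p" using y inc[of 0] qm by simp
      thus False using * side \<open>q' = q\<close> by auto
    next
      case 2
      thus False using middle_agree[OF st stV eqV s(1) u(1)] i ne by blast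
    next
      case 3
      obtain q' p' where *: "q' \<ge> 1" "u + q' \<le> n" "sep \<alpha> \<beta> q' p'" 
        "\<And>x. x \<in> S \<Longrightarrow> x < u \<Longrightarrow> x + q' \<in> S \<and> U (x + q') = U x + p'"
        using tail_change[OF st stV pr eqV u i 3 ne] by metis
      define x where "x = s + (m - 1) * q"
      have xu: "x + q = u" using qm by (cases m) (auto simp: x_def u_def)
      have c: "consec S x u" using consec_ap[of q "m - 1" m s] qm xu by (simp add: S x_def)
      hence x: "x \<in> S" "x < u" by (auto simp: consec_def)
      from *(4)[OF x] have y: "x + q' \<in> S" "U (x + q') = U x + p'" by auto
      have "x < x + q'" using * by linarith
      hence "x + q' = u" using y(1) c u(2)[OF y(1)] unfolding consec_def by (metis le_neq_implies_less)
      hence "q' = q" using xu by linarith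
      hence "p' = p" using y inc[of "m - 1"] qm by (simp add: x_def)
      thus False using * side \<open>q' = q\<close> by (auto simp: u_def)
    qed
  qed
  thus ?thesis by (auto simp: agree_def V_def)
qed

section \<open>Sets with adjacent elements inside and outside\<close>

lemma switch_down:
  assumes "stair n \<alpha> U S" "0 < \<alpha>" "\<alpha> < 1" "i \<in> S" "Suc i \<notin> S" "Suc i \<le> n"
  shows "U (Suc i) = U i"
  using stairD[OF assms(1,4,6,5)] assms(2,3) by (simp add: offset_def algebra_simps)

lemma switch_up:
  assumes "stair n \<alpha> U S" "0 < \<alpha>" "\<alpha> < 1" "i \<notin> S" "Suc i \<in> S" "i \<le> n"
  shows "U (Suc i) = U i + 1"
  using stairD[OF assms(1,5,6,4)] assms(2,3) by (simp add: offset_def algebra_simps)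

text \<open>The two offsets on \<open>S\<close> are \<alpha> or 1 - \<alpha> apart, according to
  whether the increment is 0 or 1, and likewise those on the complement. Both spreads together must
  stay below 1, which for \<alpha> < 1/2 allows only two increments 0.\<close>

lemma step_mixed:
  assumes st: "stair n \<alpha> U S" and \<alpha>: "0 < \<alpha>" "\<alpha> < 1 / 2"
    and i: "i \<in> S" "Suc i \<in> S" and b: "b \<notin> S" "Suc b \<notin> S" "Suc b \<le> n"
  shows "U (Suc i) = U i" "U (Suc b) = U b"
proof -
  have bn: "b \<le> n" using b by simp
  have o: "offset \<alpha> U i < offset \<alpha> U b" "offset \<alpha> U b < offset \<alpha> U i + 1"
    "offset \<alpha> U (Suc i) < offset \<alpha> U b" "offset \<alpha> U b < offset \<alpha> U (Suc i) + 1"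
    "offset \<alpha> U i < offset \<alpha> U (Suc b)" "offset \<alpha> U (Suc b) < offset \<alpha> U i + 1"
    "offset \<alpha> U (Suc i) < offset \<alpha> U (Suc b)" "offset \<alpha> U (Suc b) < offset \<alpha> U (Suc i) + 1"
    using stairD[OF st i(1) bn b(1)] stairD[OF st i(2) bn b(1)]
      stairD[OF st i(1) b(3) b(2)] stairD[OF st i(2) b(3) b(2)] by auto
  define m where "m = U (Suc i) - U i"
  define l where "l = U (Suc b) - U b"
  have oi: "offset \<alpha> U (Suc i) = offset \<alpha> U i + \<alpha> - of_int m" by (simp add: offset_def m_def algebra_simps)
  have ob: "offset \<alpha> U (Suc b) = offset \<alpha> U b + \<alpha> - of_int l" by (simp add: offset_def l_def algebra_simps)
  have "real_of_int m < 2" "- 1 < real_of_int m" using o oi \<alpha> by linarith+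
  hence m: "m = 0 \<or> m = 1" by linarith
  have "real_of_int l < 2" "- 1 < real_of_int l" using o ob \<alpha> by linarith+
  hence l: "l = 0 \<or> l = 1" by linarith
  have "m \<noteq> 1" using o oi ob \<alpha> l by auto
  hence "m = 0" using m by simp
  moreover have "l \<noteq> 1" using o oi ob \<alpha> m by auto
  hence "l = 0" using l by simp
  ultimately show "U (Suc i) = U i" "U (Suc b) = U b" by (auto simp: m_def l_def)
qed

text \<open>All increments are known without the slope: 1 on entering \<open>S\<close> and 0
  otherwise.\<close>

lemma agree_mixed:
  assumes st: "stair n \<alpha> U S" and st': "stair n \<beta> U' S"
    and \<alpha>: "0 < \<alpha>" "\<alpha> < 1 / 2" and \<beta>: "0 < \<beta>" "\<beta> < 1 / 2"
    and a: "a \<in> S" "Suc a \<in> S" and b: "b \<notin> S" "Suc b \<notin> S" "Suc b \<le> n"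
  shows "agree n U U'"
proof -
  have "U i - U' i = U 0 - U' 0" if "i \<le> n" for i
    using that
  proof (induction i)
    case (Suc i)
    have IH: "U i - U' i = U 0 - U' 0" using Suc by simp
    have "U (Suc i) - U i = U' (Suc i) - U' i"
    proof (cases "i \<in> S"; cases "Suc i \<in> S")
      assume "i \<in> S" "Suc i \<in> S"
      thus ?thesis using step_mixed(1)[OF st \<alpha> _ _ b, of i] step_mixed(1)[OF st' \<beta> _ _ b, of i] by simp
    next
      assume "i \<in> S" "Suc i \<notin> S"
      thus ?thesis using switch_down[OF st] switch_down[OF st'] \<alpha> \<beta> Suc.prems by simp
    next
      assume "i \<notin> S" "Suc i \<in> S"
      thus ?thesis using switch_up[OF st] switch_up[OF st'] \<alpha> \<beta> Suc.prems by simp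
    next
      assume "i \<notin> S" "Suc i \<notin> S"
      thus ?thesis using step_mixed(2)[OF st \<alpha> a, of i] step_mixed(2)[OF st' \<beta> a, of i] Suc.prems by simp
    qed
    thus ?case using IH by linarith
  qed simp
  hence "\<forall>i\<le>n. U i = U' i + (U 0 - U' 0)" by (smt (verit))
  thus ?thesis unfolding agree_def by blast
qed

text \<open>Equal gaps repeat one vector (q, p), which is primitive by \<open>consec_gcd\<close>. If
  p / q exceeded 1/2, its lower neighbour E / e with e < q would still be at least 1/2, hence above
  \<alpha>, and would give an element of \<open>S\<close> strictly between \<open>s\<close> and s +
  q.\<close>

lemma ap_slope:
  assumes st: "stair n \<alpha> U S" and pr: "proper n S" and \<alpha>: "0 < \<alpha>" "\<alpha> < 1 / 2"
    and S: "S = ap s q m" and qm: "q \<ge> 2" "m \<ge> 1"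
  obtains p where "coprime p (int q)" "0 < p" "2 * p \<le> int q"
    "\<And>k. k < m \<Longrightarrow> U (s + k * q + q) = U (s + k * q) + p"
proof -
  define p where "p = U (s + q) - U s"
  have c: "consec S (s + k * q) (s + k * q + q)" if "k < m" for k
    using consec_ap[of q k m s] qm that by (simp add: S)
  have inc: "U (s + k * q + q) = U (s + k * q) + p" if "k < m" for k
    using that
  proof (induction k)
    case (Suc k)
    have 1: "consec S (s + k * q) (s + k * q + q)" "consec S (s + k * q + q) (s + k * q + q + q)"
      using c[of k] c[of "Suc k"] Suc.prems by (simp_all add: algebra_simps)
    have "U (s + k * q + q + q) - U (s + k * q + q) = U (s + k * q + q) - U (s + k * q)"
      using consec_equal_gap[OF st pr 1] qm by simp
    thus ?case using Suc by (simp add: algebra_simps)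
  qed (simp add: p_def)
  have c0: "consec S s (s + q)" using c[of 0] qm by simp
  have cop: "coprime p (int q)" using consec_gcd[OF st pr c0] by (simp add: p_def coprime_commute)
  have sS: "s \<in> S" "s + q \<in> S" using c0 by (auto simp: consec_def)
  have sn: "s + q \<le> n" using sS pr by (auto simp: proper_def)
  have osq: "offset \<alpha> U (s + q) = offset \<alpha> U s + real q * \<alpha> - of_int p"
    by (simp add: offset_def p_def algebra_simps)
  obtain y where y: "y \<le> n" "y \<notin> S" using proper_obtain[OF pr] by blast
  have "real q * \<alpha> - of_int p < 1"
    using stairD[OF st sS(1) y] stairD[OF st sS(2) y] osq by linarith
  moreover have "0 < real q * \<alpha>" using \<alpha> qm by simp
  ultimately have "0 \<le> p" by linarith
  moreover have "p \<noteq> 0" using cop qm by auto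
  ultimately have p0: "0 < p" by simp
  have "2 * p \<le> int q"
  proof (rule ccontr)
    assume "\<not> 2 * p \<le> int q"
    hence y1: "2 * p - int q \<ge> 1" by simp
    obtain e0 f0 where b0: "p * e0 + int q * f0 = 1" using bezout_int[of p "int q"] cop
      by (auto simp: mult.commute)
    define e where "e = e0 mod int q"
    \<comment> \<open>Compensates the reduction of \<open>e0\<close> modulo q, so that p e - q E
      stays 1.\<close>
    define E where "E = - (f0 + p * (e0 div int q))"
    have be: "p * e - int q * E = 1"
    proof -
      have "p * e - int q * E = p * (e0 mod int q) + p * (int q * (e0 div int q)) + int q * f0"
        by (simp add: e_def E_def algebra_simps)
      also have "\<dots> = p * (e0 mod int q + int q * (e0 div int q)) + int q * f0"
        by (rule arg_cong[where f = "\<lambda>x. x + _"]) (rule distrib_left[symmetric])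
      finally show ?thesis using b0 by simp
    qed
    have "0 \<le> e" "e < int q" using qm by (auto simp: e_def)
    moreover have "e \<noteq> 0"
    proof
      assume "e = 0"
      hence "int q * (- E) = 1" using be by simp
      hence "int q dvd 1" by (metis dvd_triv_left)
      thus False using qm by auto
    qed
    ultimately have e: "0 < e" "e < int q" by auto
    \<comment> \<open>Measures how far E / e exceeds 1/2, as 2 p - q does for p / q. The bound 0 <=
      z controls the vector (e, E), and z < 2 p - q controls the remaining vector (q - e, p -
      E).\<close>
    define z where "z = 2 * E - e"
    have qz: "int q * z = e * (2 * p - int q) - 2" using be by (simp add: z_def algebra_simps)
    have "e * 1 \<le> e * (2 * p - int q)" using e y1 by (intro mult_left_mono) auto
    hence "int q * z \<ge> - 1" using qz e by linarith
    hence z0: "z \<ge> 0" using qm mult_left_mono[of z "-1" "int q"] by (cases "z \<ge> 0") auto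
    have "e * (2 * p - int q) \<le> int q * (2 * p - int q)" using e y1 by (intro mult_right_mono) auto
    hence "int q * z < int q * (2 * p - int q)" using qz by linarith
    hence zy: "z < 2 * p - int q" using qm by simp
    define i where "i = s + nat e"
    have i: "int i = int s + e" "real i = real s + of_int e" using e by (auto simp: i_def)
    have i2: "s < i" "i < s + q" using i(1) e by linarith+
    have oi: "real i * \<alpha> - of_int (U s + E) = offset \<alpha> U s + of_int e * \<alpha> - of_int E"
      by (simp add: offset_def i algebra_simps)
    have l1: "of_int e * \<alpha> \<le> of_int E"
    proof -
      have "of_int e * \<alpha> \<le> of_int e * (1 / 2)" using e \<alpha> by (intro mult_left_mono) auto
      moreover have "real_of_int e \<le> 2 * of_int E" using z0 z_def by linarith
      ultimately show ?thesis by linarith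
    qed
    have l2: "real q * \<alpha> - of_int p \<le> of_int e * \<alpha> - of_int E"
    proof -
      have "(real q - of_int e) * \<alpha> \<le> (real q - of_int e) * (1 / 2)" using e \<alpha> by (intro mult_left_mono) auto
      moreover have "int q - e \<le> 2 * (p - E)" using zy unfolding z_def by (simp add: algebra_simps)
      hence "real_of_int (int q - e) \<le> of_int (2 * (p - E))" by (rule of_int_le_iff[THEN iffD2])
      hence "real q - of_int e \<le> 2 * (of_int p - of_int E)" by simp
      ultimately show ?thesis by (simp add: algebra_simps)
    qed
    have "i \<in> S \<and> U i = U s + E"
    proof (rule stair_lattice_point[OF st pr])
      show "i \<le> n" using i2 sn by simp
      fix j assume j: "j \<le> n" "j \<notin> S"
      show "real i * \<alpha> - of_int (U s + E) < offset \<alpha> U j \<and> offset \<alpha> U j < real i * \<alpha> - of_int (U s + E) + 1"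
        unfolding oi using stairD[OF st sS(1) j] stairD[OF st sS(2) j] osq l1 l2 by linarith
    qed
    thus False using c0 i2 by (auto simp: consec_def)
  qed
  thus ?thesis using that cop p0 inc by blast
qed

section \<open>Farey fractions and cells\<close>

text \<open>The possible left ends of cells inside (0, 1/2): 0/1 is included, 1/2 is not.\<close>

definition farey :: "nat \<Rightarrow> (nat \<times> nat) set" where
  "farey n = {(p, q). 1 \<le> q \<and> q \<le> n \<and> coprime p q \<and> 2 * p < q}"

definition fval :: "nat \<times> nat \<Rightarrow> real" where
  "fval r = real (fst r) / real (snd r)"

text \<open>A slope so close to the right of \<open>r\<close> that no fraction with denominator at most \<open>n\<close> lies between.\<close>
definition fnext :: "nat \<Rightarrow> nat \<times> nat \<Rightarrow> real" where
  "fnext n r = fval r + 1 / (real n + 1)\<^sup>2"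

lemma finite_farey [simp]: "finite (farey n)"
proof (rule finite_subset)
  show "farey n \<subseteq> {..n} \<times> {..n}" by (auto simp: farey_def)
qed simp

lemma fval_inj: "inj_on fval (farey n)"
proof (rule inj_onI)
  fix r r' assume r: "r \<in> farey n" "r' \<in> farey n" "fval r = fval r'"
  obtain p q p' q' where pq: "r = (p, q)" "r' = (p', q')" by (metis surj_pair)
  have "real p * real q' = real p' * real q"
    using r by (auto simp: pq fval_def farey_def field_simps)
  hence "real (p * q') = real (p' * q)" by simp
  hence e: "p * q' = p' * q" using of_nat_eq_iff by blast
  have c: "coprime p q" "coprime p' q'" using r by (auto simp: pq farey_def)
  have "q dvd q'" using e c(1) by (metis coprime_commute coprime_dvd_mult_right_iff dvd_triv_right)
  moreover have "q' dvd q" using e c(2) by (metis coprime_commute coprime_dvd_mult_right_iff dvd_triv_right)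
  ultimately have "q = q'" by (rule dvd_antisym)
  moreover from this have "p = p'" using e r by (auto simp: pq farey_def)
  ultimately show "r = r'" by (simp add: pq)
qed

text \<open>An integer above b p / q exceeds it by at least 1 / q, while moving to
  \<open>fnext\<close> adds b / (n + 1)^2, which is less than 1 / q because b q <= n^2. This
  explains the constant in \<open>fnext\<close>.\<close>

lemma fnext_gap:
  fixes a :: int
  assumes r: "r \<in> farey n" and b: "b \<le> n" and lt: "real b * fval r < of_int a"
  shows "real b * fnext n r < of_int a"
proof -
  obtain p q where pq: "r = (p, q)" by (metis surj_pair)
  have q: "1 \<le> q" "q \<le> n" using r by (auto simp: pq farey_def)
  have "real b * real p < of_int a * real q" using lt q by (simp add: fval_def pq field_simps)
  hence "real_of_int (int b * int p) < of_int (a * int q)" by simp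
  hence "int b * int p < a * int q" using of_int_less_iff by blast
  hence "int b * int p + 1 \<le> a * int q" by simp
  hence "real_of_int (int b * int p + 1) \<le> of_int (a * int q)" using of_int_le_iff by blast
  hence "real b * real p + 1 \<le> of_int a * real q" by simp
  hence "(real b * real p + 1) / real q \<le> of_int a" using q by (simp add: divide_le_eq)
  hence 1: "real b * fval r + 1 / real q \<le> of_int a" using q by (simp add: fval_def pq field_simps)
  have "real b * real q \<le> real n * real n" using b q by (intro mult_mono) auto
  also have "\<dots> < (real n + 1)\<^sup>2" by (simp add: power2_eq_square algebra_simps)
  finally have "real b / (real n + 1)\<^sup>2 < 1 / real q"
    using q by (simp add: field_simps)
  with 1 show ?thesis by (simp add: fnext_def algebra_simps)
qed

lemma fval_nonneg: "fval r \<ge> 0"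
  by (simp add: fval_def)

lemma fval_lt_fnext: "fval r < fnext n r"
  by (simp add: fnext_def)

lemma fnext_pos: "fnext n r > 0"
  using fval_nonneg[of r] fval_lt_fnext[of r n] by linarith

lemma fnext_lt_half:
  assumes "r \<in> farey n" "n \<ge> 2"
  shows "fnext n r < 1 / 2"
proof -
  have "real 2 * fval r < of_int 1"
    using assms by (cases r) (auto simp: fval_def farey_def field_simps)
  from fnext_gap[OF assms this] show ?thesis by simp
qed

lemma fnext_less_fval:
  assumes "r \<in> farey n" "r' \<in> farey n" "fval r < fval r'"
  shows "fnext n r < fval r'"
proof -
  obtain p q where pq: "r' = (p, q)" by (metis surj_pair)
  have q: "1 \<le> q" "q \<le> n" using assms by (auto simp: pq farey_def)
  have "real q * fval r < of_int (int p)" using assms(3) q by (simp add: fval_def pq field_simps)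
  from fnext_gap[OF assms(1) q(2) this] show ?thesis using q by (simp add: fval_def pq field_simps)
qed

lemma sees_fnext: "r \<in> farey n \<Longrightarrow> sees n (fval r) (fnext n r)"
  unfolding sees_def
proof (intro ballI allI conjI impI)
  fix b a assume r: "r \<in> farey n" and b: "b \<in> {1..n}"
  show "of_int a < real b * fnext n r" if "of_int a < real b * fval r"
  proof -
    have "real b * fval r \<le> real b * fnext n r"
      using fval_lt_fnext[of r n] by (intro mult_left_mono) auto
    thus ?thesis using that by linarith
  qed
  show "real b * fnext n r < of_int a" if "real b * fval r < of_int a"
    using fnext_gap[OF r _ that] b by simp
qed

text \<open>\<open>r\<close> is the largest member of \<open>farey n\<close> not exceeding \<alpha>;
  a nonnegative fraction below \<alpha> with denominator at most \<open>n\<close> is in lowest terms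
  such a member, hence at most \<open>fval r\<close>.\<close>

lemma sees_farey:
  assumes n: "n \<ge> 1" and \<alpha>: "0 \<le> \<alpha>" "\<alpha> < 1 / 2"
  obtains r where "r \<in> farey n" "fval r \<le> \<alpha>" "sees n \<alpha> (fnext n r)"
proof -
  define X where "X = {r \<in> farey n. fval r \<le> \<alpha>}"
  have "finite X" by (simp add: X_def)
  moreover have "(0, 1) \<in> X" using n \<alpha> by (simp add: X_def farey_def fval_def)
  ultimately have fX: "finite (fval ` X)" "fval ` X \<noteq> {}" by auto
  obtain r where r: "r \<in> X" "fval r = Max (fval ` X)" using Max_in[OF fX] by fastforce
  have mx: "\<And>r'. r' \<in> X \<Longrightarrow> fval r' \<le> fval r" using r(2) fX by simp
  have rf: "r \<in> farey n" "fval r \<le> \<alpha>" using r by (auto simp: X_def)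
  have "sees n \<alpha> (fnext n r)"
    unfolding sees_def
  proof (intro ballI allI conjI impI)
    fix b and a :: int assume b: "b \<in> {1..n}"
    show "of_int a < real b * fnext n r" if lt: "of_int a < real b * \<alpha>"
    \<comment> \<open>\<open>farey n\<close> has no negative fractions, so negative \<open>a\<close>
      is settled by sign alone.\<close>
    proof (cases "a < 0")
      case True
      have "0 \<le> real b * fnext n r" using fnext_pos[of n r] by simp
      thus ?thesis using True by (smt (verit) of_int_less_0_iff)
    next
      case False
      define A where "A = nat a"
      define d where "d = gcd A b"
      have A: "of_int a = real A" using False by (simp add: A_def)
      have d: "d > 0" using b by (simp add: d_def)
      obtain p q where pq: "A = p * d" "b = q * d" "coprime p q"
        using gcd_coprime_exists[of A b] d unfolding d_def by blast
      have "q \<noteq> 0" using b pq by (intro notI) simp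
      hence q1: "q \<ge> 1" by simp
      have "q \<le> q * d" using d by simp
      moreover have "q * d \<le> n" using b pq(2) by simp
      ultimately have q: "q \<ge> 1" "q \<le> n" using q1 by linarith+
      have e: "real A / real b = fval (p, q)" using d by (simp add: fval_def pq)
      have "real A / real b < \<alpha>" using lt A b by (simp add: field_simps)
      hence l: "fval (p, q) < \<alpha>" using e by simp
      hence "fval (p, q) < 1 / 2" using \<alpha> by simp
      hence "real (2 * p) < real q" using q by (simp add: fval_def field_simps)
      hence "2 * p < q" using of_nat_less_iff by blast
      hence "(p, q) \<in> X" using q pq l by (simp add: X_def farey_def)
      hence "real A / real b \<le> fval r" using mx e by metis
      hence "real A / real b < fnext n r" using fval_lt_fnext[of r n] by linarith
      thus ?thesis using A b by (simp add: field_simps)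
    qed
    show "real b * fnext n r < of_int a" if "real b * \<alpha> < of_int a"
    proof (rule fnext_gap[OF rf(1)])
      have "real b * fval r \<le> real b * \<alpha>" using rf by (intro mult_left_mono) auto
      thus "real b * fval r < of_int a" using that by linarith
    qed (use b in simp)
  qed
  thus ?thesis using that rf by blast
qed

section \<open>Rotation sets of one slope, cells and their left ends\<close>

definition rotset :: "nat \<Rightarrow> real \<Rightarrow> nat set set" where
  "rotset n \<alpha> = {S. proper n S \<and> (\<exists>U. stair n \<alpha> U S)}"

text \<open>At slope 0 all offsets are integers, so no difference lies strictly between 0 and
  1.\<close>

lemma rotset_0: "rotset n 0 = {}"
proof -
  have False if pr: "proper n S" and st: "stair n 0 U S" for S U
  proof -
    obtain i j where ij: "i \<in> S" "j \<le> n" "j \<notin> S" using proper_obtain[OF pr] by blast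
    have "- U i < - U j" "- U j < - U i + 1"
      using stairD[OF st ij] unfolding offset_def by linarith+
    thus False by linarith
  qed
  thus ?thesis by (auto simp: rotset_def)
qed

lemma rotset_compl: "S \<in> rotset n \<alpha> \<Longrightarrow> {..n} - S \<in> rotset n \<alpha>"
  using stair_compl proper_compl unfolding rotset_def by blast

lemma rotset_sees: "sees n \<alpha> \<beta> \<Longrightarrow> rotset n \<alpha> \<subseteq> rotset n \<beta>"
  using stair_sees unfolding rotset_def proper_def by blast

text \<open>A cell that begins at r is open and misses r. No other cell of \<open>S\<close> contains
  r, for it would reach \<open>fnext n r\<close> as well, where the staircase is unique up to a
  constant. Hence the beginning of a cell can be recognised without naming \<open>U\<close>.\<close>

definition left_ends :: "nat \<Rightarrow> nat set \<Rightarrow> (nat \<times> nat) set" where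
  "left_ends n S = {r \<in> farey n. S \<in> rotset n (fnext n r) - rotset n (fval r)}"

text \<open>Staircases matter only up to constants and only on {0..n}; the value 0 at 0 and beyond
  \<open>n\<close> picks one representative for each cell.\<close>

definition cells :: "nat \<Rightarrow> nat set \<Rightarrow> (nat \<Rightarrow> int) set" where
  "cells n S = {U. U 0 = 0 \<and> (\<forall>i>n. U i = 0) \<and> (\<exists>\<alpha>. 0 < \<alpha> \<and> \<alpha> < 1 / 2 \<and> stair n \<alpha> U S)}"

lemma left_ends_compl:
  assumes "S \<subseteq> {..n}" shows "left_ends n ({..n} - S) = left_ends n S"
proof -
  have "{..n} - S \<in> rotset n \<alpha> \<longleftrightarrow> S \<in> rotset n \<alpha>" for \<alpha>
    using rotset_compl[of S n \<alpha>] rotset_compl[of "{..n} - S" n \<alpha>] compl_compl[OF assms] by auto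
  thus ?thesis by (simp add: left_ends_def)
qed

lemma finite_left_ends [simp]: "finite (left_ends n S)"
  by (rule finite_subset[of _ "farey n"]) (auto simp: left_ends_def)

lemma normalize:
  assumes st: "stair n \<alpha> U S" and "proper n S"
  obtains V where "V 0 = 0" "\<forall>i>n. V i = 0" "stair n \<alpha> V S" "agree n U V"
proof
  define V where "V = (\<lambda>i. if i \<le> n then U i - U 0 else 0)"
  show "V 0 = 0" "\<forall>i>n. V i = 0" by (auto simp: V_def)
  show "stair n \<alpha> V S" using stair_shift[OF st, of V "- U 0"] assms by (auto simp: V_def proper_def)
  have "\<forall>i\<le>n. U i = V i + U 0" by (simp add: V_def)
  thus "agree n U V" unfolding agree_def by blast
qed

lemma agree_normal_eq:
  assumes ag: "agree n U V" and "U 0 = 0" "\<forall>i>n. U i = 0" "V 0 = 0" "\<forall>i>n. V i = 0"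
  shows "U = V"
proof
  obtain c where c: "\<forall>i\<le>n. U i = V i + c" using ag by (auto simp: agree_def)
  hence "c = 0" using assms by auto
  fix i show "U i = V i" using c assms \<open>c = 0\<close> by (cases "i \<le> n") auto
qed

lemma stair_unique_agree:
  assumes "stair n \<alpha> U S" "stair n \<alpha> U' S" "proper n S"
  shows "agree n U U'"
proof -
  have "\<forall>i\<le>n. U i = U' i + (U 0 - U' 0)" using stair_unique[OF assms, of _ 0] by (smt (verit) zero_le)
  thus ?thesis unfolding agree_def by blast
qed

lemma stair_agree:
  assumes "stair n \<alpha> U S" "agree n U U'" "proper n S"
  shows "stair n \<alpha> U' S"
proof -
  obtain c where "\<forall>i\<le>n. U i = U' i + c" using assms(2) by (auto simp: agree_def)
  thus ?thesis using stair_shift[OF assms(1), of U' "-c"] assms(3) by (auto simp: proper_def)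
qed

text \<open>A cell containing r also contains slopes slightly below r and hence, by
  \<open>sees_farey\<close>, the point \<open>fnext\<close> of a smaller fraction.\<close>

lemma stair_left:
  assumes n: "n \<ge> 1" and r: "r \<in> farey n" and pr: "proper n S" and st: "stair n (fval r) U S"
  obtains r' where "r' \<in> farey n" "fval r' < fval r" "stair n (fnext n r') U S"
proof -
  have sub: "S \<subseteq> {..n}" using pr by (simp add: proper_def)
  have "fval r \<noteq> 0"
  proof
    assume "fval r = 0"
    hence "S \<in> rotset n 0" using st pr by (auto simp: rotset_def)
    thus False by (simp add: rotset_0)
  qed
  hence pos: "fval r > 0" using fval_nonneg[of r] by simp
  have half: "fval r < 1 / 2" using r by (cases r) (auto simp: farey_def fval_def field_simps)
  obtain \<delta> where \<delta>: "\<delta> > 0" "\<And>x. \<bar>x - fval r\<bar> < \<delta> \<Longrightarrow> stair n x U S"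
    using stair_open[OF st sub] by blast
  define \<alpha> where "\<alpha> = max (fval r / 2) (fval r - \<delta> / 2)"
  have \<alpha>: "0 \<le> \<alpha>" "\<alpha> < 1 / 2" "\<alpha> < fval r" "\<bar>\<alpha> - fval r\<bar> < \<delta>"
    using \<delta> pos half by (auto simp: \<alpha>_def max_def)
  obtain r' where r': "r' \<in> farey n" "fval r' \<le> \<alpha>" "sees n \<alpha> (fnext n r')" using sees_farey[OF n \<alpha>(1,2)] .
  show ?thesis using that[of r'] r' stair_sees[OF r'(3) \<delta>(2)[OF \<alpha>(4)] sub] \<alpha> by auto
qed

text \<open>The bijection sends r to the normalised staircase at \<open>fnext n r\<close>. Two left
  ends with the same staircase would by convexity put the larger one into the cell. Conversely, the
  smallest r with \<open>fnext n r\<close> in a given cell is a left end, by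
  \<open>stair_left\<close>.\<close>

lemma left_ends_cells_bij:
  assumes n: "n \<ge> 2" and pr: "proper n S"
  shows "\<exists>f. bij_betw f (left_ends n S) (cells n S)"
proof -
  have sub: "S \<subseteq> {..n}" using pr by (simp add: proper_def)
  define P where "P = (\<lambda>r U. U 0 = 0 \<and> (\<forall>i>n. U i = 0) \<and> stair n (fnext n r) U S)"
  define f where "f = (\<lambda>r. SOME U. P r U)"
  have f: "P r (f r)" if "r \<in> left_ends n S" for r
  proof -
    have "\<exists>U. stair n (fnext n r) U S" using that unfolding left_ends_def rotset_def by blast
    then obtain U where "stair n (fnext n r) U S" by blast
    then obtain V where "P r V" using normalize[OF _ pr] unfolding P_def by metis
    thus ?thesis unfolding f_def by (rule someI[where P = "P r"])
  qed
  have inj: "inj_on f (left_ends n S)"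
  proof -
    have False if r: "r \<in> left_ends n S" "r' \<in> left_ends n S" "f r = f r'" "fval r < fval r'" for r r'
    proof -
      have far: "r \<in> farey n" "r' \<in> farey n" using r by (auto simp: left_ends_def)
      have "stair n (fnext n r) (f r) S" "stair n (fnext n r') (f r) S"
        using f[OF r(1)] f[OF r(2)] r(3) by (auto simp: P_def)
      moreover have "fnext n r \<le> fval r'" "fval r' \<le> fnext n r'"
        using fnext_less_fval[OF far r(4)] fval_lt_fnext[of r' n] by auto
      ultimately have "stair n (fval r') (f r) S" by (rule stair_convex)
      thus False using r(2) pr by (auto simp: left_ends_def rotset_def)
    qed
    note less = this
    show ?thesis
    proof (rule inj_onI)
      fix r r' assume r: "r \<in> left_ends n S" "r' \<in> left_ends n S" "f r = f r'"
      have "fval r = fval r'" using less[OF r] less[OF r(2,1) r(3)[symmetric]] by (cases "fval r" "fval r'" rule: linorder_cases) auto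
      thus "r = r'" using fval_inj r by (auto simp: left_ends_def inj_on_def)
    qed
  qed
  have "f ` left_ends n S = cells n S"
  proof (intro equalityI subsetI)
    fix U assume "U \<in> f ` left_ends n S"
    then obtain r where r: "r \<in> left_ends n S" "U = f r" by blast
    hence "r \<in> farey n" by (simp add: left_ends_def)
    hence "0 < fnext n r" "fnext n r < 1 / 2" using fnext_pos fnext_lt_half n by auto
    thus "U \<in> cells n S" using f[OF r(1)] r(2) by (auto simp: P_def cells_def)
  next
    fix U assume "U \<in> cells n S"
    then obtain \<alpha> where U: "U 0 = 0" "\<forall>i>n. U i = 0" and \<alpha>: "0 < \<alpha>" "\<alpha> < 1 / 2" "stair n \<alpha> U S"
      by (auto simp: cells_def)
    define X where "X = {r \<in> farey n. stair n (fnext n r) U S}"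
    have "1 \<le> n" "0 \<le> \<alpha>" using n \<alpha> by simp_all
    then obtain r0 where "r0 \<in> farey n" "sees n \<alpha> (fnext n r0)"
      using sees_farey[of n \<alpha>] \<alpha>(2) by blast
    hence "r0 \<in> X" using stair_sees \<alpha> sub by (auto simp: X_def)
    moreover have "finite X" by (simp add: X_def)
    ultimately have fX: "finite (fval ` X)" "fval ` X \<noteq> {}" by auto
    obtain r where r: "r \<in> X" "fval r = Min (fval ` X)" using Min_in[OF fX] by fastforce
    have mn: "\<And>r'. r' \<in> X \<Longrightarrow> fval r \<le> fval r'" using r(2) fX by simp
    have rf: "r \<in> farey n" "stair n (fnext n r) U S" using r by (auto simp: X_def)
    have "\<not> stair n (fval r) U' S" for U'
    proof
      assume st: "stair n (fval r) U' S"
      have st2: "stair n (fnext n r) U' S" using stair_sees[OF sees_fnext[OF rf(1)] st sub] .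
      have "agree n U' U" using stair_unique_agree[OF st2 rf(2) pr] .
      hence "stair n (fval r) U S" using stair_agree[OF st _ pr] by blast
      then obtain r' where "r' \<in> farey n" "fval r' < fval r" "stair n (fnext n r') U S"
        using stair_left[of n r S U] n rf(1) pr by auto
      thus False using mn[of r'] by (auto simp: X_def)
    qed
    hence left_ends: "r \<in> left_ends n S" using rf pr by (auto simp: left_ends_def rotset_def)
    have "U = f r"
      using agree_normal_eq[of n U "f r"] stair_unique_agree[OF rf(2) _ pr, of "f r"] f[OF left_ends] U by (auto simp: P_def)
    thus "U \<in> f ` left_ends n S" using left_ends by blast
  qed
  thus ?thesis using inj unfolding bij_betw_def by blast
qed

lemma card_left_ends_eq_cells: "n \<ge> 2 \<Longrightarrow> proper n S \<Longrightarrow> card (left_ends n S) = card (cells n S)"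
  using left_ends_cells_bij bij_betw_same_card by blast

lemma left_ends_empty_iff: "n \<ge> 2 \<Longrightarrow> proper n S \<Longrightarrow> left_ends n S = {} \<longleftrightarrow> cells n S = {}"
  using left_ends_cells_bij bij_betw_empty1 bij_betw_empty2 by metis

section \<open>Sets with a single cell\<close>

lemma card_cells_1:
  assumes ne: "cells n S \<noteq> {}"
    and ag: "\<And>\<alpha> \<beta> U U'. 0 < \<alpha> \<Longrightarrow> \<alpha> < 1 / 2 \<Longrightarrow> 0 < \<beta> \<Longrightarrow> \<beta> < 1 / 2 \<Longrightarrow>
      stair n \<alpha> U S \<Longrightarrow> stair n \<beta> U' S \<Longrightarrow> agree n U U'"
  shows "card (cells n S) = 1"
proof -
  obtain U where U: "U \<in> cells n S" using ne by blast
  have "cells n S = {U}"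
  proof (intro equalityI subsetI)
    fix V assume V: "V \<in> cells n S"
    hence "agree n V U" using U ag unfolding cells_def by blast
    thus "V \<in> {U}" using agree_normal_eq[of n V U] U V by (auto simp: cells_def)
  qed (use U in simp)
  thus ?thesis by simp
qed

text \<open>Up to complement, the sets that may have several cells. Difference 2 is left out because
  it admits only the fraction 1/2, which separates no two slopes below 1/2; sets with adjacent
  elements are treated through their complement or by \<open>agree_mixed\<close>.\<close>

definition thin :: "nat \<Rightarrow> nat set \<Rightarrow> bool" where
  "thin n S \<longleftrightarrow> S \<subseteq> {..n} \<and> (\<exists>s q m. S = ap s q m \<and> (m = 0 \<or> q \<ge> 3))"

lemma agree_sparse:
  assumes st: "stair n \<alpha> U S" and st': "stair n \<beta> U' S" and pr: "proper n S"
    and \<alpha>: "0 < \<alpha>" "\<alpha> < 1 / 2" and \<beta>: "0 < \<beta>" "\<beta> < 1 / 2"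
    and sparse: "\<forall>x\<in>S. Suc x \<notin> S" and nt: "\<not> thin n S"
  shows "agree n U U'"
proof (cases "\<exists>s q m. q \<ge> 1 \<and> S = ap s q m")
  case False
  thus ?thesis using sparse_agree[OF st st' pr \<alpha> \<beta> sparse] agree_nonap[OF st st' pr] by metis
next
  case True
  then obtain s q m where q: "q \<ge> 1" and S: "S = ap s q m" by blast
  have "\<not> (m = 0 \<or> q \<ge> 3)" using nt S pr unfolding thin_def proper_def by blast
  hence m: "m \<ge> 1" "q < 3" by auto
  have "consec S s (s + q)" using consec_ap[of q 0 m s] q m by (simp add: S)
  hence "q \<noteq> 1" using sparse by (auto simp: consec_def)
  hence q2: "q = 2" using q m by simp
  obtain p where p: "coprime p (int q)" "0 < p" "2 * p \<le> int q"
    "\<And>k. k < m \<Longrightarrow> U (s + k * q + q) = U (s + k * q) + p"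
    using ap_slope[OF st pr \<alpha> S] q2 m by auto
  obtain p' where p': "coprime p' (int q)" "0 < p'" "2 * p' \<le> int q"
    "\<And>k. k < m \<Longrightarrow> U' (s + k * q + q) = U' (s + k * q) + p'"
    using ap_slope[OF st' pr \<beta> S] q2 m by auto
  \<comment> \<open>Now \<open>sep\<close> for q = 2 and p = 1 would put 1/2 strictly between two
    slopes below 1/2.\<close>
  have "p = 1" "p' = 1" using p p' q2 by auto
  thus ?thesis using agree_ap[OF st st' pr S q m(1), of p] p(4) p'(4) q2 \<alpha> \<beta> by (auto simp: sep_def)
qed

lemma agree_generic:
  assumes st: "stair n \<alpha> U S" and st': "stair n \<beta> U' S" and pr: "proper n S"
    and \<alpha>: "0 < \<alpha>" "\<alpha> < 1 / 2" and \<beta>: "0 < \<beta>" "\<beta> < 1 / 2"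
    and nt: "\<not> thin n S" "\<not> thin n ({..n} - S)"
  shows "agree n U U'"
proof (cases "\<forall>x\<in>S. Suc x \<notin> S")
  case True
  thus ?thesis using agree_sparse[OF st st' pr \<alpha> \<beta> _ nt(1)] by blast
next
  case False
  then obtain a where a: "a \<in> S" "Suc a \<in> S" by blast
  show ?thesis
  proof (cases "\<forall>x\<in>{..n} - S. Suc x \<notin> {..n} - S")
    case True
    have "agree n (\<lambda>i. U i - of_bool (i \<in> S)) (\<lambda>i. U' i - of_bool (i \<in> S))"
      using agree_sparse[OF stair_compl[OF st] stair_compl[OF st'] proper_compl[OF pr] \<alpha> \<beta> True nt(2)] .
    thus ?thesis by (simp add: agree_def)
  next
    case False
    then obtain b where "b \<notin> S" "Suc b \<notin> S" "Suc b \<le> n" by auto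
    thus ?thesis using agree_mixed[OF st st' \<alpha> \<beta> a] by blast
  qed
qed

lemma card_left_ends_generic:
  assumes n: "n \<ge> 2" and pr: "proper n S" and ne: "left_ends n S \<noteq> {}"
    and nt: "\<not> thin n S" "\<not> thin n ({..n} - S)"
  shows "card (left_ends n S) = 1"
proof -
  have "card (cells n S) = 1"
    using card_cells_1[of n S] ne left_ends_empty_iff[OF n pr] agree_generic[OF _ _ pr _ _ _ _ nt] by blast
  thus ?thesis using card_left_ends_eq_cells[OF n pr] by simp
qed

section \<open>Counting rotation sets of a fixed slope\<close>

definition arc :: "nat \<Rightarrow> real \<Rightarrow> real \<Rightarrow> real \<Rightarrow> nat set" where
  "arc n \<alpha> x y = {i. i \<le> n \<and> frac (real i * \<alpha>) \<in> circle_interval x y}"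

lemma frac_add_int: "frac (x + of_int m) = frac (x :: real)"
  by (simp add: frac_def)

lemma frac_offset: "frac (offset \<alpha> U i) = frac (real i * \<alpha>)"
  using frac_add_int[of "real i * \<alpha>" "- U i"] by (simp add: offset_def)

text \<open>Cut open at \<beta>, the circle becomes [\<beta>, \<beta> + 1) and the interval an
  initial segment of it; for \<beta> = \<gamma> this is the whole circle, in accordance with
  \<open>circle_interval\<close>.\<close>

lemma circle_interval_lift:
  assumes "0 \<le> \<beta>" "\<beta> < 1" "0 \<le> \<gamma>" "\<gamma> < 1" "\<beta> \<le> x" "x < \<beta> + 1"
  shows "frac x \<in> circle_interval \<beta> \<gamma> \<longleftrightarrow> x < (if \<beta> < \<gamma> then \<gamma> else \<gamma> + 1)"
proof (cases "x < 1")
  case True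
  hence "frac x = x" using assms by (simp add: frac_eq)
  thus ?thesis using assms True by (auto simp: circle_interval_def)
next
  case False
  hence "frac x = x - 1" using assms frac_add_int[of "x - 1" 1] by (simp add: frac_eq)
  thus ?thesis using assms False by (auto simp: circle_interval_def)
qed

lemma circle_interval_frac:
  assumes "a \<le> x" "x < a + 1" "a < b" "b < a + 1"
  shows "frac x \<in> circle_interval (frac a) (frac b) \<longleftrightarrow> x < b"
proof -
  define m where "m = \<lfloor>a\<rfloor>"
  have fa: "frac a = a - of_int m" by (simp add: frac_def m_def)
  have m: "of_int m \<le> a" "a < of_int m + 1" by (auto simp: m_def)
  have fx: "frac (x - of_int m) = frac x" using frac_add_int[of x "- m"] by simp
  have fb: "frac b = (if b < of_int m + 1 then b - of_int m else b - of_int m - 1)"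
  proof (cases "b < of_int m + 1")
    case True
    hence "\<lfloor>b\<rfloor> = m" using assms m by (intro floor_unique) auto
    thus ?thesis using True by (simp add: frac_def)
  next
    case False
    hence "\<lfloor>b\<rfloor> = m + 1" using assms m by (intro floor_unique) auto
    thus ?thesis using False by (simp add: frac_def)
  qed
  have "frac (x - of_int m) \<in> circle_interval (frac a) (frac b)
      \<longleftrightarrow> x - of_int m < (if frac a < frac b then frac b else frac b + 1)"
    using assms fa m by (intro circle_interval_lift) (auto simp: frac_lt_1)
  also have "\<dots> \<longleftrightarrow> x < b" using fa fb assms m by auto
  finally show ?thesis using fx by simp
qed

lemma arc_rotset:
  assumes "0 \<le> \<beta>" "\<beta> < 1" "0 \<le> \<gamma>" "\<gamma> < 1" "proper n (arc n \<alpha> \<beta> \<gamma>)"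
  shows "arc n \<alpha> \<beta> \<gamma> \<in> rotset n \<alpha>"
proof -
  \<comment> \<open>This floor puts all offsets into [\<beta>, \<beta> + 1).\<close>
  define U where "U = (\<lambda>k::nat. \<lfloor>real k * \<alpha> - \<beta>\<rfloor>)"
  define \<gamma>' where "\<gamma>' = (if \<beta> < \<gamma> then \<gamma> else \<gamma> + 1)"
  have b: "\<beta> \<le> offset \<alpha> U k" "offset \<alpha> U k < \<beta> + 1" for k
    unfolding offset_def U_def by linarith+
  have "k \<in> arc n \<alpha> \<beta> \<gamma> \<longleftrightarrow> offset \<alpha> U k < \<gamma>'" if "k \<le> n" for k
    using circle_interval_lift[OF assms(1-4) b[of k]] that
    by (simp add: arc_def frac_offset \<gamma>'_def)
  moreover have "arc n \<alpha> \<beta> \<gamma> \<subseteq> {..n}" by (auto simp: arc_def)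
  ultimately have "stair n \<alpha> U (arc n \<alpha> \<beta> \<gamma>)"
    unfolding stair_def
  proof (intro ballI)
    fix i j assume *: "\<And>k. k \<le> n \<Longrightarrow> (k \<in> arc n \<alpha> \<beta> \<gamma>) = (offset \<alpha> U k < \<gamma>')"
      "arc n \<alpha> \<beta> \<gamma> \<subseteq> {..n}" and i: "i \<in> arc n \<alpha> \<beta> \<gamma>" and j: "j \<in> {..n} - arc n \<alpha> \<beta> \<gamma>"
    have "offset \<alpha> U i < \<gamma>'" "\<gamma>' \<le> offset \<alpha> U j" using *(1)[of i] *(1)[of j] *(2) i j by auto
    thus "offset \<alpha> U i < offset \<alpha> U j \<and> offset \<alpha> U j < offset \<alpha> U i + 1" using b[of i] b[of j] by linarith
  qed
  thus ?thesis using assms by (auto simp: rotset_def)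
qed

text \<open>The arc can begin at the smallest offset on \<open>S\<close> and end at the smallest
  offset on the complement, so that both ends are orbit points.\<close>

lemma rotset_arc:
  assumes "S \<in> rotset n \<alpha>"
  obtains i j where "i \<le> n" "j \<le> n" "frac (real i * \<alpha>) \<noteq> frac (real j * \<alpha>)"
    "S = arc n \<alpha> (frac (real i * \<alpha>)) (frac (real j * \<alpha>))"
proof -
  obtain U where pr: "proper n S" and st: "stair n \<alpha> U S" using assms by (auto simp: rotset_def)
  define o' where "o' = offset \<alpha> U"
  have fin: "finite (o' ` S)" "o' ` S \<noteq> {}" "finite (o' ` ({..n} - S))" "o' ` ({..n} - S) \<noteq> {}"
    using pr finite_subset by (auto simp: proper_def)
  obtain i where i: "i \<in> S" "o' i = Min (o' ` S)" using Min_in[OF fin(1,2)] by fastforce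
  obtain j where j: "j \<in> {..n} - S" "o' j = Min (o' ` ({..n} - S))" using Min_in[OF fin(3,4)] by fastforce
  have i2: "o' i \<le> o' k" if "k \<in> S" for k using that fin i by simp
  have j2: "o' j \<le> o' k" if "k \<in> {..n} - S" for k using that fin j by simp
  have ij: "o' i < o' j" "o' j < o' i + 1" using stairD[OF st i(1), of j] j by (auto simp: o'_def)
  have "k \<in> S \<longleftrightarrow> frac (real k * \<alpha>) \<in> circle_interval (frac (real i * \<alpha>)) (frac (real j * \<alpha>))" if k: "k \<le> n" for k
  proof -
    have b: "o' i \<le> o' k \<and> o' k < o' i + 1 \<and> (k \<in> S \<longleftrightarrow> o' k < o' j)"
    proof (cases "k \<in> S")
      case True
      have "o' k < o' j" using stairD(1)[OF st True, of j] j by (simp add: o'_def)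
      thus ?thesis using True i2[OF True] ij by auto
    next
      case False
      thus ?thesis using stairD(2)[OF st i(1) k False] j2[of k] k ij by (auto simp: o'_def)
    qed
    have "frac (o' k) \<in> circle_interval (frac (o' i)) (frac (o' j)) \<longleftrightarrow> o' k < o' j"
      by (rule circle_interval_frac) (use b ij in auto)
    thus ?thesis using b by (simp add: o'_def frac_offset)
  qed
  hence "S = arc n \<alpha> (frac (real i * \<alpha>)) (frac (real j * \<alpha>))"
    using pr by (auto simp: arc_def proper_def)
  moreover have "frac (real i * \<alpha>) \<noteq> frac (real j * \<alpha>)"
  proof
    assume "frac (real i * \<alpha>) = frac (real j * \<alpha>)"
    hence "frac (o' i) = frac (o' j)" by (simp add: o'_def frac_offset)
    hence "o' j - o' i = of_int (\<lfloor>o' j\<rfloor> - \<lfloor>o' i\<rfloor>)" by (simp add: frac_def)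
    hence "0 < real_of_int (\<lfloor>o' j\<rfloor> - \<lfloor>o' i\<rfloor>)" "real_of_int (\<lfloor>o' j\<rfloor> - \<lfloor>o' i\<rfloor>) < 1" using ij by linarith+
    hence "0 < \<lfloor>o' j\<rfloor> - \<lfloor>o' i\<rfloor>" "\<lfloor>o' j\<rfloor> - \<lfloor>o' i\<rfloor> < 1" by simp_all
    thus False by linarith
  qed
  moreover have "i \<le> n" "j \<le> n" using i j pr by (auto simp: proper_def)
  ultimately show ?thesis using that by blast
qed

text \<open>Each arc contains the start of the other. If the starts differed, the way from x' round
  to x would pass y inside the second arc, which is excluded; with equal starts the earlier end
  would lie in the other arc.\<close>

lemma circle_interval_inj:
  assumes "x \<in> circle_interval x' y'" "x' \<in> circle_interval x y" "y \<notin> circle_interval x' y'"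
    "y' \<notin> circle_interval x y" "x \<noteq> y" "x' \<noteq> y'"
    "0 \<le> x" "x < 1" "0 \<le> y" "y < 1" "0 \<le> x'" "x' < 1" "0 \<le> y'" "y' < 1"
  shows "x = x' \<and> y = y'"
  using assms by (auto simp: circle_interval_def split: if_splits)

lemma circle_interval_ends:
  assumes "x \<noteq> y" "0 \<le> x" "x < 1" "0 \<le> y" "y < 1"
  shows "x \<in> circle_interval x y" "y \<notin> circle_interval x y"
  using assms by (auto simp: circle_interval_def)

text \<open>Rotation sets correspond to ordered pairs of distinct orbit points, the starts of the
  arc and of its complement.\<close>

lemma card_rotset:
  fixes n \<alpha>
  defines "v \<equiv> card ((\<lambda>i. frac (real i * \<alpha>)) ` {..n})"
  shows "card (rotset n \<alpha>) = v * (v - 1)"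
proof -
  define V where "V = (\<lambda>i. frac (real i * \<alpha>)) ` {..n}"
  have finV: "finite V" by (simp add: V_def)
  have V01: "0 \<le> x" "x < 1" if "x \<in> V" for x using that by (auto simp: V_def frac_lt_1)
  define D where "D = {(x, y) \<in> V \<times> V. x \<noteq> y}"
  have ends: "\<exists>i. i \<in> arc n \<alpha> x y \<and> frac (real i * \<alpha>) = x" "\<exists>i. i \<le> n \<and> i \<notin> arc n \<alpha> x y \<and> frac (real i * \<alpha>) = y"
    if "(x, y) \<in> D" for x y
  proof -
    have xy: "x \<in> V" "y \<in> V" "x \<noteq> y" using that by (auto simp: D_def)
    have c: "x \<in> circle_interval x y" "y \<notin> circle_interval x y"
      using circle_interval_ends xy V01 by blast+
    obtain i j where ij: "i \<le> n" "x = frac (real i * \<alpha>)" "j \<le> n" "y = frac (real j * \<alpha>)"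
      using xy by (auto simp: V_def)
    show "\<exists>i. i \<in> arc n \<alpha> x y \<and> frac (real i * \<alpha>) = x"
      using ij c by (intro exI[of _ i]) (simp add: arc_def)
    show "\<exists>i. i \<le> n \<and> i \<notin> arc n \<alpha> x y \<and> frac (real i * \<alpha>) = y"
      using ij c by (intro exI[of _ j]) (simp add: arc_def)
  qed
  have "rotset n \<alpha> = (\<lambda>(x, y). arc n \<alpha> x y) ` D"
  proof (intro equalityI subsetI)
    fix S assume "S \<in> rotset n \<alpha>"
    then obtain i j where "i \<le> n" "j \<le> n" "frac (real i * \<alpha>) \<noteq> frac (real j * \<alpha>)"
      "S = arc n \<alpha> (frac (real i * \<alpha>)) (frac (real j * \<alpha>))" using rotset_arc by blast
    thus "S \<in> (\<lambda>(x, y). arc n \<alpha> x y) ` D"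
      by (intro image_eqI[of _ _ "(frac (real i * \<alpha>), frac (real j * \<alpha>))"]) (auto simp: D_def V_def)
  next
    fix S assume "S \<in> (\<lambda>(x, y). arc n \<alpha> x y) ` D"
    then obtain x y where xy: "(x, y) \<in> D" "S = arc n \<alpha> x y" by auto
    have "proper n S" using ends[OF xy(1)] xy(2) by (auto simp: proper_def arc_def)
    thus "S \<in> rotset n \<alpha>" using arc_rotset[of x y n \<alpha>] V01 xy by (auto simp: D_def)
  qed
  moreover have "inj_on (\<lambda>(x, y). arc n \<alpha> x y) D"
  proof (rule inj_onI)
    fix d d' assume dd: "d \<in> D" "d' \<in> D" "(\<lambda>(x, y). arc n \<alpha> x y) d = (\<lambda>(x, y). arc n \<alpha> x y) d'"
    obtain x y x' y' where d: "d = (x, y)" "d' = (x', y')" by (metis surj_pair)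
    have mem: "(x, y) \<in> D" "(x', y') \<in> D" and eq: "arc n \<alpha> x y = arc n \<alpha> x' y'" using dd by (auto simp: d)
    have "x \<in> circle_interval x' y'" "y \<notin> circle_interval x' y'"
      using ends[OF mem(1)] unfolding eq by (auto simp: arc_def)
    moreover have "x' \<in> circle_interval x y" "y' \<notin> circle_interval x y"
      using ends[OF mem(2)] unfolding eq[symmetric] by (auto simp: arc_def)
    ultimately show "d = d'" using circle_interval_inj[of x x' y' y] mem V01 by (auto simp: D_def d)
  qed
  ultimately have "card (rotset n \<alpha>) = card D" by (simp add: card_image)
  also have "D = V \<times> V - (\<lambda>x. (x, x)) ` V" by (auto simp: D_def)
  also have "card \<dots> = card (V \<times> V) - card ((\<lambda>x. (x, x)) ` V)"
    using finV by (intro card_Diff_subset) auto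
  also have "card ((\<lambda>x. (x, x)) ` V) = card V" by (intro card_image inj_onI) auto
  finally show ?thesis by (simp add: v_def V_def card_cartesian_product diff_mult_distrib2)
qed

lemma fnext_not_int:
  assumes r: "r \<in> farey n" and e: "e \<noteq> 0" "\<bar>e\<bar> \<le> int n"
  shows "of_int e * fnext n r \<noteq> of_int k"
proof -
  have *: "real b * fnext n r \<noteq> of_int l" if b: "b \<in> {1..n}" for b l
  proof (cases "real b * fval r < of_int l")
    case True
    thus ?thesis using fnext_gap[OF r _ True] b by simp
  next
    case False
    moreover have "real b * fval r < real b * fnext n r"
      using b fval_lt_fnext[of r n] by (intro mult_strict_left_mono) auto
    ultimately show ?thesis by linarith
  qed
  show ?thesis
  proof (cases "e > 0")
    case True
    hence "nat e \<in> {1..n}" "real (nat e) = of_int e" using e by auto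
    thus ?thesis using *[of "nat e" k] by simp
  next
    case False
    hence "nat (-e) \<in> {1..n}" "real (nat (-e)) = - of_int e" using e by auto
    thus ?thesis using *[of "nat (-e)" "-k"] by simp
  qed
qed

lemma fval_int_iff:
  assumes r: "(p, q) \<in> farey n"
  shows "(\<exists>k. of_int e * fval (p, q) = of_int k) \<longleftrightarrow> int q dvd e"
proof -
  have q: "q \<ge> 1" "coprime p q" using r by (auto simp: farey_def)
  have iff: "of_int e * fval (p, q) = of_int k \<longleftrightarrow> e * int p = k * int q" for k
  proof -
    have "of_int e * fval (p, q) = of_int k \<longleftrightarrow> real_of_int (e * int p) = of_int (k * int q)"
      using q by (simp add: fval_def field_simps)
    thus ?thesis using of_int_eq_iff by blast
  qed
  have cop: "coprime (int q) (int p)" using q by (simp add: coprime_commute)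
  show ?thesis
  proof
    assume "\<exists>k. of_int e * fval (p, q) = of_int k"
    then obtain k where "e * int p = k * int q" using iff by blast
    hence "int q dvd e * int p" by (metis dvd_triv_right)
    thus "int q dvd e" using cop coprime_dvd_mult_left_iff by blast
  next
    assume "int q dvd e"
    then obtain l where "e = int q * l" by (elim dvdE)
    hence "e * int p = (l * int p) * int q" by simp
    thus "\<exists>k. of_int e * fval (p, q) = of_int k" using iff by blast
  qed
qed

lemma card_rotset_fnext:
  assumes r: "r \<in> farey n"
  shows "card (rotset n (fnext n r)) = (n + 1) * n"
proof -
  have "inj_on (\<lambda>i. frac (real i * fnext n r)) {..n}"
  proof (rule inj_onI, rule ccontr)
    fix i j assume ij: "i \<in> {..n}" "j \<in> {..n}" "frac (real i * fnext n r) = frac (real j * fnext n r)" "i \<noteq> j"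
    have "of_int (int i - int j) * fnext n r = of_int (\<lfloor>real i * fnext n r\<rfloor> - \<lfloor>real j * fnext n r\<rfloor>)"
      using ij(3) by (simp add: frac_def algebra_simps)
    moreover have "int i - int j \<noteq> 0" "\<bar>int i - int j\<bar> \<le> int n" using ij by auto
    ultimately show False using fnext_not_int[OF r] by blast
  qed
  hence "card ((\<lambda>i. frac (real i * fnext n r)) ` {..n}) = n + 1" by (simp add: card_image)
  thus ?thesis by (simp add: card_rotset)
qed

lemma card_rotset_fval:
  assumes r: "(p, q) \<in> farey n"
  shows "card (rotset n (fval (p, q))) = q * (q - 1)"
proof -
  have q: "q \<ge> 1" "q \<le> n" using r by (auto simp: farey_def)
  define F where "F = (\<lambda>i::nat. frac (real i * fval (p, q)))"
  have diff: "F i = F j \<longleftrightarrow> int q dvd int i - int j" for i j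
  proof -
    have "F i = F j \<longleftrightarrow> (\<exists>k. of_int (int i - int j) * fval (p, q) = of_int k)"
    proof
      assume "F i = F j"
      hence "of_int (int i - int j) * fval (p, q) = of_int (\<lfloor>real i * fval (p, q)\<rfloor> - \<lfloor>real j * fval (p, q)\<rfloor>)"
        by (simp add: F_def frac_def algebra_simps)
      thus "\<exists>k. of_int (int i - int j) * fval (p, q) = of_int k" by blast
    next
      assume "\<exists>k. of_int (int i - int j) * fval (p, q) = of_int k"
      then obtain k where "of_int (int i - int j) * fval (p, q) = of_int k" by blast
      hence "real i * fval (p, q) = real j * fval (p, q) + of_int k" by (simp add: algebra_simps)
      thus "F i = F j" by (simp add: F_def frac_add_int)
    qed
    thus ?thesis using fval_int_iff[OF r, of "int i - int j"] by blast
  qed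
  have "F ` {..n} = F ` {..<q}"
  proof (intro equalityI subsetI)
    fix x assume "x \<in> F ` {..n}"
    then obtain i where i: "x = F i" by blast
    have "int q dvd int i - int (i mod q)" by (simp add: zmod_int)
    hence "F i = F (i mod q)" using diff by blast
    thus "x \<in> F ` {..<q}" using i q by (intro image_eqI[of _ _ "i mod q"]) auto
  qed (use q in auto)
  moreover have "inj_on F {..<q}"
  proof (rule inj_onI)
    fix i j assume ij: "i \<in> {..<q}" "j \<in> {..<q}" "F i = F j"
    hence "int q dvd int i - int j" using diff by blast
    hence "int i mod int q = int j mod int q" by (simp add: mod_eq_dvd_iff)
    thus "i = j" using ij by simp
  qed
  ultimately have "card (F ` {..n}) = q" by (simp add: card_image)
  thus ?thesis using card_rotset[of n "fval (p, q)"] by (simp add: F_def)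
qed

text \<open>Double counting of the pairs of a set and one of its left ends. Since rotation sets at r
  survive at \<open>fnext n r\<close>, the two counts for r can simply be subtracted.\<close>

lemma sum_card_left_ends:
  "(\<Sum>S\<in>Pow {..n}. card (left_ends n S)) = (\<Sum>(p, q)\<in>farey n. (n + 1) * n - q * (q - 1))"
proof -
  define D where "D = (\<lambda>r. rotset n (fnext n r) - rotset n (fval r))"
  have Dsub: "D r \<subseteq> Pow {..n}" for r by (auto simp: D_def rotset_def proper_def)
  have "card (left_ends n S) = (\<Sum>r\<in>farey n. of_bool (S \<in> D r))" for S
    by (simp add: left_ends_def D_def of_bool_def sum.If_cases Int_def)
  hence "(\<Sum>S\<in>Pow {..n}. card (left_ends n S)) = (\<Sum>S\<in>Pow {..n}. \<Sum>r\<in>farey n. of_bool (S \<in> D r))" by simp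
  also have "\<dots> = (\<Sum>r\<in>farey n. \<Sum>S\<in>Pow {..n}. of_bool (S \<in> D r))" by (rule sum.swap)
  also have "\<dots> = (\<Sum>r\<in>farey n. card (D r))"
  proof (rule sum.cong[OF refl])
    fix r
    have "Pow {..n} \<inter> {S. S \<in> D r} = D r" using Dsub[of r] by blast
    thus "(\<Sum>S\<in>Pow {..n}. of_bool (S \<in> D r)) = card (D r)"
      by (simp add: of_bool_def sum.If_cases)
  qed
  also have "\<dots> = (\<Sum>(p, q)\<in>farey n. (n + 1) * n - q * (q - 1))"
  proof (rule sum.cong[OF refl], safe)
    fix p q assume r: "(p, q) \<in> farey n"
    have "rotset n (fval (p, q)) \<subseteq> Pow {..n}" by (auto simp: rotset_def proper_def)
    hence "finite (rotset n (fval (p, q)))" by (rule finite_subset) simp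
    thus "card (D (p, q)) = (n + 1) * n - q * (q - 1)"
      unfolding D_def using rotset_sees[OF sees_fnext[OF r]]
      by (simp add: card_Diff_subset card_rotset_fnext[OF r] card_rotset_fval[OF r])
  qed
  finally show ?thesis .
qed


text \<open>Slope 0 has no rotation sets, slope 1/2 is left by openness, and slopes above 1/2 are
  reflected to 1 - \<alpha>, which keeps \<open>S\<close>.\<close>

lemma left_ends_nonempty:
  assumes n: "n \<ge> 2" and S: "S \<in> rotset n \<alpha>" and \<alpha>: "0 \<le> \<alpha>" "\<alpha> < 1"
  shows "left_ends n S \<noteq> {}"
proof -
  obtain U where pr: "proper n S" and st: "stair n \<alpha> U S" using S by (auto simp: rotset_def)
  have sub: "S \<subseteq> {..n}" using pr by (simp add: proper_def)
  have main: "left_ends n S \<noteq> {}" if "0 < \<alpha>" "\<alpha> < 1 / 2" "stair n \<alpha> U S" for \<alpha> U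
  proof -
    obtain V where "V 0 = 0" "\<forall>i>n. V i = 0" "stair n \<alpha> V S"
      using normalize[OF \<open>stair n \<alpha> U S\<close> pr] by metis
    hence "V \<in> cells n S" using that by (auto simp: cells_def)
    thus ?thesis using left_ends_empty_iff[OF n pr] by blast
  qed
  consider "\<alpha> = 0" | "0 < \<alpha>" "\<alpha> < 1 / 2" | "\<alpha> = 1 / 2" | "\<alpha> > 1 / 2" using \<alpha> by linarith
  thus ?thesis
  proof cases
    case 1
    thus ?thesis using S by (simp add: rotset_0)
  next
    case 2
    thus ?thesis using main st by blast
  next
    case 3
    obtain \<delta> where \<delta>: "\<delta> > 0" "\<And>x. \<bar>x - \<alpha>\<bar> < \<delta> \<Longrightarrow> stair n x U S"
      using stair_open[OF st sub] by blast
    define x where "x = max (1 / 4) (\<alpha> - \<delta> / 2)"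
    have "\<bar>x - \<alpha>\<bar> < \<delta>" "0 < x" "x < 1 / 2" using \<delta>(1) 3 by (auto simp: x_def max_def)
    thus ?thesis using main \<delta>(2) by blast
  next
    case 4
    have "stair n (1 - \<alpha>) (\<lambda>i. of_bool (i \<in> S) - U i + int i * 1) S"
      using stair_add_int[OF stair_neg[OF st], of 1] by simp
    thus ?thesis using main[of "1 - \<alpha>"] 4 \<alpha> by simp
  qed
qed

text \<open>Words correspond to the position sets of their ones. The summand 2 stands for the
  constant words, whose sets are not \<open>proper\<close> and have no left ends.\<close>

lemma num_rotation_words_eq:
  assumes n: "n \<ge> 2"
  shows "num_rotation_words (n + 1) = card {S \<in> Pow {..n}. left_ends n S \<noteq> {}} + 2"
proof -
  define T where "T = {S \<in> Pow {..n}. left_ends n S \<noteq> {}}"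
  define A where "A = {arc n \<alpha> \<beta> \<gamma> | \<alpha> \<beta> \<gamma>. \<alpha> \<in> {0..<1} \<and> \<beta> \<in> {0..<1} \<and> \<gamma> \<in> {0..<1}}"
  define G where "G = (\<lambda>S. map (\<lambda>i. if i \<in> S then 1 else 0 :: nat) [0..<n + 1])"
  have G: "rotation_prefix \<alpha> \<beta> \<gamma> (n + 1) = G (arc n \<alpha> \<beta> \<gamma>)" for \<alpha> \<beta> \<gamma>
    unfolding rotation_prefix_def G_def
    by (rule map_cong[OF refl]) (auto simp: rotation_letter_def arc_def)
  have "rotation_words (n + 1) = G ` A"
    unfolding rotation_words_def A_def G by blast
  moreover have "inj_on G A"
  proof (rule inj_onI)
    fix S S' assume S: "S \<in> A" "S' \<in> A" "G S = G S'"
    have sub: "S \<subseteq> {..n}" "S' \<subseteq> {..n}" using S by (auto simp: A_def arc_def)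
    have "i \<in> S \<longleftrightarrow> i \<in> S'" if "i \<le> n" for i
    proof -
      have "G S ! i = G S' ! i" using S by simp
      moreover have "G R ! i = (if i \<in> R then 1 else 0)" for R
        using that unfolding G_def by (subst nth_map) (auto simp del: upt_Suc simp: nth_upt)
      ultimately show ?thesis by (auto split: if_splits)
    qed
    thus "S = S'" using sub by blast
  qed
  ultimately have "num_rotation_words (n + 1) = card A"
    by (simp add: num_rotation_words_def card_image)
  also have "A = insert {} (insert {..n} T)"
  proof (intro equalityI subsetI)
    fix S assume "S \<in> A"
    then obtain \<alpha> \<beta> \<gamma> where S: "S = arc n \<alpha> \<beta> \<gamma>" and p: "0 \<le> \<alpha>" "\<alpha> < 1" "0 \<le> \<beta>" "\<beta> < 1" "0 \<le> \<gamma>" "\<gamma> < 1"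
      by (auto simp: A_def)
    have sub: "S \<subseteq> {..n}" by (auto simp: S arc_def)
    show "S \<in> insert {} (insert {..n} T)"
    proof (cases "proper n S")
      case True
      hence "S \<in> rotset n \<alpha>" using arc_rotset p S by blast
      thus ?thesis using left_ends_nonempty[OF n _ p(1,2)] sub by (simp add: T_def)
    qed (use sub in \<open>auto simp: proper_def\<close>)
  next
    fix S assume "S \<in> insert {} (insert {..n} T)"
    then consider "S = {}" | "S = {..n}" | "S \<in> T" by blast
    thus "S \<in> A"
    proof cases
      case 1
      \<comment> \<open>At slope 0 the orbit is {0}, which this interval avoids.\<close>
      have "S = arc n 0 (1/2) (3/4)" using 1 by (auto simp: arc_def circle_interval_def)
      thus ?thesis unfolding A_def by force
    next
      case 2
      have "S = arc n 0 0 0" using 2 by (auto simp: arc_def circle_interval_def)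
      thus ?thesis unfolding A_def by force
    next
      case 3
      then obtain r where r: "r \<in> farey n" "S \<in> rotset n (fnext n r)" by (auto simp: T_def left_ends_def)
      obtain i j where "S = arc n (fnext n r) (frac (real i * fnext n r)) (frac (real j * fnext n r))"
        using rotset_arc[OF r(2)] by metis
      moreover have "0 \<le> fnext n r" "fnext n r < 1" using fnext_pos[of n r] fnext_lt_half[OF r(1) n] by auto
      ultimately show ?thesis unfolding A_def by (force simp: frac_lt_1)
    qed
  qed
  also have "card \<dots> = card T + 2"
  proof -
    have "proper n S" if "S \<in> T" for S using that by (auto simp: T_def left_ends_def rotset_def)
    hence "{} \<notin> T" "{..n} \<notin> T" by (auto simp: proper_def)
    moreover have "finite T" by (simp add: T_def)
    ultimately show ?thesis by simp
  qed
  finally show ?thesis by (simp add: T_def)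
qed

section \<open>Singletons and arithmetic progressions\<close>

definition halves :: "nat \<Rightarrow> nat set" where
  "halves q = {p. coprime p q \<and> 2 * p < q}"

lemma finite_halves [simp]: "finite (halves q)"
  by (rule finite_subset[of _ "{..q}"]) (auto simp: halves_def)

lemma halves_1: "halves 1 = {0}"
  by (auto simp: halves_def)

lemma halves_2: "halves 2 = {}"
proof -
  have "p \<notin> halves 2" for p by (cases "p = 0") (auto simp: halves_def)
  thus ?thesis by blast
qed

lemma halves_pos: "p \<in> halves q \<Longrightarrow> q \<ge> 2 \<Longrightarrow> p > 0"
  by (cases "p = 0") (auto simp: halves_def)

lemma coprime_diff_iff:
  fixes p q :: nat
  assumes "p \<le> q"
  shows "coprime (q - p) q \<longleftrightarrow> coprime p q"
proof -
  have "gcd (q - p) q = gcd p q"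
    using assms by (metis gcd.commute gcd_diff1_nat gcd_diff2_nat diff_diff_cancel diff_le_self)
  thus ?thesis by (simp add: coprime_iff_gcd_eq_1)
qed

text \<open>Subtraction from \<open>q\<close> pairs the totatives below q / 2 with those above; q /
  2 itself is not coprime to \<open>q\<close> once \<open>q\<close> is at least 3.\<close>

lemma card_halves:
  assumes "q \<ge> 3"
  shows "2 * card (halves q) = totient q"
proof -
  have "totatives q = halves q \<union> (\<lambda>p. q - p) ` halves q"
  proof (intro equalityI subsetI)
    fix k assume "k \<in> totatives q"
    hence k: "0 < k" "k \<le> q" "coprime k q" by (auto simp: totatives_def)
    have "2 * k \<noteq> q"
    proof
      assume "2 * k = q"
      hence "k dvd q" by auto
      hence "k = 1" using k(3) by (simp add: coprime_absorb_left)
      thus False using \<open>2 * k = q\<close> assms by simp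
    qed
    then consider "2 * k < q" | "2 * k > q" by linarith
    thus "k \<in> halves q \<union> (\<lambda>p. q - p) ` halves q"
    proof cases
      case 2
      have "q - k \<in> halves q" using 2 k coprime_diff_iff[OF k(2)] by (auto simp: halves_def)
      thus ?thesis using k by (intro UnI2 image_eqI[of _ _ "q - k"]) auto
    qed (use k in \<open>simp add: halves_def\<close>)
  next
    fix k assume "k \<in> halves q \<union> (\<lambda>p. q - p) ` halves q"
    thus "k \<in> totatives q"
    proof
      assume k: "k \<in> halves q"
      hence "k > 0" using halves_pos assms by simp
      thus ?thesis using k by (auto simp: halves_def totatives_def)
    next
      assume "k \<in> (\<lambda>p. q - p) ` halves q"
      then obtain p where p: "p \<in> halves q" "k = q - p" by blast
      hence "p \<le> q" "k > 0" by (auto simp: halves_def)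
      thus ?thesis using p coprime_diff_iff[of p q] by (auto simp: halves_def totatives_def)
    qed
  qed
  moreover have "halves q \<inter> (\<lambda>p. q - p) ` halves q = {}" by (auto simp: halves_def)
  moreover have "inj_on (\<lambda>p. q - p) (halves q)" by (rule inj_onI) (auto simp: halves_def)
  hence "card ((\<lambda>p. q - p) ` halves q) = card (halves q)" by (rule card_image)
  ultimately show ?thesis by (simp add: totient_def card_Un_disjoint)
qed

lemma sum_farey: "(\<Sum>(p, q)\<in>farey n. F q) = (\<Sum>q=1..n. of_nat (card (halves q)) * (F q :: 'a :: semiring_1))"
proof -
  have "(\<Sum>q=1..n. of_nat (card (halves q)) * F q) = (\<Sum>q=1..n. \<Sum>p\<in>halves q. F q)" by simp
  also have "\<dots> = (\<Sum>(q, p)\<in>(SIGMA q:{1..n}. halves q). F q)" by (subst sum.Sigma) auto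
  also have "\<dots> = (\<Sum>(p, q)\<in>farey n. F q)"
    by (rule sum.reindex_bij_witness[of _ "\<lambda>(p, q). (q, p)" "\<lambda>(q, p). (p, q)"])
      (auto simp: farey_def halves_def)
  finally show ?thesis by simp
qed

text \<open>Denominators 1 and 2 have 1 and 0 numerators, but totients 1 and 1: the identity fails
  for each of them and holds for their sum, so the induction starts at 2.\<close>

lemma card_farey:
  assumes "n \<ge> 2"
  shows "2 * card (farey n) = (\<Sum>q=1..n. totient q)"
proof -
  have "card (farey n) = (\<Sum>q=1..n. card (halves q))"
    using sum_farey[of "\<lambda>_. 1 :: nat" n] by simp
  moreover have "2 * (\<Sum>q=1..n. card (halves q)) = (\<Sum>q=1..n. totient q)" using assms
  proof (induction n rule: dec_induct)
    case base
    have "{1..2::nat} = {1, 2}" by auto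
    moreover have "totatives 2 = {1}" by (auto simp: totatives_def le_Suc_eq numeral_2_eq_2)
    ultimately show ?case using halves_1 halves_2 by (simp add: totient_def)
  next
    case (step n)
    thus ?case using card_halves[of "Suc n"] by simp
  qed
  ultimately show ?thesis by simp
qed

section \<open>Cells of singletons\<close>

lemma no_int_between_0_1:
  assumes "0 < real_of_int k" "real_of_int k < 1" shows False
proof -
  have "0 < k" "k < 1" using assms by simp_all
  thus False by simp
qed

text \<open>Cuts the circle at the orbit point of index \<open>e\<close>: up to the common shift e
  \<alpha>, the offset of k is the fractional part of (k - e) \<alpha>.\<close>

lemma stair_base:
  assumes "\<And>x y. x \<in> S \<Longrightarrow> y \<le> n \<Longrightarrow> y \<notin> S \<Longrightarrow>
    frac ((real x - real e) * \<alpha>) < frac ((real y - real e) * \<alpha>)"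
  shows "stair n \<alpha> (\<lambda>k. \<lfloor>(real k - real e) * \<alpha>\<rfloor>) S"
proof -
  have o: "offset \<alpha> (\<lambda>k. \<lfloor>(real k - real e) * \<alpha>\<rfloor>) k = frac ((real k - real e) * \<alpha>) + real e * \<alpha>" for k
    by (simp add: offset_def frac_def algebra_simps)
  show ?thesis unfolding stair_def o
  proof (intro ballI)
    fix x y assume xy: "x \<in> S" "y \<in> {..n} - S"
    have "0 \<le> frac ((real x - real e) * \<alpha>)" "frac ((real y - real e) * \<alpha>) < 1"
      by (rule frac_ge_0) (rule frac_lt_1)
    thus "frac ((real x - real e) * \<alpha>) + real e * \<alpha> < frac ((real y - real e) * \<alpha>) + real e * \<alpha> \<and>
      frac ((real y - real e) * \<alpha>) + real e * \<alpha> < frac ((real x - real e) * \<alpha>) + real e * \<alpha> + 1"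
      using assms[of x y] xy by (intro conjI) (simp, linarith)
  qed
qed

lemma frac_pos_iff: "0 < frac x \<longleftrightarrow> (\<forall>k. x \<noteq> of_int k)"
  by (metis Ints_cases Ints_of_int frac_gt_0_iff)

lemma singleton_fnext:
  assumes r: "r \<in> farey n" and i: "i \<le> n" and n: "n \<ge> 1"
  shows "{i} \<in> rotset n (fnext n r)"
proof -
  have "stair n (fnext n r) (\<lambda>k. \<lfloor>(real k - real i) * fnext n r\<rfloor>) {i}"
  proof (rule stair_base)
    fix x y assume xy: "x \<in> {i}" "y \<le> n" "y \<notin> {i}"
    have "of_int (int y - int i) * fnext n r \<noteq> of_int k" for k
      by (rule fnext_not_int[OF r]) (use xy i in auto)
    hence "0 < frac (of_int (int y - int i) * fnext n r)" unfolding frac_pos_iff by blast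
    hence "0 < frac ((real y - real i) * fnext n r)" by simp
    thus "frac ((real x - real i) * fnext n r) < frac ((real y - real i) * fnext n r)" using xy by simp
  qed
  moreover have "proper n {i}" using i n by (auto simp: proper_def dest: equalityD2)
  ultimately show ?thesis by (auto simp: rotset_def)
qed

text \<open>At slope p / q two indices share an orbit point exactly when they are congruent modulo
  q. A singleton can be cut off iff neither i - q nor i + q is an index.\<close>

lemma singleton_fval:
  assumes r: "(p, q) \<in> farey n" and i: "i \<le> n" and n: "n \<ge> 1"
  shows "{i} \<in> rotset n (fval (p, q)) \<longleftrightarrow> max i (n - i) < q"
proof
  assume q: "max i (n - i) < q"
  have "stair n (fval (p, q)) (\<lambda>k. \<lfloor>(real k - real i) * fval (p, q)\<rfloor>) {i}"
  proof (rule stair_base)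
    fix x y assume xy: "x \<in> {i}" "y \<le> n" "y \<notin> {i}"
    have "\<not> int q dvd int y - int i"
    proof
      assume "int q dvd int y - int i"
      hence "int q \<le> \<bar>int y - int i\<bar>" using xy by (intro zdvd_imp_le) auto
      thus False using q xy i by auto
    qed
    hence "0 < frac (of_int (int y - int i) * fval (p, q))" using fval_int_iff[OF r] frac_pos_iff by blast
    thus "frac ((real x - real i) * fval (p, q)) < frac ((real y - real i) * fval (p, q))" using xy by simp
  qed
  moreover have "proper n {i}" using i n by (auto simp: proper_def dest: equalityD2)
  ultimately show "{i} \<in> rotset n (fval (p, q))" by (auto simp: rotset_def)
next
  assume "{i} \<in> rotset n (fval (p, q))"
  then obtain U where st: "stair n (fval (p, q)) U {i}" by (auto simp: rotset_def)
  have q: "q \<ge> 1" using r by (auto simp: farey_def)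
  have *: False if j: "j \<le> n" "j \<noteq> i" "int j - int i = l * int q" for j l
  proof -
    have "offset (fval (p, q)) U i < offset (fval (p, q)) U j" "offset (fval (p, q)) U j < offset (fval (p, q)) U i + 1"
      using stairD[OF st, of i j] j by auto
    moreover have "offset (fval (p, q)) U j - offset (fval (p, q)) U i = of_int (l * int p - U j + U i)"
    proof -
      have "(real j - real i) = of_int l * real q" using arg_cong[OF j(3), of real_of_int] by simp
      hence "(real j - real i) * fval (p, q) = of_int l * real p" using q by (simp add: fval_def)
      thus ?thesis by (simp add: offset_def algebra_simps)
    qed
    ultimately have "0 < real_of_int (l * int p - U j + U i)" "real_of_int (l * int p - U j + U i) < 1" by linarith+
    thus False by (rule no_int_between_0_1)
  qed
  show "max i (n - i) < q"
  proof (rule ccontr)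
    assume "\<not> max i (n - i) < q"
    hence "q \<le> i \<or> i + q \<le> n" using i by auto
    thus False using *[of "i - q" "-1"] *[of "i + q" 1] q i by auto
  qed
qed

lemma card_left_ends_singleton:
  assumes i: "i \<le> n" and n: "n \<ge> 3"
  shows "2 * card (left_ends n {i}) = (\<Sum>q=1..max i (n - i). totient q)"
proof -
  have "left_ends n {i} = farey (max i (n - i))"
  proof (intro equalityI subsetI)
    fix r assume "r \<in> left_ends n {i}"
    thus "r \<in> farey (max i (n - i))" using singleton_fval[OF _ i, of "fst r" "snd r"] n
      by (cases r) (auto simp: left_ends_def farey_def)
  next
    fix r assume r: "r \<in> farey (max i (n - i))"
    hence "r \<in> farey n" using i by (cases r) (auto simp: farey_def)
    thus "r \<in> left_ends n {i}" using singleton_fval[OF _ i, of "fst r" "snd r"] singleton_fnext[OF _ i, of r] n r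
      by (cases r) (auto simp: left_ends_def farey_def)
  qed
  thus ?thesis using card_farey[of "max i (n - i)"] n i by auto
qed

section \<open>Slopes next to p / q and the cells of progressions\<close>

definition near :: "nat \<Rightarrow> nat \<Rightarrow> nat \<Rightarrow> int \<Rightarrow> real" where
  "near n p q \<sigma> = real p / real q + of_int \<sigma> / (2 * real q * (real n + 1))"

lemma near_mult:
  "q \<ge> 1 \<Longrightarrow> of_int t * near n p q \<sigma> =
     of_int (t * int p) / real q + of_int (\<sigma> * t) / (2 * real q * (real n + 1))"
  by (simp add: near_def algebra_simps)

text \<open>The reason for the displacement 1 / (2 q (n + 1)) in \<open>near\<close>: no index moves
  by as much as half of the distance 1 / q between neighbouring orbit points at p / q.\<close>

lemma near_small:
  assumes "q \<ge> 1" "\<bar>t\<bar> \<le> int n"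
  shows "\<bar>of_int t / (2 * real q * (real n + 1))\<bar> < 1 / (2 * real q)"
proof -
  have "\<bar>real_of_int t\<bar> \<le> real n" using assms(2) by linarith
  hence "\<bar>real_of_int t\<bar> < real n + 1" by simp
  hence "\<bar>real_of_int t\<bar> / (2 * real q * (real n + 1)) < (real n + 1) / (2 * real q * (real n + 1))"
    using assms by (intro divide_strict_right_mono) auto
  also have "\<dots> = 1 / (2 * real q)" by simp
  finally show ?thesis by (simp add: abs_divide abs_mult)
qed

lemma floor_frac_near:
  assumes q: "q \<ge> 1" and t: "int q dvd t" "0 \<le> \<sigma> * t" "\<bar>\<sigma> * t\<bar> \<le> int n"
  shows "\<lfloor>of_int t * near n p q \<sigma>\<rfloor> = t div int q * int p"
    and "frac (of_int t * near n p q \<sigma>) = of_int (\<sigma> * t) / (2 * real q * (real n + 1))"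
proof -
  obtain l where l: "t = int q * l" using t by blast
  have e: "of_int t * near n p q \<sigma> = of_int (l * int p) + of_int (\<sigma> * t) / (2 * real q * (real n + 1))"
    unfolding near_mult[OF q] using q by (simp add: l)
  have b: "0 \<le> of_int (\<sigma> * t) / (2 * real q * (real n + 1))" 
    using t(2) by (intro divide_nonneg_nonneg) (auto simp del: of_int_mult)
  have "1 / (2 * real q) < 1" using q by simp
  hence b2: "of_int (\<sigma> * t) / (2 * real q * (real n + 1)) < 1" using near_small[OF q t(3)] by linarith
  have "\<lfloor>of_int t * near n p q \<sigma>\<rfloor> = l * int p" unfolding e using b b2 by (intro floor_unique) linarith+
  moreover have "t div int q = l" using l q by simp
  ultimately show "\<lfloor>of_int t * near n p q \<sigma>\<rfloor> = t div int q * int p" by simp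
  show "frac (of_int t * near n p q \<sigma>) = of_int (\<sigma> * t) / (2 * real q * (real n + 1))"
    using \<open>\<lfloor>of_int t * near n p q \<sigma>\<rfloor> = l * int p\<close> unfolding frac_def e by simp
qed

text \<open>Counterpart of \<open>floor_frac_near\<close>, where multiples of q with the sign of
  \<sigma> stay below 1 / (2 q). Nonmultiples start at 1 / q or more, and multiples of the opposite
  sign wrap around to below 1, so all of these end up above 1 / (2 q).\<close>

lemma frac_near_far:
  assumes q: "q \<ge> 1" and cop: "coprime p q" and t: "\<bar>\<sigma> * t\<bar> \<le> int n" "\<not> int q dvd t \<or> \<sigma> * t < 0"
  shows "1 / (2 * real q) < frac (of_int t * near n p q \<sigma>)"
proof -
  define \<epsilon> where "\<epsilon> = of_int (\<sigma> * t) / (2 * real q * (real n + 1))"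
  have \<epsilon>: "\<bar>\<epsilon>\<bar> < 1 / (2 * real q)" using near_small[OF q t(1)] by (simp add: \<epsilon>_def)
  have e: "of_int t * near n p q \<sigma> = of_int (t * int p) / real q + \<epsilon>" unfolding near_mult[OF q] \<epsilon>_def ..
  show ?thesis
  proof (cases "int q dvd t")
    case True
    then obtain l where l: "t = int q * l" by blast
    have \<epsilon>0: "\<epsilon> < 0" using t(2) True q unfolding \<epsilon>_def
      by (intro divide_neg_pos) (auto simp del: of_int_mult)
    have q2: "1 / (2 * real q) \<le> 1 / 2" using q by (simp add: field_simps)
    define L where "L = l * int p"
    have e2: "of_int t * near n p q \<sigma> = of_int L + \<epsilon>" unfolding e using q by (simp add: l L_def)
    have "\<lfloor>of_int t * near n p q \<sigma>\<rfloor> = L - 1" unfolding e2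
    proof (rule floor_unique)
      have "- 1 < \<epsilon>" using \<epsilon> q2 by linarith
      thus "of_int (L - 1) \<le> of_int L + \<epsilon>" by simp
      show "of_int L + \<epsilon> < of_int (L - 1) + 1" using \<epsilon>0 by simp
    qed
    hence "frac (of_int t * near n p q \<sigma>) = 1 + \<epsilon>" unfolding frac_def e2 by simp
    thus ?thesis using \<epsilon> q2 by linarith
  next
    case False
    define k where "k = (t * int p) div int q"
    define \<rho> where "\<rho> = (t * int p) mod int q"
    have "\<not> int q dvd t * int p"
    proof
      assume "int q dvd t * int p"
      moreover have "coprime (int q) (int p)" using cop by (simp add: coprime_commute)
      ultimately show False using False coprime_dvd_mult_left_iff by blast
    qed
    hence "\<rho> \<noteq> 0" by (auto simp: \<rho>_def)
    moreover have "0 \<le> \<rho>" "\<rho> < int q" using q by (auto simp: \<rho>_def)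
    ultimately have "1 \<le> \<rho>" "\<rho> \<le> int q - 1" by linarith+
    hence r: "1 \<le> real_of_int \<rho>" "real_of_int \<rho> \<le> real q - 1" by linarith+
    have r1: "1 / real q \<le> of_int \<rho> / real q" using r by (intro divide_right_mono) auto
    have "of_int \<rho> / real q \<le> (real q - 1) / real q" using r by (intro divide_right_mono) auto
    also have "\<dots> = 1 - 1 / real q" using q by (simp add: field_simps)
    finally have r2: "of_int \<rho> / real q \<le> 1 - 1 / real q" .
    have tk: "t * int p = k * int q + \<rho>" by (simp add: k_def \<rho>_def)
    have e2: "of_int t * near n p q \<sigma> = of_int k + (of_int \<rho> / real q + \<epsilon>)"
      unfolding e tk using q by (simp add: field_simps)
    have q2: "1 / real q = 1 / (2 * real q) + 1 / (2 * real q)" using q by (simp add: field_simps)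
    have "\<lfloor>of_int t * near n p q \<sigma>\<rfloor> = k" unfolding e2
      using r1 r2 \<epsilon> q2 by (intro floor_unique) linarith+
    hence "frac (of_int t * near n p q \<sigma>) = of_int \<rho> / real q + \<epsilon>" unfolding frac_def e2 by simp
    thus ?thesis using r1 \<epsilon> q2 by linarith
  qed
qed

lemma mem_ap_iff:
  assumes "q \<ge> 1"
  shows "y \<in> ap s q m \<longleftrightarrow> int q dvd int y - int s \<and> int s \<le> int y \<and> int y \<le> int s + int m * int q"
proof
  assume "y \<in> ap s q m"
  then obtain k where "k \<le> m" "y = s + k * q" by (auto simp: ap_def)
  moreover from this have "k * q \<le> m * q" by simp
  ultimately show "int q dvd int y - int s \<and> int s \<le> int y \<and> int y \<le> int s + int m * int q"
    by (auto simp: of_nat_mult[symmetric] simp del: of_nat_mult)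
next
  assume *: "int q dvd int y - int s \<and> int s \<le> int y \<and> int y \<le> int s + int m * int q"
  hence "s \<le> y" by simp
  hence "int q dvd int (y - s)" using * by (simp add: of_nat_diff)
  then obtain k where k: "y - s = q * k" by (auto simp: dvd_def simp flip: of_nat_mult) (metis dvdE int_dvd_int_iff dvd_triv_left of_nat_mult)
  have "int (q * k) \<le> int (m * q)" using * k \<open>s \<le> y\<close> by (simp add: of_nat_diff flip: k)
  hence "k * q \<le> m * q" by (simp add: mult.commute flip: of_nat_mult)
  hence "k \<le> m" using assms by simp
  thus "y \<in> ap s q m" using k \<open>s \<le> y\<close> by (auto simp: ap_def mult.commute intro!: image_eqI[of _ _ k])
qed

lemma proper_ap:
  assumes "q \<ge> 2" "m \<ge> 1" "s + m * q \<le> n"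
  shows "proper n (ap s q m)"
proof -
  have "ap s q m \<subseteq> {..n}" using ap_le assms(3) by (meson atMost_iff le_trans subsetI)
  moreover have "s \<in> ap s q m" using mem_apI[of 0 m s q] by simp
  moreover have "Suc s \<notin> ap s q m"
    using consec_ap[of q 0 m s] assms by (auto simp: consec_def)
  moreover have "q \<le> m * q" using assms by simp
  hence "Suc s \<le> n" using assms by linarith
  ultimately show ?thesis unfolding proper_def by blast
qed

text \<open>To the right of p / q the residue class of \<open>s\<close> is spread out in increasing
  order, to the left in decreasing order. Counted from its first or last term respectively, the
  progression is an initial segment of the class.\<close>

lemma ap_near_stair:
  assumes q: "q \<ge> 1" and m: "m \<ge> 1" and n: "s + m * q \<le> n" and cop: "coprime p q" and \<sigma>: "\<sigma> = 1 \<or> \<sigma> = -1"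
  obtains U where "stair n (near n p q \<sigma>) U (ap s q m)" "U (s + q) - U s = int p"
proof -
  define e where "e = (if \<sigma> = 1 then s else s + m * q)"
  define U where "U = (\<lambda>k. \<lfloor>(real k - real e) * near n p q \<sigma>\<rfloor>)"
  define t where "t = (\<lambda>y. int y - int e)"
  have qm: "q \<le> m * q" using m by simp
  have rt: "(real y - real e) = of_int (t y)" for y by (simp add: t_def)
  have mq: "int m * int q = int (m * q)" by simp
  have en: "e \<le> n" using n by (simp add: e_def)
  have tn: "\<bar>\<sigma> * t y\<bar> \<le> int n" if "y \<le> n" for y
    using that en \<sigma> unfolding t_def by auto
  have dv: "int q dvd t y \<longleftrightarrow> int q dvd int y - int s" for y
  proof (cases "\<sigma> = 1")
    case False
    have "int y - int s = t y + int m * int q" using False by (simp add: t_def e_def)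
    thus ?thesis by simp
  qed (simp add: t_def e_def)
  have mem: "y \<in> ap s q m \<longleftrightarrow> int q dvd t y \<and> 0 \<le> \<sigma> * t y \<and> \<sigma> * t y \<le> int (m * q)" for y
  proof (cases "\<sigma> = 1")
    case True
    thus ?thesis unfolding mem_ap_iff[OF q] dv mq by (simp add: t_def e_def algebra_simps)
  next
    case False
    hence "\<sigma> * t y = int s + int (m * q) - int y" using \<sigma> by (simp add: t_def e_def)
    thus ?thesis unfolding mem_ap_iff[OF q] dv mq by auto
  qed
  have "stair n (near n p q \<sigma>) U (ap s q m)"
    unfolding U_def
  proof (rule stair_base, unfold rt)
    fix x y assume x: "x \<in> ap s q m" and y: "y \<le> n" "y \<notin> ap s q m"
    have xn: "x \<le> n" using ap_le[OF x] n by simp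
    have fx: "frac (of_int (t x) * near n p q \<sigma>) = of_int (\<sigma> * t x) / (2 * real q * (real n + 1))"
      using x tn[OF xn] unfolding mem by (intro floor_frac_near(2) q) auto
    consider "\<not> int q dvd t y \<or> \<sigma> * t y < 0" | "int q dvd t y" "\<sigma> * t y > int (m * q)"
      using y(2) unfolding mem by linarith
    thus "frac (of_int (t x) * near n p q \<sigma>) < frac (of_int (t y) * near n p q \<sigma>)"
    proof cases
      case 1
      have "\<bar>of_int (\<sigma> * t x) / (2 * real q * (real n + 1))\<bar> < 1 / (2 * real q)"
        by (rule near_small[OF q tn[OF xn]])
      thus ?thesis using frac_near_far[OF q cop tn[OF y(1)] 1] fx by linarith
    next
      case 2
      have "0 \<le> \<sigma> * t y" using 2 by linarith
      hence fy: "frac (of_int (t y) * near n p q \<sigma>) = of_int (\<sigma> * t y) / (2 * real q * (real n + 1))"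
        by (intro floor_frac_near(2) q 2(1) tn[OF y(1)])
      have "\<sigma> * t x < \<sigma> * t y" using x 2 unfolding mem by linarith
      hence "real_of_int (\<sigma> * t x) < of_int (\<sigma> * t y)" using of_int_less_iff by blast
      thus ?thesis unfolding fx fy using q by (intro divide_strict_right_mono) auto
    qed
  qed
  moreover have "U (s + q) - U s = int p"
  proof -
    have Ux: "U x = t x div int q * int p" if "x \<in> ap s q m" for x
    proof -
      have "x \<le> n" using ap_le[OF that] n by simp
      from tn[OF this] show ?thesis unfolding U_def rt using that unfolding mem by (intro floor_frac_near(1) q) auto
    qed
    have "s \<in> ap s q m" "s + q \<in> ap s q m" using mem_apI[of 0 m s q] mem_apI[of 1 m s q] m by auto
    moreover have "t (s + q) div int q = t s div int q + 1"
    proof -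
      have "t (s + q) = t s + int q" by (simp add: t_def)
      thus ?thesis using q by (simp add: div_add_self2)
    qed
    ultimately show ?thesis using Ux by (simp add: algebra_simps)
  qed
  ultimately show ?thesis using that by blast
qed

text \<open>Under \<open>full\<close> the progression is its whole residue class modulo
  \<open>q\<close> within {0..n}, and at slope p / q this class collapses to one orbit point, apart
  from all others.\<close>

lemma ap_full_stair:
  assumes q: "q \<ge> 1" and m: "m \<ge> 1" and n: "s + m * q \<le> n" and cop: "coprime p q"
    and full: "s < q" "n < s + m * q + q"
  obtains U where "stair n (real p / real q) U (ap s q m)" "U (s + q) - U s = int p"
proof -
  define \<alpha> where "\<alpha> = real p / real q"
  define U where "U = (\<lambda>k. \<lfloor>(real k - real s) * \<alpha>\<rfloor>)"
  have mem: "y \<in> ap s q m \<longleftrightarrow> int q dvd int y - int s" if y: "y \<le> n" for y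
  proof -
    have "int s \<le> int y \<and> int y \<le> int s + int m * int q" if d: "int q dvd int y - int s"
    proof -
      obtain l where l: "int y - int s = int q * l" using d by blast
      have "int q * (-1) < int q * l" using full l by linarith
      hence "- 1 < l" using q mult_less_cancel_left_pos[of "int q" "- 1" l] by simp
      hence l0: "0 \<le> l" by simp
      have "int y - int s < int (m * q + q)" using full y by linarith
      hence "int q * l < int q * (int m + 1)" using l by (simp add: algebra_simps)
      hence "l \<le> int m" using q by simp
      hence "int q * l \<le> int q * int m" using q by simp
      moreover have "0 \<le> int q * l" using l0 by simp
      ultimately show ?thesis using l by (simp add: algebra_simps)
    qed
    thus ?thesis using mem_ap_iff[OF q] by blast
  qed
  have val: "(real y - real s) * \<alpha> = of_int (l * int p)" if "int y - int s = int q * l" for y l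
  proof -
    have "real y - real s = real q * of_int l" using arg_cong[OF that, of real_of_int] by simp
    thus ?thesis using q by (simp add: \<alpha>_def)
  qed
  have "stair n \<alpha> U (ap s q m)"
    unfolding U_def
  proof (rule stair_base)
    fix x y assume x: "x \<in> ap s q m" and y: "y \<le> n" "y \<notin> ap s q m"
    have xn: "x \<le> n" using ap_le[OF x] n by simp
    obtain l where l: "int x - int s = int q * l" using x mem[OF xn] by blast
    have "frac ((real x - real s) * \<alpha>) = 0" unfolding val[OF l] by (rule frac_of_int)
    moreover have "0 < frac ((real y - real s) * \<alpha>)"
      unfolding frac_pos_iff
    proof (intro allI notI)
      fix k assume "(real y - real s) * \<alpha> = of_int k"
      hence "real_of_int ((int y - int s) * int p) = of_int (k * int q)" using q by (simp add: \<alpha>_def field_simps)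
      hence "(int y - int s) * int p = k * int q" using of_int_eq_iff by blast
      hence "int q dvd (int y - int s) * int p" by (metis dvd_triv_right)
      moreover have "coprime (int q) (int p)" using cop by (simp add: coprime_commute)
      ultimately show False using mem y coprime_dvd_mult_left_iff by blast
    qed
    ultimately show "frac ((real x - real s) * \<alpha>) < frac ((real y - real s) * \<alpha>)" by linarith
  qed
  moreover have "U (s + q) - U s = int p" using val[of "s + q" 1] by (simp add: U_def)
  ultimately show ?thesis using that by (simp add: \<alpha>_def)
qed

lemma ap_cell_slope:
  assumes st: "stair n \<alpha> U (ap s q m)" and \<alpha>: "0 < \<alpha>" "\<alpha> < 1 / 2"
    and q: "q \<ge> 3" and m: "m \<ge> 1" and n: "s + m * q \<le> n"
  obtains p where "p \<in> halves q" "U (s + q) - U s = int p"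
    "\<And>k. k < m \<Longrightarrow> U (s + k * q + q) = U (s + k * q) + int p"
proof -
  have q2: "q \<ge> 2" using q by simp
  obtain p where p: "coprime p (int q)" "0 < p" "2 * p \<le> int q"
    "\<And>k. k < m \<Longrightarrow> U (s + k * q + q) = U (s + k * q) + p"
    using ap_slope[OF st proper_ap[OF q2 m n] \<alpha> refl q2 m] by blast
  have "2 * p \<noteq> int q"
  proof
    assume e: "2 * p = int q"
    hence "p dvd int q" by (metis dvd_triv_right)
    hence "p = 1" using p by (simp add: coprime_absorb_left)
    thus False using e q by simp
  qed
  hence "nat p \<in> halves q" "int (nat p) = p"
    using p by (auto simp: halves_def coprime_int_iff[symmetric] simp del: coprime_int_iff)
  moreover from this have "U (s + q) - U s = int (nat p)" using p(4)[of 0] m by simp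
  ultimately show ?thesis using that[of "nat p"] p(4) by simp
qed

lemma agree_diff: "agree n U V \<Longrightarrow> i \<le> n \<Longrightarrow> j \<le> n \<Longrightarrow> U i - U j = V i - V j"
  by (auto simp: agree_def)

text \<open>A full class is a rotation set at p / q itself, so slopes on both sides of p / q belong
  to one cell. A cell is determined by its increment, which ranges over
  \<open>halves q\<close>.\<close>

lemma card_left_ends_ap_full:
  assumes q: "q \<ge> 3" and m: "m \<ge> 1" and n: "s + m * q \<le> n" and full: "s < q" "n < s + m * q + q"
  shows "2 * card (left_ends n (ap s q m)) = totient q"
proof -
  define S where "S = ap s q m"
  have q12: "q \<ge> 1" "q \<ge> 2" using q by auto
  have pr: "proper n S" unfolding S_def by (rule proper_ap[OF q12(2) m n])
  have qm: "q \<le> m * q" using m by simp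
  hence sn: "s \<le> n" "s + q \<le> n" "n \<ge> 2" using n q by linarith+
  define f where "f = (\<lambda>U. nat (U (s + q) - U s :: int))"
  have "bij_betw f (cells n S) (halves q)"
    unfolding bij_betw_def
  proof (intro conjI inj_onI equalityI subsetI)
    fix U V assume U: "U \<in> cells n S" and V: "V \<in> cells n S" and eq: "f U = f V"
    obtain \<alpha> where \<alpha>: "0 < \<alpha>" "\<alpha> < 1 / 2" "stair n \<alpha> U S" using U by (auto simp: cells_def)
    obtain \<beta> where \<beta>: "0 < \<beta>" "\<beta> < 1 / 2" "stair n \<beta> V S" using V by (auto simp: cells_def)
    obtain p where p: "U (s + q) - U s = int p" "\<And>k. k < m \<Longrightarrow> U (s + k * q + q) = U (s + k * q) + int p"
      using ap_cell_slope[OF \<alpha>(3)[unfolded S_def] \<alpha>(1,2) q m n] by blast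
    obtain p' where p': "V (s + q) - V s = int p'" "\<And>k. k < m \<Longrightarrow> V (s + k * q + q) = V (s + k * q) + int p'"
      using ap_cell_slope[OF \<beta>(3)[unfolded S_def] \<beta>(1,2) q m n] by blast
    have "p = p'" using eq p(1) p'(1) by (simp add: f_def)
    hence "agree n U V" using agree_ap[OF \<alpha>(3) \<beta>(3) pr S_def q12(1) m p(2)] p'(2) full by blast
    thus "U = V" using agree_normal_eq[of n U V] U V by (auto simp: cells_def)
  next
    fix p assume "p \<in> f ` cells n S"
    then obtain U where U: "U \<in> cells n S" "p = f U" by blast
    obtain \<alpha> where \<alpha>: "0 < \<alpha>" "\<alpha> < 1 / 2" "stair n \<alpha> U S" using U by (auto simp: cells_def)
    obtain p' where "p' \<in> halves q" "U (s + q) - U s = int p'"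
      using ap_cell_slope[OF \<alpha>(3)[unfolded S_def] \<alpha>(1,2) q m n] by blast
    thus "p \<in> halves q" using U by (simp add: f_def)
  next
    fix p assume p: "p \<in> halves q"
    obtain U where U: "stair n (real p / real q) U S" "U (s + q) - U s = int p"
      using ap_full_stair[OF q12(1) m n _ full] p by (auto simp: halves_def S_def)
    obtain V where V: "V 0 = 0" "\<forall>i>n. V i = 0" "stair n (real p / real q) V S" "agree n U V"
      using normalize[OF U(1) pr] by metis
    have "0 < real p / real q" using halves_pos[OF p q12(2)] q by simp
    moreover have "real p / real q < 1 / 2" using p q by (simp add: halves_def field_simps)
    ultimately have "V \<in> cells n S" using V unfolding cells_def by blast
    moreover have "f V = p" using agree_diff[OF V(4) sn(2,1)] U(2) by (simp add: f_def)
    ultimately show "p \<in> f ` cells n S" by blast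
  qed
  hence "card (cells n S) = card (halves q)" by (rule bij_betw_same_card)
  thus ?thesis using card_left_ends_eq_cells[OF sn(3) pr] card_halves[OF q] by (simp add: S_def)
qed

text \<open>Some index outside the progression is congruent to its first or last term; their offsets
  differ by an integer, which \<open>stair\<close> forbids.\<close>

lemma ap_not_full_no_stair:
  assumes st: "stair n \<alpha> U (ap s q m)" and \<alpha>: "real q * \<alpha> = of_int p" and q: "q \<ge> 1"
    and n: "s + m * q \<le> n" and nf: "\<not> (s < q \<and> n < s + m * q + q)"
  shows False
proof -
  have *: False if ij: "i \<in> ap s q m" "j \<le> n" "j \<notin> ap s q m" and d: "int j - int i = l * int q" for i j l
  proof -
    have "real j - real i = of_int l * real q" using arg_cong[OF d, of real_of_int] by simp
    hence "(real j - real i) * \<alpha> = of_int (l * p)" using \<alpha> by (simp add: mult.assoc)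
    hence "offset \<alpha> U j - offset \<alpha> U i = of_int (l * p - U j + U i)" by (simp add: offset_def algebra_simps)
    hence "0 < real_of_int (l * p - U j + U i)" "real_of_int (l * p - U j + U i) < 1"
      using stairD[OF st ij] by linarith+
    thus False by (rule no_int_between_0_1)
  qed
  show False
  proof (cases "s < q")
    case True
    hence "s + m * q + q \<le> n" using nf by simp
    moreover have "s + m * q + q \<notin> ap s q m" using ap_le[of "s + m * q + q" s q m] q by auto
    moreover have "s + m * q \<in> ap s q m" by (rule mem_apI) simp
    ultimately show ?thesis using *[of "s + m * q" "s + m * q + q" 1] by simp
  next
    case False
    moreover have "s - q \<notin> ap s q m" using False q by (auto simp: ap_def)
    moreover have "s \<in> ap s q m" using mem_apI[of 0 m s q] by simp
    ultimately show ?thesis using *[of s "s - q" "-1"] n by (simp add: of_nat_diff)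
  qed
qed

text \<open>Here p / q itself is lost, so each p contributes one cell on either side, told apart by
  the boolean. Convexity shows that the two differ, \<open>agree_ap\<close> that there are no
  others.\<close>

lemma card_left_ends_ap_not_full:
  assumes q: "q \<ge> 3" and m: "m \<ge> 1" and n: "s + m * q \<le> n" and nf: "\<not> (s < q \<and> n < s + m * q + q)"
  shows "card (left_ends n (ap s q m)) = totient q"
proof -
  define S where "S = ap s q m"
  have q12: "q \<ge> 1" "q \<ge> 2" using q by auto
  have pr: "proper n S" unfolding S_def by (rule proper_ap[OF q12(2) m n])
  have qm: "q \<le> m * q" using m by simp
  hence sn: "s \<le> n" "s + q \<le> n" "n \<ge> 2" using n q by linarith+
  define \<nu> where "\<nu> = (\<lambda>(p, b). near n p q (if b then 1 else - 1))"
  define P where "P = (\<lambda>d U. U 0 = 0 \<and> (\<forall>i>n. U i = 0) \<and> stair n (\<nu> d) U S \<and> U (s + q) - U s = int (fst d))"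
  define H where "H = (\<lambda>d. SOME U. P d U)"
  define D where "D = halves q \<times> (UNIV :: bool set)"
  have H: "P d (H d)" if "d \<in> D" for d
  proof -
    obtain p b where d: "d = (p, b)" by (metis surj_pair)
    have cop: "coprime p q" using that by (simp add: D_def d halves_def)
    have \<sigma>: "(if b then 1 else -1) = (1 :: int) \<or> (if b then 1 else -1) = (-1 :: int)" by simp
    obtain U where "stair n (near n p q (if b then 1 else -1)) U (ap s q m)" "U (s + q) - U s = int p"
      using ap_near_stair[OF q12(1) m n cop \<sigma>] .
    hence U: "stair n (\<nu> d) U S" "U (s + q) - U s = int p" by (simp_all add: d \<nu>_def S_def)
    obtain V where V: "V 0 = 0" "\<forall>i>n. V i = 0" "stair n (\<nu> d) V S" "agree n U V"
      using normalize[OF U(1) pr] by metis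
    have "P d V" unfolding P_def using V U agree_diff[OF V(4) sn(2,1)] by (simp add: d)
    thus ?thesis unfolding H_def by (rule someI[where P = "P d"])
  qed
  have \<nu>T: "real p < real q * \<nu> (p, True)" and \<nu>F: "real q * \<nu> (p, False) < real p" for p
  proof -
    have "real q * near n p q \<sigma> = real p + of_int \<sigma> / (2 * (real n + 1))" for \<sigma>
    proof -
      have "real q * (real p / real q) = real p" using q by simp
      moreover have "real q * (of_int \<sigma> / (2 * real q * (real n + 1))) = of_int \<sigma> / (2 * (real n + 1))"
        using q by simp
      ultimately show ?thesis unfolding near_def distrib_left by simp
    qed
    moreover have "1 / (2 * (real n + 1)) > 0" by simp
    ultimately show "real p < real q * \<nu> (p, True)" "real q * \<nu> (p, False) < real p"
      by (simp_all add: \<nu>_def)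
  qed
  have \<nu>01: "0 < \<nu> (p, b) \<and> \<nu> (p, b) < 1 / 2" if p: "p \<in> halves q" for p b
  proof -
    have p0: "p \<ge> 1" using halves_pos[OF p q12(2)] by simp
    have p1: "2 * real p + 1 \<le> real q" using p by (auto simp: halves_def)
    have "n \<ge> 1" using sn by simp
    define X where "X = of_int (if b then 1 else -1) / (2 * real q * (real n + 1))"
    have "\<bar>X\<bar> < 1 / (2 * real q)"
      unfolding X_def using \<open>n \<ge> 1\<close> by (intro near_small[OF q12(1)]) auto
    moreover have "1 / real q \<le> real p / real q" using p0 by (intro divide_right_mono) auto
    moreover have "real p / real q \<le> (real q - 1) / (2 * real q)" using p1 q by (simp add: field_simps)
    moreover have "(real q - 1) / (2 * real q) = 1 / 2 - 1 / (2 * real q)" "1 / real q = 1 / (2 * real q) + 1 / (2 * real q)"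
      using q by (auto simp: field_simps)
    moreover have "\<nu> (p, b) = real p / real q + X" by (simp only: \<nu>_def near_def X_def prod.case)
    ultimately show ?thesis by linarith
  qed
  have "bij_betw H D (cells n S)"
    unfolding bij_betw_def
  proof (intro conjI inj_onI equalityI subsetI)
    fix d d' assume dd: "d \<in> D" "d' \<in> D" "H d = H d'"
    obtain p b p' b' where d: "d = (p, b)" "d' = (p', b')" by (metis surj_pair)
    have "int p = int p'" using H[OF dd(1)] H[OF dd(2)] dd(3) by (simp add: P_def d)
    hence pp: "p = p'" by simp
    have False if "b \<noteq> b'"
    proof -
      have "stair n (\<nu> (p, True)) (H d) S" "stair n (\<nu> (p, False)) (H d) S"
        using H[OF dd(1)] H[OF dd(2)] dd(3) that by (cases b; cases b'; simp add: P_def d pp)+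
      moreover have "\<nu> (p, False) \<le> real p / real q" "real p / real q \<le> \<nu> (p, True)"
        using \<nu>T[of p] \<nu>F[of p] q by (auto simp: field_simps)
      ultimately have "stair n (real p / real q) (H d) S" using stair_convex by blast
      thus False using ap_not_full_no_stair[OF _ _ q12(1) n nf, of "real p / real q" "H d" "int p"] q
        by (simp add: S_def)
    qed
    thus "d = d'" using d pp by blast
  next
    fix U assume "U \<in> H ` D"
    then obtain p b where pb: "(p, b) \<in> D" "U = H (p, b)" by auto
    have "p \<in> halves q" using pb by (simp add: D_def)
    thus "U \<in> cells n S" using H[OF pb(1)] pb(2) \<nu>01 unfolding cells_def P_def by blast
  next
    fix U assume U: "U \<in> cells n S"
    obtain \<alpha> where \<alpha>: "0 < \<alpha>" "\<alpha> < 1 / 2" "stair n \<alpha> U S" using U by (auto simp: cells_def)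
    obtain p where p: "p \<in> halves q" "\<And>k. k < m \<Longrightarrow> U (s + k * q + q) = U (s + k * q) + int p"
      using ap_cell_slope[OF \<alpha>(3)[unfolded S_def] \<alpha>(1,2) q m n] by blast
    have ne: "real q * \<alpha> \<noteq> real p"
      using ap_not_full_no_stair[OF \<alpha>(3)[unfolded S_def] _ q12(1) n nf, of "int p"] by auto
    define b where "b = (real q * \<alpha> > real p)"
    define d where "d = (p, b)"
    have dD: "d \<in> D" using p by (simp add: D_def d_def)
    have Hd: "stair n (\<nu> d) (H d) S" "H d (s + q) - H d s = int p" using H[OF dD] by (auto simp: P_def d_def)
    have \<nu>d: "0 < \<nu> d" "\<nu> d < 1 / 2" using \<nu>01[OF p(1)] by (auto simp: d_def)
    obtain p' where p': "H d (s + q) - H d s = int p'"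
      "\<And>k. k < m \<Longrightarrow> H d (s + k * q + q) = H d (s + k * q) + int p'"
      using ap_cell_slope[OF Hd(1)[unfolded S_def] \<nu>d q m n] by blast
    have "p' = p" using p'(1) Hd(2) by simp
    have "\<not> sep \<alpha> (\<nu> d) q (int p)"
      using \<nu>T[of p] \<nu>F[of p] ne by (cases b) (auto simp: sep_def d_def b_def)
    hence "agree n U (H d)"
      using agree_ap[OF \<alpha>(3) Hd(1) pr S_def q12(1) m p(2)] p'(2) \<open>p' = p\<close> by blast
    hence "U = H d" using agree_normal_eq[of n U "H d"] U H[OF dD] by (auto simp: cells_def P_def)
    thus "U \<in> H ` D" using dD by blast
  qed
  hence "card D = card (cells n S)" by (rule bij_betw_same_card)
  moreover have "card D = 2 * card (halves q)" by (simp add: D_def card_cartesian_product)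
  ultimately show ?thesis using card_left_ends_eq_cells[OF sn(3) pr] card_halves[OF q] by (simp add: S_def)
qed

section \<open>Summation\<close>

text \<open>By the symmetry of i and n - i, each value above n / 2 occurs twice and, for n = 2 k,
  the value k once. The bound i + 1 in \<open>f1\<close> is only a shift of the range.\<close>

lemma sum_max_eq_f1:
  assumes n: "n \<ge> 2"
  shows "(\<Sum>i\<le>n. \<Sum>p=1..max i (n - i). totient p) = f1 n"
proof -
  define \<Phi> where "\<Phi> = (\<lambda>i. \<Sum>p=1..i. totient p)"
  define k where "k = n div 2"
  have shift: "(\<Sum>i=a..b. \<Phi> (i + 1)) = (\<Sum>i=Suc a..Suc b. \<Phi> i)" for a b
    using sum.shift_bounds_cl_Suc_ivl[of \<Phi> a b] by simp
  have mirror: "(\<Sum>i<c. \<Phi> (max i (n - i))) = (\<Sum>i=Suc (n - c)..n. \<Phi> i)" if c: "2 * c \<le> n + 1" for c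
    by (rule sum.reindex_bij_witness[of _ "\<lambda>i. n - i" "\<lambda>i. n - i"]) (use c in \<open>auto simp: max_def\<close>)
  have upper: "(\<Sum>i=c..n. \<Phi> (max i (n - i))) = (\<Sum>i=c..n. \<Phi> i)" if c: "2 * c \<ge> n" for c
  proof (rule sum.cong[OF refl])
    fix i assume "i \<in> {c..n}"
    hence "max i (n - i) = i" using c by auto
    thus "\<Phi> (max i (n - i)) = \<Phi> i" by simp
  qed
  show ?thesis
  proof (cases "odd n")
    case True
    hence nk: "n = 2 * k + 1" unfolding k_def by simp
    have "{..n} = {..<Suc k} \<union> {Suc k..n}" using nk by auto
    hence "(\<Sum>i\<le>n. \<Phi> (max i (n - i))) = (\<Sum>i<Suc k. \<Phi> (max i (n - i))) + (\<Sum>i=Suc k..n. \<Phi> (max i (n - i)))"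
      by (simp only:) (intro sum.union_disjoint, auto)
    also have "\<dots> = 2 * (\<Sum>i=Suc k..n. \<Phi> i)"
      using mirror[of "Suc k"] upper[of "Suc k"] nk by simp
    also have "\<dots> = f1 n"
      using True nk shift[of k "2 * k"] by (simp add: f1_def Let_def k_def[symmetric] \<Phi>_def)
    finally show ?thesis by (simp add: \<Phi>_def)
  next
    case False
    hence nk: "n = 2 * k" unfolding k_def by simp
    have k1: "k \<ge> 1" using n nk by simp
    have "{..n} = {..<k} \<union> {k..n}" using nk by auto
    hence "(\<Sum>i\<le>n. \<Phi> (max i (n - i))) = (\<Sum>i<k. \<Phi> (max i (n - i))) + (\<Sum>i=k..n. \<Phi> (max i (n - i)))"
      by (simp only:) (intro sum.union_disjoint, auto)
    also have "\<dots> = (\<Sum>i=Suc k..n. \<Phi> i) + (\<Sum>i=k..n. \<Phi> i)"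
      using mirror[of k] upper[of k] nk by simp
    also have "(\<Sum>i=k..n. \<Phi> i) = \<Phi> k + (\<Sum>i=Suc k..n. \<Phi> i)"
      using nk by (intro sum.atLeast_Suc_atMost) simp
    also have "(\<Sum>i=Suc k..n. \<Phi> i) = (\<Sum>i=k..2 * k - 1. \<Phi> (i + 1))"
      using shift[of k "2 * k - 1"] k1 nk by simp
    finally show ?thesis
      using False by (simp add: f1_def Let_def k_def[symmetric] \<Phi>_def)
  qed
qed

section \<open>Counting progressions of a given difference\<close>

definition aps :: "nat \<Rightarrow> nat \<Rightarrow> (nat \<times> nat) set" where
  "aps n q = {(m, s). 1 \<le> m \<and> s + m * q \<le> n}"

text \<open>The residue classes modulo \<open>q\<close> within {0..n} that have at least two
  elements.\<close>

definition full_aps :: "nat \<Rightarrow> nat \<Rightarrow> (nat \<times> nat) set" where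
  "full_aps n q = {(m, s) \<in> aps n q. s < q \<and> n < s + m * q + q}"

lemma aps_Sigma:
  assumes "q \<ge> 1"
  shows "aps n q = (SIGMA m:{1..n div q}. {..n - m * q})"
proof -
  have "m \<le> n div q \<longleftrightarrow> m * q \<le> n" for m using assms by (simp add: less_eq_div_iff_mult_less_eq)
  thus ?thesis by (auto simp: aps_def)
qed

lemma finite_aps [simp]: "q \<ge> 1 \<Longrightarrow> finite (aps n q)"
  by (simp add: aps_Sigma)

text \<open>For m steps there are n - m q + 1 starting points. Summing the arithmetic series and
  substituting n = q (n div q) + n mod q gives the form of \<open>g\<close>, where q = l +
  1.\<close>

lemma card_aps:
  assumes q: "q \<ge> 1"
  shows "real (card (aps n q)) = 1 / 2 * real (n div q) * (real n + 2 - real q + real (n mod q))"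
proof -
  define a where "a = n div q"
  have tri: "2 * (\<Sum>m=1..b. real n + 1 - real m * real q) = real b * (2 * real n + 2 - real q * (real b + 1))" for b
    by (induction b) (simp_all add: algebra_simps)
  have "real (card (aps n q)) = (\<Sum>m=1..a. real (n - m * q + 1))"
    using q by (simp add: aps_Sigma a_def)
  also have "\<dots> = (\<Sum>m=1..a. real n + 1 - real m * real q)"
  proof (rule sum.cong[OF refl])
    fix m assume "m \<in> {1..a}"
    hence "m * q \<le> n" using q by (simp add: a_def less_eq_div_iff_mult_less_eq)
    thus "real (n - m * q + 1) = real n + 1 - real m * real q" by (simp add: of_nat_diff)
  qed
  finally have "2 * real (card (aps n q)) = real a * (2 * real n + 2 - real q * (real a + 1))" using tri by simp
  moreover have "real n = real q * real a + real (n mod q)"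
    unfolding a_def of_nat_mult[symmetric] of_nat_add[symmetric] by simp
  ultimately show ?thesis by (simp add: a_def[symmetric] algebra_simps)
qed

text \<open>A full class is determined by its least element s, which has to satisfy s < q and s + q
  <= n.\<close>

lemma card_full_aps:
  assumes q: "q \<ge> 1" "q \<le> n"
  shows "card (full_aps n q) = min q (n + 1 - q)"
proof -
  have "bij_betw snd (full_aps n q) {..<min q (n + 1 - q)}"
  proof (rule bij_betwI')
    fix x y assume xy: "x \<in> full_aps n q" "y \<in> full_aps n q"
    obtain m s m' s' where e: "x = (m, s)" "y = (m', s')" by (metis surj_pair)
    have "m = m'" if "s = s'"
    proof -
      have "m * q < Suc m' * q" "m' * q < Suc m * q"
        using xy that by (auto simp: e full_aps_def aps_def)
      hence "m < Suc m'" "m' < Suc m" using mult_less_cancel2 by blast+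
      thus ?thesis by simp
    qed
    thus "(snd x = snd y) = (x = y)" by (auto simp: e)
  next
    fix x assume x: "x \<in> full_aps n q"
    obtain m s where e: "x = (m, s)" by (metis surj_pair)
    have "1 \<le> m" "s + m * q \<le> n" "s < q" using x by (auto simp: e full_aps_def aps_def)
    moreover from this have "q \<le> m * q" by simp
    ultimately have "s < q" "s < n + 1 - q" by linarith+
    thus "snd x \<in> {..<min q (n + 1 - q)}" by (simp add: e)
  next
    fix s assume "s \<in> {..<min q (n + 1 - q)}"
    hence s: "s < q" "s + q \<le> n" by auto
    define m where "m = (n - s) div q"
    have d: "m * q + (n - s) mod q = n - s" by (simp add: m_def)
    have "q div q \<le> m" unfolding m_def using s by (intro div_le_mono) simp
    hence "1 \<le> m" using q by simp
    moreover have "s + m * q \<le> n" using d s by linarith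
    moreover have "(n - s) mod q < q" using q by simp
    hence "n < s + m * q + q" using d s by linarith
    ultimately show "\<exists>x\<in>full_aps n q. s = snd x" using s
      by (intro bexI[of _ "(m, s)"]) (auto simp: full_aps_def aps_def)
  qed
  thus ?thesis using bij_betw_same_card by fastforce
qed

text \<open>The meaning of \<open>f2\<close>: the cells beyond the first, summed over the
  progressions of difference q = l + 1. A progression that is not full has totient q - 1 of them, a
  full one totient q / 2 - 1.\<close>

lemma f2_eq:
  assumes q: "3 \<le> q" "q \<le> n"
  shows "f2 n (q - 1) = (real (card (aps n q)) - real (card (full_aps n q))) * (real (totient q) - 1)
     + real (card (full_aps n q)) * (real (totient q) / 2 - 1)"
proof -
  have "real (q - 1) = real q - 1" "q - 1 + 1 = q" using q by auto
  moreover have "real (card (full_aps n q)) = h n (q - 1)"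
    using q card_full_aps[of q n] by (auto simp: h_def min_def of_nat_diff)
  moreover have "real (card (aps n q)) = 1 / 2 * real (n div q) * g n (q - 1)"
    using q card_aps[of q n] by (simp add: g_def of_nat_diff)
  ultimately show ?thesis by (simp add: f2_def)
qed

section \<open>Thin sets and their surplus of cells\<close>

lemma thin_gap:
  assumes "thin n S" "x \<in> S" "y \<in> S" "x < y"
  shows "x + 3 \<le> y"
proof -
  obtain s q m where S: "S = ap s q m" and c: "m = 0 \<or> q \<ge> 3" using assms by (auto simp: thin_def)
  obtain k l where kl: "k \<le> m" "x = s + k * q" "l \<le> m" "y = s + l * q" using assms by (auto simp: S ap_def)
  have "k * q < l * q" using kl assms by simp
  hence "k < l" using mult_less_cancel2 by blast
  hence "Suc k * q \<le> l * q" by (intro mult_le_mono1) simp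
  moreover have "q \<ge> 3" using c kl \<open>k < l\<close> by auto
  ultimately show ?thesis using kl by simp
qed

text \<open>Two of the indices 0, 1, 2 lie on the same side, at distance less than 3.\<close>

lemma thin_compl_disjoint:
  assumes "n \<ge> 2" "thin n S" "thin n ({..n} - S)"
  shows False
proof -
  have "0 \<in> S \<or> 0 \<in> {..n} - S" "1 \<in> S \<or> 1 \<in> {..n} - S" "2 \<in> S \<or> 2 \<in> {..n} - S" using assms by auto
  thus False
    using thin_gap[OF assms(2), of 0 1] thin_gap[OF assms(2), of 0 2] thin_gap[OF assms(2), of 1 2]
      thin_gap[OF assms(3), of 0 1] thin_gap[OF assms(3), of 0 2] thin_gap[OF assms(3), of 1 2] by linarith
qed

lemma thin_sets:
  "{S. thin n S} = (\<lambda>i. {i}) ` {..n} \<union> (\<lambda>(q, m, s). ap s q m) ` (SIGMA q:{3..n}. aps n q)"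
proof (intro equalityI subsetI)
  fix S assume "S \<in> {S. thin n S}"
  then obtain s q m where sub: "S \<subseteq> {..n}" and S: "S = ap s q m" and c: "m = 0 \<or> q \<ge> 3" by (auto simp: thin_def)
  have l: "s + m * q \<le> n" "s \<le> n" using sub mem_apI[of m m s q] by (auto simp: S)
  show "S \<in> (\<lambda>i. {i}) ` {..n} \<union> (\<lambda>(q, m, s). ap s q m) ` (SIGMA q:{3..n}. aps n q)"
  proof (cases "m = 0")
    case True
    thus ?thesis using l by (auto simp: S ap_def)
  next
    case False
    hence "q \<le> m * q" by simp
    hence "q \<le> n" using l by linarith
    thus ?thesis using False c l
      by (intro UnI2 image_eqI[of _ _ "(q, m, s)"]) (auto simp: S aps_def)
  qed
next
  fix S assume "S \<in> (\<lambda>i. {i}) ` {..n} \<union> (\<lambda>(q, m, s). ap s q m) ` (SIGMA q:{3..n}. aps n q)"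
  thus "S \<in> {S. thin n S}"
  proof
    assume "S \<in> (\<lambda>i. {i}) ` {..n}"
    then obtain i where i: "i \<le> n" "S = {i}" by auto
    hence "S = ap i 1 0" by (simp add: ap_def)
    moreover have "S \<subseteq> {..n}" using i by simp
    ultimately show ?thesis unfolding thin_def by blast
  next
    assume "S \<in> (\<lambda>(q, m, s). ap s q m) ` (SIGMA q:{3..n}. aps n q)"
    then obtain q m s where *: "3 \<le> q" "s + m * q \<le> n" "S = ap s q m" by (auto simp: aps_def)
    have "S \<subseteq> {..n}" using * ap_le by (meson atMost_iff le_trans subsetI)
    thus ?thesis using * unfolding thin_def by blast
  qed
qed

lemma ap_inj:
  assumes "q \<ge> 1" "m \<ge> 1" "q' \<ge> 1" "m' \<ge> 1" and eq: "ap s q m = ap s' q' m'"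
  shows "s = s' \<and> q = q' \<and> m = m'"
proof -
  have lo: "ap s q m \<subseteq> {s..}" for s q m by (auto simp: ap_def)
  have "s \<in> ap s q m" "s' \<in> ap s' q' m'" using mem_apI[of 0 m s q] mem_apI[of 0 m' s' q'] by simp_all
  hence "s \<in> {s'..}" "s' \<in> {s..}" using lo[of s q m] lo[of s' q' m'] eq by blast+
  hence s: "s = s'" by simp
  have "consec (ap s q m) s (s + q)" "consec (ap s' q' m') s' (s' + q')"
    using consec_ap[of q 0 m s] consec_ap[of q' 0 m' s'] assms by auto
  hence q: "q = q'" using consec_succ_unique s eq by fastforce
  have "s + m * q \<in> ap s' q' m'" "s' + m' * q' \<in> ap s q m"
    using mem_apI[of m m s q] mem_apI[of m' m' s' q'] eq by auto
  from this[THEN ap_le] have "s + m * q \<le> s' + m' * q'" "s' + m' * q' \<le> s + m * q" .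
  hence "m * q \<le> m' * q" "m' * q \<le> m * q" unfolding s q by linarith+
  hence "m = m'" using assms(1) by simp
  thus ?thesis using s q assms by simp
qed

text \<open>After doubling, the singletons contribute \<open>f1 n\<close> for their cells and -2 (n
  + 1) for the subtracted ones; the progressions are grouped by their difference.\<close>

lemma sum_thin:
  assumes n: "n \<ge> 3"
  shows "2 * (\<Sum>S | thin n S. real (card (left_ends n S)) - 1) = real (f1 n) - 2 * (real n + 1)
     + 2 * (\<Sum>q=3..n. f2 n (q - 1))"
proof -
  define w where "w = (\<lambda>S. real (card (left_ends n S)) - 1)"
  define I where "I = (SIGMA q:{3..n}. aps n q)"
  define F where "F = (\<lambda>(q, m, s). ap s q m :: nat set)"
  have finI: "finite I" by (auto simp: I_def)
  have disj: "(\<lambda>i. {i}) ` {..n} \<inter> F ` I = {}"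
  proof -
    have False if "(q, m, s) \<in> I" "{i} = ap s q m" for i q m s
    proof -
      have "q \<ge> 3" "m \<ge> 1" using that(1) by (auto simp: I_def aps_def)
      hence "consec {i} s (s + q)" using consec_ap[of q 0 m s] that(2) by simp
      thus False by (auto simp: consec_def)
    qed
    thus ?thesis unfolding F_def by fast
  qed
  have "(\<Sum>S | thin n S. w S) = (\<Sum>S\<in>(\<lambda>i. {i}) ` {..n}. w S) + (\<Sum>S\<in>F ` I. w S)"
  proof -
    have "{S. thin n S} = (\<lambda>i. {i}) ` {..n} \<union> F ` I" unfolding F_def I_def by (rule thin_sets)
    thus ?thesis using disj finI by (simp add: sum.union_disjoint)
  qed
  also have "(\<Sum>S\<in>(\<lambda>i. {i}) ` {..n}. w S) = (\<Sum>i\<le>n. w {i})"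
    by (subst sum.reindex) auto
  also have "(\<Sum>S\<in>F ` I. w S) = (\<Sum>x\<in>I. w (F x))"
  proof (subst sum.reindex)
    show "inj_on F I"
    proof (rule inj_onI)
      fix x y assume xy: "x \<in> I" "y \<in> I" "F x = F y"
      obtain q m s q' m' s' where e: "x = (q, m, s)" "y = (q', m', s')" by (metis surj_pair)
      have "q \<ge> 1" "m \<ge> 1" "q' \<ge> 1" "m' \<ge> 1" "ap s q m = ap s' q' m'"
        using xy by (simp_all add: e I_def F_def aps_def)
      thus "x = y" using ap_inj e by blast
    qed
  qed simp
  also have "\<dots> = (\<Sum>q=3..n. \<Sum>(m, s)\<in>aps n q. w (ap s q m))"
  proof -
    have "(\<Sum>q=3..n. \<Sum>x\<in>aps n q. w (F (q, x))) = (\<Sum>(q, x)\<in>I. w (F (q, x)))"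
      unfolding I_def by (rule sum.Sigma) auto
    thus ?thesis by (simp add: F_def case_prod_unfold)
  qed
  also have "\<dots> = (\<Sum>q=3..n. f2 n (q - 1))"
  proof (rule sum.cong[OF refl])
    fix q assume "q \<in> {3..n}"
    hence q: "3 \<le> q" "q \<le> n" by auto
    define \<phi> where "\<phi> = real (totient q)"
    have fin: "finite (aps n q)" using q by simp
    have sub: "full_aps n q \<subseteq> aps n q" by (auto simp: full_aps_def)
    have "(\<Sum>(m, s)\<in>aps n q. w (ap s q m)) = (\<Sum>x\<in>aps n q. if x \<in> full_aps n q then \<phi> / 2 - 1 else \<phi> - 1)"
    proof (rule sum.cong[OF refl], safe)
      fix m s assume ms: "(m, s) \<in> aps n q"
      hence m: "m \<ge> 1" "s + m * q \<le> n" by (auto simp: aps_def)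
      show "w (ap s q m) = (if (m, s) \<in> full_aps n q then \<phi> / 2 - 1 else \<phi> - 1)"
      proof (cases "s < q \<and> n < s + m * q + q")
        case True
        hence "2 * card (left_ends n (ap s q m)) = totient q" using card_left_ends_ap_full[OF q(1) m] by simp
        hence "2 * real (card (left_ends n (ap s q m))) = \<phi>" unfolding \<phi>_def by (metis of_nat_mult of_nat_numeral)
        thus ?thesis using True ms by (simp add: full_aps_def w_def)
      next
        case False
        thus ?thesis using card_left_ends_ap_not_full[OF q(1) m False] by (auto simp: full_aps_def w_def \<phi>_def)
      qed
    qed
    also have "\<dots> = real (card (full_aps n q)) * (\<phi> / 2 - 1) + real (card (aps n q - full_aps n q)) * (\<phi> - 1)"
      using fin sub by (simp add: sum.If_cases Int_absorb1 Diff_eq[symmetric])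
    also have "real (card (aps n q - full_aps n q)) = real (card (aps n q)) - real (card (full_aps n q))"
      using fin sub by (simp add: card_Diff_subset finite_subset of_nat_diff card_mono)
    finally show "(\<Sum>(m, s)\<in>aps n q. w (ap s q m)) = f2 n (q - 1)"
      using f2_eq[OF q] by (simp add: \<phi>_def)
  qed
  finally have "2 * (\<Sum>S | thin n S. w S) = (\<Sum>i\<le>n. 2 * w {i}) + 2 * (\<Sum>q=3..n. f2 n (q - 1))"
    by (simp add: sum_distrib_left)
  also have "(\<Sum>i\<le>n. 2 * w {i}) = (\<Sum>i\<le>n. real (\<Sum>p=1..max i (n - i). totient p) - 2)"
  proof (rule sum.cong[OF refl])
    fix i assume "i \<in> {..n}"
    hence "2 * card (left_ends n {i}) = (\<Sum>p=1..max i (n - i). totient p)" using card_left_ends_singleton n by simp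
    from arg_cong[OF this, of real] show "2 * w {i} = real (\<Sum>p=1..max i (n - i). totient p) - 2"
      by (simp add: w_def)
  qed
  also have "\<dots> = real (f1 n) - 2 * (real n + 1)"
  proof -
    have "real (\<Sum>i\<le>n. \<Sum>p=1..max i (n - i). totient p) = real (f1 n)" using sum_max_eq_f1[of n] n by simp
    thus ?thesis by (simp add: sum_subtractf)
  qed
  finally show ?thesis by (simp add: w_def)
qed

text \<open>Makes the surplus of a thin set equal to its number of cells minus 1. For singletons,
  0/1 is a left end.\<close>

lemma thin_left_ends_nonempty:
  assumes n: "n \<ge> 3" and S: "thin n S"
  shows "left_ends n S \<noteq> {}"
proof -
  have "S \<in> (\<lambda>i. {i}) ` {..n} \<union> (\<lambda>(q, m, s). ap s q m) ` (SIGMA q:{3..n}. aps n q)"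
    using S thin_sets by blast
  thus ?thesis
  proof
    assume "S \<in> (\<lambda>i. {i}) ` {..n}"
    then obtain i where i: "i \<le> n" "S = {i}" by auto
    have "(0, 1) \<in> farey n" using n by (simp add: farey_def)
    hence "(0, 1) \<in> left_ends n {i}"
      using singleton_fnext[of "(0, 1)" n i] singleton_fval[of 0 1 n i] i n by (auto simp: left_ends_def)
    thus ?thesis using i by blast
  next
    assume "S \<in> (\<lambda>(q, m, s). ap s q m) ` (SIGMA q:{3..n}. aps n q)"
    then obtain q m s where *: "q \<ge> 3" "m \<ge> 1" "s + m * q \<le> n" "S = ap s q m" by (auto simp: aps_def)
    have "totient q > 0" using * by simp
    hence "card (left_ends n S) \<noteq> 0"
      using card_left_ends_ap_full[OF *(1-3)] card_left_ends_ap_not_full[OF *(1-3)] *(4)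
      by (cases "s < q \<and> n < s + m * q + q") auto
    thus ?thesis by auto
  qed
qed

text \<open>The surplus vanishes unless \<open>S\<close> or its complement is thin. Both cannot be,
  and complements have the same left ends, so the total surplus is twice the surplus of the thin
  sets.\<close>

lemma card_left_ends_sets:
  assumes n: "n \<ge> 3"
  shows "real (card {S \<in> Pow {..n}. left_ends n S \<noteq> {}}) =
    (\<Sum>S\<in>Pow {..n}. real (card (left_ends n S))) - 2 * (\<Sum>S | thin n S. real (card (left_ends n S)) - 1)"
proof -
  define E where "E = {S. thin n S}"
  define C where "C = (\<lambda>S. {..n} - S)"
  \<comment> \<open>The indicator in place of 1 makes \<open>w\<close> vanish for sets without cells
    too.\<close>
  define w where "w = (\<lambda>S. real (card (left_ends n S)) - of_bool (left_ends n S \<noteq> {}))"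
  have Esub: "E \<subseteq> Pow {..n}" by (auto simp: E_def thin_def)
  hence finE: "finite E" by (rule finite_subset) simp
  have "(\<Sum>S\<in>Pow {..n}. of_bool (left_ends n S \<noteq> {})) = real (card {S \<in> Pow {..n}. left_ends n S \<noteq> {}})"
    by (simp add: of_bool_def sum.If_cases Int_def)
  hence "(\<Sum>S\<in>Pow {..n}. w S) = (\<Sum>S\<in>Pow {..n}. real (card (left_ends n S))) - real (card {S \<in> Pow {..n}. left_ends n S \<noteq> {}})"
    by (simp add: w_def sum_subtractf)
  moreover have "(\<Sum>S\<in>Pow {..n}. w S) = (\<Sum>S\<in>E \<union> C ` E. w S)"
  proof (rule sum.mono_neutral_right)
    show "E \<union> C ` E \<subseteq> Pow {..n}" using Esub by (auto simp: C_def)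
    show "\<forall>S\<in>Pow {..n} - (E \<union> C ` E). w S = 0"
    proof
      fix S assume S: "S \<in> Pow {..n} - (E \<union> C ` E)"
      have nt: "\<not> thin n S" "\<not> thin n ({..n} - S)"
      proof -
        show "\<not> thin n S" using S by (simp add: E_def)
        have "S = C (C S)" using S by (auto simp: C_def)
        thus "\<not> thin n ({..n} - S)" using S by (auto simp: E_def C_def)
      qed
      show "w S = 0"
      proof (cases "left_ends n S = {}")
        case False
        hence pr: "proper n S" by (auto simp: left_ends_def rotset_def)
        have "n \<ge> 2" using n by simp
        from card_left_ends_generic[OF this pr False nt] show ?thesis using False by (simp add: w_def)
      qed (simp add: w_def)
    qed
  qed simp
  moreover have "(\<Sum>S\<in>E \<union> C ` E. w S) = (\<Sum>S\<in>E. w S) + (\<Sum>S\<in>C ` E. w S)"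
  proof (rule sum.union_disjoint)
    show "E \<inter> C ` E = {}"
    proof -
      have False if "S \<in> E" "C S \<in> E" for S
        using thin_compl_disjoint[of n S] n that by (simp add: E_def C_def)
      thus ?thesis by blast
    qed
  qed (use finE in auto)
  moreover have "(\<Sum>S\<in>C ` E. w S) = (\<Sum>S\<in>E. w S)"
  proof (subst sum.reindex)
    show "inj_on C E" using Esub unfolding C_def by (intro inj_onI) blast
    show "(\<Sum>S\<in>E. (w \<circ> C) S) = (\<Sum>S\<in>E. w S)"
    proof (rule sum.cong[OF refl])
      fix S assume "S \<in> E"
      hence "S \<subseteq> {..n}" using Esub by blast
      thus "(w \<circ> C) S = w S" using left_ends_compl by (simp add: w_def C_def)
    qed
  qed
  moreover have "(\<Sum>S\<in>E. w S) = (\<Sum>S\<in>E. real (card (left_ends n S)) - 1)"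
    using thin_left_ends_nonempty[OF n] by (intro sum.cong) (auto simp: E_def w_def)
  ultimately show ?thesis by (simp add: E_def)
qed

lemma sum_left_ends_total:
  assumes n: "n \<ge> 3"
  shows "(\<Sum>S\<in>Pow {..n}. real (card (left_ends n S))) = (real n)\<^sup>2 + real n
     + 1 / 2 * (\<Sum>p=3..n. real (totient p) * ((real n)\<^sup>2 - (real p)\<^sup>2 + real n + real p))"
proof -
  define c where "c = (\<lambda>q. (real n)\<^sup>2 - (real q)\<^sup>2 + real n + real q)"
  have "(\<Sum>S\<in>Pow {..n}. real (card (left_ends n S))) = real (\<Sum>(p, q)\<in>farey n. (n + 1) * n - q * (q - 1))"
    unfolding sum_card_left_ends[symmetric] by simp
  also have "\<dots> = real (\<Sum>q=1..n. card (halves q) * ((n + 1) * n - q * (q - 1)))"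
    using sum_farey[of "\<lambda>q. (n + 1) * n - q * (q - 1)" n] by simp
  also have "\<dots> = (\<Sum>q=1..n. real (card (halves q)) * c q)"
    unfolding of_nat_sum
  proof (rule sum.cong[OF refl])
    fix q assume q: "q \<in> {1..n}"
    hence "q * (q - 1) \<le> (n + 1) * n" by (intro mult_le_mono) auto
    hence "real ((n + 1) * n - q * (q - 1)) = real ((n + 1) * n) - real (q * (q - 1))" by (rule of_nat_diff)
    also have "\<dots> = c q" using q by (simp add: c_def of_nat_diff power2_eq_square algebra_simps)
    finally show "real (card (halves q) * ((n + 1) * n - q * (q - 1))) = real (card (halves q)) * c q" by simp
  qed
  also have "\<dots> = c 1 + (\<Sum>q=3..n. real (card (halves q)) * c q)"
  proof -
    \<comment> \<open>Denominator 1 contributes n^2 + n, denominator 2 nothing.\<close>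
    have "{1..n} = insert 1 (insert 2 {3..n})" using n by auto
    thus ?thesis using halves_1 halves_2 by simp
  qed
  also have "(\<Sum>q=3..n. real (card (halves q)) * c q) = (\<Sum>q=3..n. 1 / 2 * (real (totient q) * c q))"
  proof (rule sum.cong[OF refl])
    fix q assume "q \<in> {3..n}"
    hence "totient q = 2 * card (halves q)" using card_halves[of q] by simp
    thus "real (card (halves q)) * c q = 1 / 2 * (real (totient q) * c q)" by simp
  qed
  finally show ?thesis by (simp add: c_def sum_distrib_left)
qed

theorem theorem1:
  fixes n :: nat
  assumes "n \<ge> 3"
  shows "real (num_rotation_words (n + 1)) =
    (real n)^2 + 3 * real n + 4
    + 1 / 2 * (\<Sum>p=3..n. real (totient p) * ((real n)^2 - (real p)^2 + real n + real p))
    - real (f1 n)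
    - 2 * (\<Sum>l=2..n-1. f2 n l)"
proof -
  have "(\<Sum>l=2..n-1. f2 n l) = (\<Sum>q=3..n. f2 n (q - 1))"
    by (rule sum.reindex_bij_witness[of _ "\<lambda>q. q - 1" Suc]) (use assms in auto)
  moreover have "n \<ge> 2" using assms by simp
  \<comment> \<open>The polynomial part is (n^2 + n) + 2 (n + 1) + 2, from denominator 1, the
    singletons and the two constant words.\<close>
  ultimately show ?thesis
    using num_rotation_words_eq[of n] card_left_ends_sets[OF assms] sum_left_ends_total[OF assms] sum_thin[OF assms] by simp
qed

end
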